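(* For positive integers $\ell\le n$, let $\mathcal{T}_n(\ell)$ be the set of $n\times n$ SNFs with at most $\ell$ diagonal entries not equal to $1$. In what follows $p$ denotes a prime and $\prod_p$ a product over all primes. (i) $$\mu(\mathcal{T}_n(\ell))=\prod_pZ_n(p,\ell)=\frac{1}{\prod_{i=2}^{n}\zeta(i)}\prod_pY_n(p,\ell)=:Z_n(\ell),$$ where $$Z_n(p,\ell)=\mu_p(\mathcal{T}_n(\ell))=[p,n]\sum_{i=0}^{\ell}\frac{p^{-i^2}[p,n]}{[p,i]^2[p,n-i]},\qquad Y_n(p,\ell)=\frac{[p,1]}{[p,n]}Z_n(p,\ell)=[p,1]\sum_{i=0}^{\ell}\frac{p^{-i^2}[p,n]}{[p,i]^2[p,n-i]}.$$ (ii) $$Y_n(p,\ell)\uparrow[p,1]\sum_{i=0}^{\ell}\frac{p^{-i^2}}{[p,i]^2}=:Y(p,\ell)\ \text{ as } n\to\infty,\qquad Y(p,\ell)\uparrow\frac{[p,1]}{C_p}\ \text{ as }\ell\to\infty,$$ and $$\mu_p(\mathcal{T}_n(\ell))=Z_n(p,\ell)\to\frac{C_p}{[p,1]}Y(p,\ell)=C_p\sum_{i=0}^{\ell}\frac{p^{-i^2}}{[p,i]^2}=:Z(p,\ell)\ \text{ as } n\to\infty,$$ and then $Z(p,\ell)\uparrow1$ as $\ell\to\infty$. (iii) $$\mu(\mathcal{T}_n(\ell))=Z_n(\ell)\to\frac{1}{\prod_{i=2}^{\infty}\zeta(i)}\prod_pY(p,\ell)=\prod_pZ(p,\ell)=:Z(\ell)\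 \text{ as } n\to\infty,$$ and $Z(\ell)\uparrow1$ as $\ell\to\infty$. (iv) $$\lim_{n\to\infty}\mu_p(\mathcal{T}_n(\ell))=Z(p,\ell)=1-C_p^{-1}p^{-(\ell+1)^2}\left[1-\frac{2}{p^2-p}\cdot p^{-\ell}+O(p^{-2\ell})\right]\ \text{ as }\ell\to\infty;$$ more precisely, this $O(p^{-2\ell})$ term lies in $(0,2p^{-2\ell})$. (v) $$\lim_{n\to\infty}\mu(\mathcal{T}_n(\ell))=Z(\ell)=1-C_2^{-1}\cdot2^{-(\ell+1)^2}\left[1-2^{-\ell}+O(4^{-\ell})\right]\ \text{ as }\ell\to\infty,$$ where $C_2^{-1}\approx3.46275$. Parts (ii) and (iv), read as statements about the functions $Y_n,Y,Z_n,Z$ given by the formulas above, also hold with $p=1/x$ for any real $x\in(0,1/2]$.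
   Context: $\zeta$ is the Riemann zeta function. $\uparrow$ denotes monotone increasing convergence. For real $q\ge2$ (a prime $p$, or $q=1/x$ with $x\in(0,1/2]$), $[q,0]=1$, $[q,\ell]=\prod_{j=1}^{\ell}(1-q^{-j})$ for $\ell\ge1$, and $C_q=\prod_{j=1}^{\infty}(1-q^{-j})$. For a positive integer $k$, $\mathbb{Z}_{(k)}=\{-k,\dots,k\}$. The Smith normal form (SNF) of an $n\times n$ matrix $M$ over $\mathbb{Z}$ or $\mathbb{Z}/p\mathbb{Z}$ is the diagonal matrix $PMQ$ ($P,Q$ invertible) with diagonal entries $d_1\mid d_2\mid\cdots\mid d_n$ (trailing entries may be $0$), unique up to units and taken nonnegative over $\mathbb{Z}$. For a set $\mathcal{S}$ of integer diagonal matrices of this form, $\mu^{(k)}(\mathcal{S})$ is the probability that $\mathrm{SNF}(M)\in\mathcal{S}$ for a random $n\times n$ matrix $M$ with independent entries uniform on $\mathbb{Z}_{(k)}$, and $\mu(\mathcal{S})=\lim_{k\to\infty}\mu^{(k)}(\mathcal{S})$ if the limit exists (for $\mathcal{T}_n(\ell)$ its existence is part of the claim). For a prime $p$, $\mu_p(\mathcal{S})$ is the probability, for an $n\times n$ matrix $M$ with independent entries uniform on $\mathbb{Z}/p\mathbb{Z}$, that some $D\in\mathcal{S}$ has, mod $p$, the same diagonal entries as $\mathrm{SNF}(M)$ up to units; thus $\mu_p(\mathcal{T}_n(\ell))$ is the probability that $M$ has rank at least $n-\ell$ over $\mathbb{Z}/p\mathbb{Z}$. *)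

theory Defs
  imports
    "HOL-Probability.Product_PMF"
    "HOL-Number_Theory.Cong"
    "HOL-Library.Landau_Symbols"
    "Jordan_Normal_Form.Matrix"
begin

text \<open>The Riemann zeta function on its half-line \<open>s > 1\<close> of convergence
  (it is only used at integers \<open>s \<ge> 2\<close>).\<close>

definition zeta :: "real \<Rightarrow> real" where
  "zeta s = (\<Sum>n. 1 / real (Suc n) powr s)"

text \<open>A product over all primes \<open>p\<close> of \<open>f p\<close> is the infinite product, in increasing order of the
  index, of the following sequence.\<close>

definition over_primes :: "(nat \<Rightarrow> real) \<Rightarrow> nat \<Rightarrow> real" where
  "over_primes f = (\<lambda>p. if prime p then f p else 1)"

text \<open>Monotone increasing convergence of a sequence that starts at index \<open>a\<close>.\<close>

definition increases_to :: "nat \<Rightarrow> (nat \<Rightarrow> real) \<Rightarrow> real \<Rightarrow> bool" where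
  "increases_to a f L \<longleftrightarrow> mono_on {a..} f \<and> f \<longlonglongrightarrow> L"

definition random_mat :: "nat \<Rightarrow> int set \<Rightarrow> int mat pmf" where
  "random_mat n A = map_pmf (mat n n) (Pi_pmf ({..<n} \<times> {..<n}) 0 (\<lambda>_. pmf_of_set A))"

definition smith_form :: "nat \<Rightarrow> int mat \<Rightarrow> bool" where
  "smith_form n D \<longleftrightarrow> D \<in> carrier_mat n n \<and> diagonal_mat D \<and>
     (\<forall>i<n. 0 \<le> D $$ (i, i)) \<and>
     (\<forall>i. Suc i < n \<longrightarrow> D $$ (i, i) dvd D $$ (Suc i, Suc i))"

definition is_snf :: "nat \<Rightarrow> int mat \<Rightarrow> int mat \<Rightarrow> bool" where
  "is_snf n M D \<longleftrightarrow> smith_form n D \<and>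
     (\<exists>P\<in>carrier_mat n n. \<exists>Q\<in>carrier_mat n n.
        invertible_mat P \<and> invertible_mat Q \<and> D = P * M * Q)"

text \<open>The condition that the Smith normal form of \<open>M\<close> lies in \<open>S\<close> is expressed through the
  relation \<^const>\<open>is_snf\<close>, the Smith normal form over the integers being unique.\<close>

definition mu_box :: "nat \<Rightarrow> nat \<Rightarrow> int mat set \<Rightarrow> real" where
  "mu_box k n S =
     measure_pmf.prob (random_mat n {- int k..int k}) {M. \<exists>D\<in>S. is_snf n M D}"

definition mu :: "nat \<Rightarrow> int mat set \<Rightarrow> real" where
  "mu n S = lim (\<lambda>k. mu_box k n S)"

text \<open>The modulus \<open>p\<close> ranges over all primes inside one statement, so matrices over
  \<open>\<int>/p\<int>\<close> are represented by integer matrices, with equality read as entrywise congruence.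
  Any representatives may be used; the random matrix uses \<open>{0..<p}\<close>.\<close>

definition mat_cong :: "nat \<Rightarrow> nat \<Rightarrow> int mat \<Rightarrow> int mat \<Rightarrow> bool" where
  "mat_cong p n A B \<longleftrightarrow> (\<forall>i<n. \<forall>j<n. [A $$ (i, j) = B $$ (i, j)] (mod int p))"

definition invertible_mod :: "nat \<Rightarrow> nat \<Rightarrow> int mat \<Rightarrow> bool" where
  "invertible_mod p n A \<longleftrightarrow>
     (\<exists>B\<in>carrier_mat n n. mat_cong p n (A * B) (1\<^sub>m n) \<and> mat_cong p n (B * A) (1\<^sub>m n))"

definition smith_form_mod :: "nat \<Rightarrow> nat \<Rightarrow> int mat \<Rightarrow> bool" where
  "smith_form_mod p n D \<longleftrightarrow> D \<in> carrier_mat n n \<and>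
     (\<forall>i<n. \<forall>j<n. i \<noteq> j \<longrightarrow> [D $$ (i, j) = 0] (mod int p)) \<and>
     (\<forall>i. Suc i < n \<longrightarrow> (\<exists>c. [D $$ (Suc i, Suc i) = D $$ (i, i) * c] (mod int p)))"

definition is_snf_mod :: "nat \<Rightarrow> nat \<Rightarrow> int mat \<Rightarrow> int mat \<Rightarrow> bool" where
  "is_snf_mod p n M D \<longleftrightarrow> smith_form_mod p n D \<and>
     (\<exists>P\<in>carrier_mat n n. \<exists>Q\<in>carrier_mat n n.
        invertible_mod p n P \<and> invertible_mod p n Q \<and> mat_cong p n D (P * M * Q))"

definition same_diagonal_mod :: "nat \<Rightarrow> nat \<Rightarrow> int mat \<Rightarrow> int mat \<Rightarrow> bool" where
  "same_diagonal_mod p n D E \<longleftrightarrow>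
     (\<forall>i<n. \<exists>u. coprime u (int p) \<and> [D $$ (i, i) = u * E $$ (i, i)] (mod int p))"

definition mu_mod :: "nat \<Rightarrow> nat \<Rightarrow> int mat set \<Rightarrow> real" where
  "mu_mod p n S =
     measure_pmf.prob (random_mat n {0..<int p})
       {M. \<exists>D\<in>S. \<exists>E. is_snf_mod p n M E \<and> same_diagonal_mod p n D E}"

definition snf_T :: "nat \<Rightarrow> nat \<Rightarrow> int mat set" where
  "snf_T n l = {D. smith_form n D \<and> card {i. i < n \<and> D $$ (i, i) \<noteq> 1} \<le> l}"

definition qbr :: "real \<Rightarrow> nat \<Rightarrow> real" where
  "qbr q l = (\<Prod>j=1..l. 1 - 1 / q ^ j)"

definition qC :: "real \<Rightarrow> real" where
  "qC q = (\<Prod>j. 1 - 1 / q ^ Suc j)"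

text \<open>\<open>Zn\<close>, \<open>Yn\<close>, \<open>Zn_all\<close> are meaningful for \<open>l \<le> n\<close> only
  (the subtraction \<open>n - i\<close> truncates).\<close>

definition Zn :: "nat \<Rightarrow> real \<Rightarrow> nat \<Rightarrow> real" where
  "Zn n q l = qbr q n *
     (\<Sum>i=0..l. 1 / q ^ (i^2) * qbr q n / ((qbr q i)^2 * qbr q (n - i)))"

definition Yn :: "nat \<Rightarrow> real \<Rightarrow> nat \<Rightarrow> real" where
  "Yn n q l = qbr q 1 / qbr q n * Zn n q l"

definition Y :: "real \<Rightarrow> nat \<Rightarrow> real" where
  "Y q l = qbr q 1 * (\<Sum>i=0..l. 1 / q ^ (i^2) / (qbr q i)^2)"

definition Z :: "real \<Rightarrow> nat \<Rightarrow> real" where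
  "Z q l = qC q * (\<Sum>i=0..l. 1 / q ^ (i^2) / (qbr q i)^2)"

definition Zn_all :: "nat \<Rightarrow> nat \<Rightarrow> real" where
  "Zn_all n l = prodinf (over_primes (\<lambda>p. Zn n (real p) l))"

definition Z_all :: "nat \<Rightarrow> real" where
  "Z_all l = prodinf (over_primes (\<lambda>p. Z (real p) l))"

end

theory Submission
  imports
    Defs
    "HOL-Real_Asymp.Real_Asymp"
    "Jordan_Normal_Form.Gauss_Jordan_Elimination"
    "Jordan_Normal_Form.Determinant"
begin

text \<open>
  An integer matrix has at most \<open>l\<close> invariant factors different from \<open>1\<close> iff its rank modulo every
  prime is at least \<open>n - l\<close>. The rank is encoded by the number of elements of the column space
  modulo \<open>p\<close>; revealing the columns one at a time gives a recursion for its distribution, solved by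
  the product formula \<open>rank_prob\<close>, and that its values sum to \<open>1\<close> (for every real \<open>q\<close>) yields
  Euler's identity \<open>\<Sum>i. q^(-i^2) / [q,i]^2 = 1 / C_q\<close> in the limit.

  For finitely many primes the densities multiply by the Chinese remainder theorem. The large primes
  are negligible because \<open>l \<ge> 1\<close>: a matrix whose rank drops by two modulo \<open>p\<close> has two
  maximal minors of an \<open>n \<times> (n - 1)\<close> block vanishing modulo \<open>p\<close>. These are the values of one linear
  form at two independent random rows, so for \<open>p\<close> up to the box size this has probability
  \<open>O(1/p^2)\<close>; larger primes must divide the first value, and a nonzero value has boundedly many such
  prime factors.
  The coefficients of the linear form are minors of a smaller block, and one recurses when they all vanish.
\<close>

section \<open>Infinite products and the rank distribution\<close>

text \<open>Equidistribution of a box concerns one fixed modulus, whereas the Smith form involves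
  all primes at once. So the primes up to a bound B are treated with B fixed while the box grows,
  and B tends to infinity only afterwards. This is legitimate because the bound for the primes above
  B is a sum of two parts: one does not depend on the box and tends to 0 with growing B, the other
  tends to 0 with growing box. The same exchange of limits occurs in the products over primes. Their
  factors are at least 1 - c / p^2 with one constant c for all n and l \<ge> 1, so limits in n and l
  may be taken factor by factor. For real q nothing can be counted, hence the recursion for
  \<open>rank_prob\<close> is verified as an algebraic identity, and only for primes is it matched
  with a count of matrices. Since p varies inside one formula, no type of residues modulo p is
  available; linear algebra over Z/p is done with integer vectors reduced to {0..<p}.\<close>

locale unit_factors =
  fixes f b :: "nat \<Rightarrow> real"
  assumes pos: "0 < f n" and le_1: "f n \<le> 1" and bound: "1 - f n \<le> b n" and summ: "summable b"
begin

lemma b_nonneg: "0 \<le> b n"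
  using le_1[of n] bound[of n] by linarith

lemma convergent: "convergent_prod f"
proof -
  have "summable (\<lambda>n. norm (f n - 1))"
    by (rule summable_comparison_test'[OF summ, of 0]) (use le_1 bound in auto)
  then show ?thesis
    by (intro abs_convergent_prod_imp_convergent_prod summable_imp_abs_convergent_prod)
qed

lemma tendsto: "(\<lambda>N. \<Prod>i<N. f i) \<longlonglongrightarrow> prodinf f"
  using convergent_prod_LIMSEQ[OF convergent] by (simp add: lessThan_Suc_atMost flip: LIMSEQ_lessThan_iff_atMost)

lemma prodinf_pos: "0 < prodinf f"
proof -
  have "prodinf f \<noteq> 0"
    using prodinf_nonzero[OF convergent] pos by (metis less_irrefl)
  moreover have "0 \<le> prodinf f"
    using LIMSEQ_le_const[OF tendsto, of 0] pos by (simp add: prod_nonneg less_imp_le)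
  ultimately show ?thesis by linarith
qed

lemma partial_ge: "prodinf f \<le> (\<Prod>i<N. f i)"
proof (rule LIMSEQ_le_const2[OF tendsto], intro exI allI impI)
  fix M assume "M \<ge> N"
  then show "(\<Prod>i<M. f i) \<le> (\<Prod>i<N. f i)"
  proof (induction M rule: dec_induct)
    case (step M)
    have "(\<Prod>i<Suc M. f i) \<le> (\<Prod>i<M. f i) * 1"
      unfolding prod.lessThan_Suc by (intro mult_left_mono le_1 prod_nonneg) (use pos less_imp_le in auto)
    with step show ?case by simp
  qed simp
qed

text \<open>Weierstrass' inequality bounds the product of the factors from N on below by 1 minus
  their tail sum, and the first N factors multiply to at most 1. The error depends on
  \<open>f\<close> only through \<open>b\<close>, so families with a common \<open>b\<close>
  converge uniformly.\<close>

lemma partial_le: "(\<Prod>i<N. f i) - (\<Sum>i. b (i + N)) \<le> prodinf f"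
proof (rule LIMSEQ_le_const[OF LIMSEQ_ignore_initial_segment[OF tendsto, of N]], intro exI allI impI)
  fix M :: nat
  have sN: "summable (\<lambda>i. b (i + N))" using summ by simp
  have "1 - (\<Sum>i<M. 1 - f (i + N)) \<le> (\<Prod>i<M. 1 - (1 - f (i + N)))"
    by (rule Weierstrass_prod_ineq) (use pos le_1 less_imp_le in auto)
  moreover have "(\<Sum>i<M. 1 - f (i + N)) \<le> (\<Sum>i<M. b (i + N))"
    by (intro sum_mono bound)
  moreover have "(\<Sum>i<M. b (i + N)) \<le> (\<Sum>i. b (i + N))"
    by (rule sum_le_suminf[OF sN]) (use b_nonneg in auto)
  ultimately have 1: "1 - (\<Sum>i. b (i + N)) \<le> (\<Prod>i<M. f (i + N))" by simp
  have S: "(\<Sum>i. b (i + N)) \<ge> 0" by (rule suminf_nonneg[OF sN]) (rule b_nonneg)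
  have P: "0 \<le> (\<Prod>i<N. f i)" "(\<Prod>i<N. f i) \<le> 1"
    by (auto intro!: prod_nonneg prod_le_1 less_imp_le[OF pos] le_1)
  have "(\<Prod>i<M+N. f i) = (\<Prod>i<N. f i) * (\<Prod>i<M. f (i + N))"
    by (induction M) (simp_all add: ac_simps)
  moreover have "(\<Prod>i<N. f i) * (1 - (\<Sum>i. b (i + N))) \<le> (\<Prod>i<N. f i) * (\<Prod>i<M. f (i + N))"
    by (intro mult_left_mono 1 P)
  moreover have "(\<Prod>i<N. f i) * (\<Sum>i. b (i + N)) \<le> 1 * (\<Sum>i. b (i + N))"
    by (intro mult_right_mono P S)
  ultimately show "(\<Prod>i<N. f i) - (\<Sum>i. b (i + N)) \<le> (\<Prod>i<M+N. f i)"
    by (simp add: algebra_simps)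
qed

end

text \<open>Tannery's theorem for infinite products with factors in \<open>(0, 1]\<close>.\<close>

lemma tendsto_prodinf:
  fixes f :: "nat \<Rightarrow> nat \<Rightarrow> real"
  assumes f: "\<And>n. unit_factors (f n) b" and g: "unit_factors g b"
    and lim: "\<And>i. (\<lambda>n. f n i) \<longlonglongrightarrow> g i"
  shows "(\<lambda>n. prodinf (f n)) \<longlonglongrightarrow> prodinf g"
proof (rule swap_uniform_limit')
  show "\<forall>\<^sub>F N in sequentially. (\<lambda>n. \<Prod>i<N. f n i) \<longlonglongrightarrow> (\<Prod>i<N. g i)"
    by (intro always_eventually allI tendsto_prod lim)
  show "(\<lambda>N. \<Prod>i<N. g i) \<longlonglongrightarrow> prodinf g" by (rule unit_factors.tendsto[OF g])
  show "uniform_limit UNIV (\<lambda>N n. \<Prod>i<N. f n i) (\<lambda>n. prodinf (f n)) sequentially"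
  proof (rule uniform_limitI)
    fix e :: real assume "e > 0"
    have "(\<lambda>N. \<Sum>i. b (i + N)) \<longlonglongrightarrow> 0"
      by (rule suminf_exist_split2) (rule unit_factors.summ[OF g])
    from order_tendstoD(2)[OF this \<open>e > 0\<close>]
    show "\<forall>\<^sub>F N in sequentially. \<forall>n\<in>UNIV. dist (\<Prod>i<N. f n i) (prodinf (f n)) < e"
    proof eventually_elim
      case (elim N)
      show ?case
      proof
        fix n
        show "dist (\<Prod>i<N. f n i) (prodinf (f n)) < e"
          using unit_factors.partial_ge[OF f, of n N] unit_factors.partial_le[OF f, of n N] elim
          by (simp add: dist_real_def)
      qed
    qed
  qed
qed auto

section \<open>The finite products [q,l] and their limit C_q\<close>

lemma qbr_0 [simp]: "qbr q 0 = 1"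
  by (simp add: qbr_def)

lemma qbr_Suc: "qbr q (Suc l) = qbr q l * (1 - 1 / q ^ Suc l)"
  by (simp add: qbr_def)

lemma qbr_altdef: "qbr q l = (\<Prod>j<l. 1 - 1 / q ^ Suc j)"
  by (induction l) (simp_all add: qbr_Suc)

text \<open>The probability that a uniformly random \<open>n \<times> m\<close> matrix over a field with \<open>q\<close>
  elements has rank \<open>r\<close>.\<close>

definition rank_prob :: "real \<Rightarrow> nat \<Rightarrow> nat \<Rightarrow> nat \<Rightarrow> real" where
  "rank_prob q n m r = (if r \<le> n \<and> r \<le> m
     then qbr q n * qbr q m / (q ^ ((n - r) * (m - r)) * qbr q (n - r) * qbr q (m - r) * qbr q r)
     else 0)"

context
  fixes q :: real
  assumes q: "q \<ge> 2"
begin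

lemma inv_pow_less_1: "1 / q ^ Suc j < 1"
  using q one_less_power[of q "Suc j"] by (simp add: divide_simps)

lemma inv_pow_pos: "0 < 1 / q ^ j"
  using q by simp

lemma qbr_pos: "0 < qbr q l"
  unfolding qbr_altdef by (rule prod_pos) (use inv_pow_less_1 in \<open>simp add: less_diff_eq\<close>)

lemma qbr_Suc_le: "qbr q (Suc l) \<le> qbr q l"
proof -
  have "qbr q (Suc l) \<le> qbr q l * 1"
    unfolding qbr_Suc by (intro mult_left_mono) (use qbr_pos[of l] inv_pow_pos[of "Suc l"] in auto)
  then show ?thesis by simp
qed

lemma qbr_antimono: "l \<le> m \<Longrightarrow> qbr q m \<le> qbr q l"
  using lift_Suc_antimono_le[of "qbr q"] qbr_Suc_le by blast

lemma qbr_le_1: "qbr q l \<le> 1"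
  using qbr_antimono[of 0 l] by simp

lemma summable_inv_pow: "summable (\<lambda>j. 1 / q ^ Suc j)"
proof -
  have "summable (\<lambda>j. (1 / q) ^ Suc j)"
    by (subst summable_Suc_iff, rule summable_geometric) (use q in auto)
  then show ?thesis by (simp add: power_divide)
qed

lemma unit_factors_qC: "unit_factors (\<lambda>j. 1 - 1 / q ^ Suc j) (\<lambda>j. 1 / q ^ Suc j)"
proof
  show "1 - 1 / q ^ Suc n \<le> 1" for n using inv_pow_pos[of "Suc n"] by linarith
qed (use inv_pow_less_1 summable_inv_pow in auto)

lemma qbr_tendsto: "qbr q \<longlonglongrightarrow> qC q"
  using unit_factors.tendsto[OF unit_factors_qC] unfolding qC_def qbr_altdef[abs_def] .

lemma qC_pos: "0 < qC q"
  using unit_factors.prodinf_pos[OF unit_factors_qC] by (simp add: qC_def)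

lemma qC_le_qbr: "qC q \<le> qbr q l"
  using unit_factors.partial_ge[OF unit_factors_qC] unfolding qC_def qbr_altdef .

lemma inv_pow_sum:
  "(\<Sum>j<N. 1 / q ^ Suc (a + j)) = (1 / q ^ a - 1 / q ^ (a + N)) / (q - 1)"
proof (induction N)
  case (Suc N)
  then show ?case using q by (simp add: divide_simps power_add) (simp add: algebra_simps)
qed simp

lemma qbr_split: "qbr q (a + N) = qbr q a * (\<Prod>j<N. 1 - 1 / q ^ Suc (a + j))"
  by (induction N) (simp_all add: qbr_Suc)

text \<open>Weierstrass' inequality here and 1 + x \<le> e^x in \<open>qbr_ratio_le\<close> give
  bounds for [q,a+N] / [q,a] that agree to first order. Their common linear term becomes the
  correction term in the expansion of \<open>Z\<close>.\<close>

lemma qbr_ratio_ge: "1 - (1 / q ^ a) / (q - 1) \<le> qbr q (a + N) / qbr q a"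
proof -
  have "1 - (\<Sum>j<N. 1 / q ^ Suc (a + j)) \<le> (\<Prod>j<N. 1 - 1 / q ^ Suc (a + j))"
    by (rule Weierstrass_prod_ineq) (metis atLeastAtMost_iff inv_pow_less_1 inv_pow_pos less_imp_le)
  moreover have "(\<Sum>j<N. 1 / q ^ Suc (a + j)) \<le> (1 / q ^ a) / (q - 1)"
    unfolding inv_pow_sum by (rule divide_right_mono) (use q in auto)
  ultimately show ?thesis using qbr_pos[of a] by (simp add: qbr_split)
qed

lemma qbr_ratio_le: "qbr q (a + N) / qbr q a \<le> exp (- ((1 / q ^ a - 1 / q ^ (a + N)) / (q - 1)))"
proof -
  have "(\<Prod>j<N. 1 - 1 / q ^ Suc (a + j)) \<le> (\<Prod>j<N. exp (- (1 / q ^ Suc (a + j))))"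
    by (rule prod_mono) (use inv_pow_less_1 exp_ge_add_one_self[of "- (1 / q ^ Suc (a + _))"] less_imp_le in auto)
  also have "\<dots> = exp (\<Sum>j<N. - (1 / q ^ Suc (a + j)))"
    by (simp only: exp_sum finite_lessThan)
  finally show ?thesis using qbr_pos[of a] by (simp add: qbr_split sum_negf inv_pow_sum del: power_Suc)
qed

lemma inv_pow_tendsto_0: "(\<lambda>N. 1 / q ^ (a + N)) \<longlonglongrightarrow> 0"
proof -
  have "(\<lambda>N. (1 / q) ^ a * (1 / q) ^ N) \<longlonglongrightarrow> (1 / q) ^ a * 0"
    by (intro tendsto_mult tendsto_const LIMSEQ_power_zero) (use q in auto)
  then show ?thesis by (simp add: power_divide power_add)
qed

lemma qC_ratio_tendsto: "(\<lambda>N. qbr q (a + N) / qbr q a) \<longlonglongrightarrow> qC q / qbr q a"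
proof -
  have "(\<lambda>N. qbr q (a + N)) \<longlonglongrightarrow> qC q"
    using LIMSEQ_ignore_initial_segment[OF qbr_tendsto, of a] by (simp add: add.commute)
  then show ?thesis by (intro tendsto_divide tendsto_const) (use qbr_pos[of a] in auto)
qed

lemma qC_ratio_ge: "1 - (1 / q ^ a) / (q - 1) \<le> qC q / qbr q a"
  by (rule LIMSEQ_le_const[OF qC_ratio_tendsto]) (use qbr_ratio_ge in auto)

lemma qC_ratio_le: "qC q / qbr q a \<le> exp (- ((1 / q ^ a) / (q - 1)))"
proof -
  have "(\<lambda>N. exp (- ((1 / q ^ a - 1 / q ^ (a + N)) / (q - 1)))) \<longlonglongrightarrow> exp (- ((1 / q ^ a - 0) / (q - 1)))"
    by (intro tendsto_intros inv_pow_tendsto_0) (use q in auto)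
  from LIMSEQ_le[OF qC_ratio_tendsto this] qbr_ratio_le show ?thesis by simp
qed

lemma qbr_ratio_1_ge:
  assumes "n \<ge> 1"
  shows "1 - 2 / q\<^sup>2 \<le> qbr q n / qbr q 1"
proof -
  have "1 - (1 / q ^ 1) / (q - 1) \<le> qbr q n / qbr q 1"
    using qbr_ratio_ge[of 1 "n - 1"] assms by simp
  moreover have "(1 / q ^ 1) / (q - 1) \<le> 2 / q\<^sup>2"
    using q by (simp add: divide_simps power2_eq_square)
  ultimately show ?thesis by linarith
qed

text \<open>The product splits into [q,1] = 1 - 1/q and [q,n] / [q,1], and each factor is at least
  1/2 for q \<ge> 2. The square of 4 is the constant 16 in \<open>durfee_term_le\<close>.\<close>

lemma qbr_ge: "1 / 4 \<le> qbr q n"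
proof (cases "n = 0")
  case False
  have q2: "q\<^sup>2 \<ge> 4" using power_mono[OF q, of 2] by simp
  have "qbr q n / qbr q 1 \<ge> 1 - 2 / q\<^sup>2" using False by (intro qbr_ratio_1_ge) simp
  moreover have "2 / q\<^sup>2 \<le> 1/2" using q2 by (simp add: divide_simps)
  ultimately have "qbr q n / qbr q 1 \<ge> 1/2" by linarith
  moreover have "qbr q 1 \<ge> 1/2" using q by (simp add: qbr_def divide_simps)
  ultimately have "(1/2) * (1/2) \<le> qbr q n / qbr q 1 * qbr q 1"
    by (intro mult_mono) auto
  then show ?thesis using qbr_pos[of 1] by simp
qed simp

section \<open>The recursion of the rank distribution in the number of columns\<close>

lemma rank_prob_Suc_0: "rank_prob q n (Suc m) 0 = rank_prob q n m 0 / q ^ n"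
  using qbr_pos[of n] qbr_pos[of m] qbr_pos[of "Suc m"] q
  by (simp add: rank_prob_def power_add)

lemma rank_prob_Suc_Suc:
  assumes "Suc r \<le> n"
  shows "rank_prob q n (Suc m) (Suc r)
    = rank_prob q n m (Suc r) / q ^ (n - Suc r) + rank_prob q n m r * (1 - 1 / q ^ (n - r))"
proof -
  obtain a where n: "n = Suc r + a" using assms le_Suc_ex by blast
  note pos = qbr_pos[of n] qbr_pos[of m] qbr_pos[of r] qbr_pos[of a]
  have Suc_pos: "1 - 1 / q ^ Suc j > 0" for j
    using inv_pow_less_1[of j] by simp
  consider "m < r" | "m = r" | d where "m = Suc r + d"
    by (metis add_Suc less_iff_Suc_add linorder_neqE_nat)
  then show ?thesis
  proof cases
    case 1
    then show ?thesis by (simp add: rank_prob_def)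
  next
    case 2
    define x where "x = 1 - 1 / q ^ Suc a"
    have "x > 0" "qbr q (Suc a) = qbr q a * x" using Suc_pos[of a] by (simp_all add: x_def qbr_Suc)
    then show ?thesis using 2 pos qbr_pos[of "Suc r"]
      by (simp add: rank_prob_def n flip: x_def power_Suc)
  next
    case 3
    \<comment> \<open>After the common factor \<open>K\<close> is taken out, the recursion is this
      identity, where m + 1 = (d + 1) + (r + 1).\<close>
    have eq: "(1 - 1 / q ^ Suc m) = (1 - 1 / q ^ Suc d) + 1 / q ^ Suc d * (1 - 1 / q ^ Suc r)"
      using q by (simp add: 3 field_simps power_add)
    define K where "K = qbr q n * qbr q m / (q ^ (a * Suc d) * qbr q a * qbr q (Suc d) * qbr q (Suc r))"
    have lhs: "rank_prob q n (Suc m) (Suc r) = K * (1 - 1 / q ^ Suc m)"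
      by (simp add: rank_prob_def n 3 K_def qbr_Suc[of q "Suc (r + d)"] flip: qbr_Suc)
    have r1: "rank_prob q n m (Suc r) / q ^ (n - Suc r) = K * (1 - 1 / q ^ Suc d)"
      using q pos Suc_pos[of d] qbr_pos[of d]
      by (simp add: rank_prob_def n 3 K_def qbr_Suc[of q d] power_add mult.commute)
    have r2: "rank_prob q n m r * (1 - 1 / q ^ (n - r)) = K * (1 / q ^ Suc d * (1 - 1 / q ^ Suc r))"
    proof -
      define x y where "x = 1 - 1 / q ^ Suc a" and "y = 1 - 1 / q ^ Suc r"
      have "x > 0" "y > 0" "qbr q (Suc a) = qbr q a * x" "qbr q (Suc r) = qbr q r * y"
        using Suc_pos by (simp_all add: x_def y_def qbr_Suc)
      moreover have "q ^ (Suc a * Suc d) = q ^ (a * Suc d) * q ^ Suc d"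
        by (simp only: mult_Suc power_add mult.commute)
      moreover have "n - r = Suc a" "m - r = Suc d" by (simp_all add: n 3)
      ultimately show ?thesis using q pos qbr_pos[of "Suc d"]
        by (simp add: rank_prob_def K_def n 3 flip: x_def y_def power_Suc)
    qed
    show ?thesis unfolding lhs r1 r2 eq by (simp only: distrib_left)
  qed
qed

text \<open>A step of the recursion moves the share 1 - q^-(n - r) of the mass at r to r + 1 and
  keeps the rest, so the total mass is preserved.\<close>

lemma sum_rank_prob: "(\<Sum>r\<le>n. rank_prob q n m r) = 1"
proof (induction m)
  case 0
  have "(\<Sum>r\<le>n. rank_prob q n 0 r) = (\<Sum>r\<in>{0}. rank_prob q n 0 r)"
    by (rule sum.mono_neutral_right) (auto simp: rank_prob_def)
  then show ?case using qbr_pos[of n] by (simp add: rank_prob_def)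
next
  case (Suc m)
  define P where "P = rank_prob q n m"
  have "(\<Sum>r\<le>n. rank_prob q n (Suc m) r)
      = P 0 / q ^ n + (\<Sum>r<n. P (Suc r) / q ^ (n - Suc r) + P r * (1 - 1 / q ^ (n - r)))"
    unfolding sum.atMost_shift rank_prob_Suc_0 P_def
    by (simp add: rank_prob_Suc_Suc)
  also have "\<dots> = (\<Sum>r\<le>n. P r / q ^ (n - r)) + (\<Sum>r<n. P r * (1 - 1 / q ^ (n - r)))"
    by (simp add: sum.distrib sum.atMost_shift)
  \<comment> \<open>The summand r = n is 0 because 1 - 1 / q ^ 0 = 0: full row rank cannot
    grow.\<close>
  also have "(\<Sum>r<n. P r * (1 - 1 / q ^ (n - r))) = (\<Sum>r\<le>n. P r * (1 - 1 / q ^ (n - r)))"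
    by (simp add: lessThan_Suc_atMost[symmetric])
  also have "(\<Sum>r\<le>n. P r / q ^ (n - r)) + \<dots> = (\<Sum>r\<le>n. P r)"
    by (simp add: right_diff_distrib sum_subtractf)
  finally show ?case using Suc by (simp add: P_def)
qed

end

text \<open>With x = 1/q this is the generating function of the partitions whose Durfee square has
  side i; the sum over i is the generating function 1 / C_q of all partitions.\<close>

definition durfee_term :: "real \<Rightarrow> nat \<Rightarrow> real" where
  "durfee_term q i = 1 / q ^ (i\<^sup>2) / (qbr q i)\<^sup>2"

section \<open>The functions Z_n, Y_n, Y and Z for a fixed real q\<close>

context
  fixes q :: real
  assumes q: "q \<ge> 2"
begin

lemma durfee_term_pos: "0 < durfee_term q i"
  using q qbr_pos[OF q, of i] by (simp add: durfee_term_def)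

lemma durfee_term_le: "durfee_term q i \<le> 16 * (1 / q ^ (i\<^sup>2))"
proof -
  have "(1 / 4)\<^sup>2 \<le> (qbr q i)\<^sup>2"
    by (rule power_mono[OF qbr_ge[OF q]]) simp
  then have "1 / (qbr q i)\<^sup>2 \<le> 1 / (1 / 4)\<^sup>2"
    by (intro divide_left_mono) (use qbr_pos[OF q, of i] in auto)
  then have "1 / q ^ (i\<^sup>2) * (1 / (qbr q i)\<^sup>2) \<le> 1 / q ^ (i\<^sup>2) * 16"
    by (intro mult_left_mono) (use q in \<open>simp_all add: power2_eq_square\<close>)
  then show ?thesis by (simp add: durfee_term_def)
qed

lemma Y_altdef: "Y q l = qbr q 1 * (\<Sum>i\<le>l. durfee_term q i)"
  by (simp add: Y_def durfee_term_def atLeast0AtMost)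

lemma Z_altdef: "Z q l = qC q * (\<Sum>i\<le>l. durfee_term q i)"
  by (simp add: Z_def durfee_term_def atLeast0AtMost)

lemma Zn_altdef:
  "Zn n q l = qbr q n * (\<Sum>i\<le>l. durfee_term q i * (qbr q n / qbr q (n - i)))"
  by (simp add: Zn_def durfee_term_def atLeast0AtMost mult.assoc)

text \<open>Summand i of \<open>Zn\<close> is the probability of corank i, which makes
  \<open>Zn\<close> the probability of corank at most l.\<close>

lemma Zn_eq_sum_rank_prob:
  assumes "l \<le> n"
  shows "Zn n q l = (\<Sum>i\<le>l. rank_prob q n n (n - i))"
  unfolding Zn_altdef sum_distrib_left using assms
  by (intro sum.cong) (auto simp: rank_prob_def durfee_term_def power2_eq_square mult_ac)

lemma Zn_self: "Zn n q n = 1"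
proof -
  have "Zn n q n = (\<Sum>i\<le>n. rank_prob q n n (n - i))" by (rule Zn_eq_sum_rank_prob) simp
  also have "\<dots> = (\<Sum>r\<le>n. rank_prob q n n r)"
    by (rule sum.reindex_bij_witness[of _ "\<lambda>r. n - r" "\<lambda>r. n - r"]) auto
  finally show ?thesis by (simp add: sum_rank_prob[OF q])
qed

lemma Zn_pos: "0 < Zn n q l"
  unfolding Zn_altdef
  by (intro mult_pos_pos sum_pos divide_pos_pos qbr_pos[OF q] durfee_term_pos) auto

lemma Zn_mono: "l \<le> m \<Longrightarrow> Zn n q l \<le> Zn n q m"
  unfolding Zn_altdef
  by (intro mult_left_mono sum_mono2 less_imp_le[OF qbr_pos[OF q]] mult_nonneg_nonneg divide_nonneg_nonneg
      less_imp_le[OF durfee_term_pos]) auto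

lemma Zn_le_1: "l \<le> n \<Longrightarrow> Zn n q l \<le> 1"
  using Zn_mono[of l n n] by (simp add: Zn_self)

lemma Yn_altdef: "Yn n q l = qbr q 1 * (\<Sum>i\<le>l. durfee_term q i * (qbr q n / qbr q (n - i)))"
  using qbr_pos[OF q, of n] by (simp add: Yn_def Zn_altdef)

text \<open>The ratio is a product of i factors 1 - q^-s with s from n - i + 1 to n, and raising n
  raises every exponent s.\<close>

lemma ratio_mono:
  assumes "i \<le> n" "n \<le> m"
  shows "qbr q n / qbr q (n - i) \<le> qbr q m / qbr q (m - i)"
proof -
  have *: "qbr q m / qbr q (m - i) = (\<Prod>j<i. 1 - 1 / q ^ Suc (m - i + j))" if "i \<le> m" for m
    using qbr_split[OF q, of "m - i" i] qbr_pos[OF q, of "m - i"] that by simp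
  show ?thesis
    unfolding *[OF assms(1)] *[OF order_trans[OF assms]]
  proof (intro prod_mono conjI)
    fix j
    show "0 \<le> 1 - 1 / q ^ Suc (n - i + j)" using inv_pow_less_1[OF q, of "n - i + j"] by simp
    have "q ^ Suc (n - i + j) \<le> q ^ Suc (m - i + j)"
      by (rule power_increasing) (use assms q in auto)
    then show "1 - 1 / q ^ Suc (n - i + j) \<le> 1 - 1 / q ^ Suc (m - i + j)"
      using q by (simp add: frac_le del: power_Suc)
  qed
qed

lemma ratio_le_1: "qbr q n / qbr q (n - i) \<le> 1"
  using qbr_antimono[OF q, of "n - i" n] qbr_pos[OF q, of "n - i"] by simp

lemma ratio_tendsto: "(\<lambda>n. qbr q n / qbr q (n - i)) \<longlonglongrightarrow> 1"
proof -
  have "(\<lambda>n. qbr q (n - i)) \<longlonglongrightarrow> qC q"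
    by (rule LIMSEQ_offset[of _ i]) (simp add: qbr_tendsto[OF q])
  then have "(\<lambda>n. qbr q n / qbr q (n - i)) \<longlonglongrightarrow> qC q / qC q"
    by (intro tendsto_divide qbr_tendsto[OF q]) (use qC_pos[OF q] in auto)
  then show ?thesis using qC_pos[OF q] by simp
qed

lemma sum_ratio_tendsto:
  "(\<lambda>n. \<Sum>i\<le>l. durfee_term q i * (qbr q n / qbr q (n - i))) \<longlonglongrightarrow> (\<Sum>i\<le>l. durfee_term q i)"
proof -
  have "(\<lambda>n. \<Sum>i\<le>l. durfee_term q i * (qbr q n / qbr q (n - i))) \<longlonglongrightarrow> (\<Sum>i\<le>l. durfee_term q i * 1)"
    by (intro tendsto_intros ratio_tendsto)
  then show ?thesis by simp
qed

lemma Yn_increases_to_Y: "increases_to l (\<lambda>n. Yn n q l) (Y q l)"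
  unfolding increases_to_def Yn_altdef Y_altdef
  by (intro conjI mono_onI tendsto_mult tendsto_const sum_ratio_tendsto mult_left_mono sum_mono
      ratio_mono less_imp_le[OF qbr_pos[OF q]] less_imp_le[OF durfee_term_pos]) auto

lemma Zn_tendsto_Z: "(\<lambda>n. Zn n q l) \<longlonglongrightarrow> Z q l"
  unfolding Zn_altdef Z_altdef by (intro tendsto_mult qbr_tendsto[OF q] sum_ratio_tendsto)

lemma Z_eq_Y: "qC q / qbr q 1 * Y q l = Z q l"
  unfolding Z_altdef Y_altdef using qbr_pos[OF q, of 1] by simp

lemma Z_le_1: "Z q l \<le> 1"
  by (rule LIMSEQ_le_const2[OF Zn_tendsto_Z]) (use Zn_le_1 in auto)

lemma Z_pos: "0 < Z q l"
  unfolding Z_altdef by (intro mult_pos_pos sum_pos qC_pos[OF q] durfee_term_pos) auto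

text \<open>Letting \<open>n\<close> tend to infinity in \<open>Zn n q n = 1\<close> gives Euler's identity.\<close>

lemma durfee_sums: "durfee_term q sums (1 / qC q)"
proof -
  have bound: "(\<Sum>i\<le>l. durfee_term q i) \<le> 1 / qC q" for l
    using Z_le_1[of l] qC_pos[OF q] by (simp add: Z_altdef divide_simps mult.commute)
  have "(\<Sum>i<n. durfee_term q i) \<le> 1 / qC q" for n
    using bound[of n] durfee_term_pos[of n] by (simp add: lessThan_Suc_atMost[symmetric])
  then have summ: "summable (durfee_term q)"
    by (intro summableI_nonneg_bounded less_imp_le[OF durfee_term_pos])
  then have lim: "(\<lambda>l. \<Sum>i\<le>l. durfee_term q i) \<longlonglongrightarrow> suminf (durfee_term q)"
    by (rule summable_LIMSEQ')
  \<comment> \<open>The number of summands grows with n, so the limit is not termwise. That the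
    ratios are at most 1 gives this inequality; the termwise limit for fixed l, in the form
    \<open>Z_le_1\<close>, gives the reverse one.\<close>
  have "1 \<le> qC q * suminf (durfee_term q)"
  proof (rule LIMSEQ_le_const[OF tendsto_mult[OF qbr_tendsto[OF q] lim]], intro exI allI impI)
    fix n :: nat
    have "1 = Zn n q n" by (simp add: Zn_self)
    also have "\<dots> \<le> qbr q n * (\<Sum>i\<le>n. durfee_term q i * 1)"
      unfolding Zn_altdef
      by (intro mult_left_mono sum_mono ratio_le_1 less_imp_le[OF qbr_pos[OF q]] less_imp_le[OF durfee_term_pos])
    finally show "1 \<le> qbr q n * (\<Sum>i\<le>n. durfee_term q i)" by simp
  qed
  moreover have "qC q * suminf (durfee_term q) \<le> 1"
    by (rule LIMSEQ_le_const2[OF tendsto_mult[OF tendsto_const lim]])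
       (use Z_le_1 in \<open>auto simp: Z_altdef\<close>)
  ultimately have "suminf (durfee_term q) = 1 / qC q"
    using qC_pos[OF q] by (simp add: divide_simps mult.commute)
  with summ show ?thesis by (simp add: sums_iff)
qed

lemma durfee_partial_tendsto: "(\<lambda>l. \<Sum>i\<le>l. durfee_term q i) \<longlonglongrightarrow> 1 / qC q"
  using durfee_sums unfolding sums_iff by (metis summable_LIMSEQ')

lemma durfee_partial_mono: "l \<le> m \<Longrightarrow> (\<Sum>i\<le>l. durfee_term q i) \<le> (\<Sum>i\<le>m. durfee_term q i)"
  by (rule sum_mono2) (use durfee_term_pos less_imp_le in auto)

lemma Y_increases_to: "increases_to 1 (\<lambda>l. Y q l) (qbr q 1 / qC q)"
proof -
  have "(\<lambda>l. qbr q 1 * (\<Sum>i\<le>l. durfee_term q i)) \<longlonglongrightarrow> qbr q 1 * (1 / qC q)"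
    by (intro tendsto_intros durfee_partial_tendsto)
  then show ?thesis unfolding increases_to_def Y_altdef
    by (auto intro!: mono_onI mult_left_mono durfee_partial_mono less_imp_le[OF qbr_pos[OF q]])
qed

lemma Z_mono: "l \<le> m \<Longrightarrow> Z q l \<le> Z q m"
  unfolding Z_altdef by (intro mult_left_mono durfee_partial_mono less_imp_le[OF qC_pos[OF q]])

lemma Z_increases_to: "increases_to 1 (\<lambda>l. Z q l) 1"
proof -
  have "(\<lambda>l. qC q * (\<Sum>i\<le>l. durfee_term q i)) \<longlonglongrightarrow> qC q * (1 / qC q)"
    by (intro tendsto_intros durfee_partial_tendsto)
  then show ?thesis using qC_pos[OF q] unfolding increases_to_def Z_altdef[symmetric]
    by (auto intro!: mono_onI Z_mono)
qed

section \<open>The expansion of Z(q,l) for large l\<close>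

lemma inv_pow_geometric: "(\<lambda>k. 1 / q ^ k) sums (q / (q - 1))"
proof -
  have "(\<lambda>k. (1 / q) ^ k) sums (1 / (1 - 1 / q))"
    by (rule geometric_sums) (use q in auto)
  then show ?thesis using q by (simp add: power_divide divide_simps)
qed

lemma one_minus_Z: "1 - Z q l = qC q * (\<Sum>i. durfee_term q (i + Suc l))"
  and summable_durfee_tail: "summable (\<lambda>i. durfee_term q (i + l))"
proof -
  show "summable (\<lambda>i. durfee_term q (i + l))" for l
    using durfee_sums by (simp add: sums_iff)
  have "1 / qC q = (\<Sum>i. durfee_term q (i + Suc l)) + (\<Sum>i<Suc l. durfee_term q i)"
    using durfee_sums suminf_split_initial_segment[of "durfee_term q" "Suc l"] unfolding sums_iff by metis
  then have "qC q * (1 / qC q) = qC q * ((\<Sum>i. durfee_term q (i + Suc l)) + (\<Sum>i\<le>l. durfee_term q i))"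
    by (simp only: lessThan_Suc_atMost)
  then show "1 - Z q l = qC q * (\<Sum>i. durfee_term q (i + Suc l))"
    using qC_pos[OF q] by (simp add: Z_altdef algebra_simps)
qed

text \<open>Multiplying 1 - Z by C_q q^((l+1)^2) turns the first omitted term into the square of C_q
  / [q,l+1], called \<open>a 0\<close> below. It lies between (1 - S)^2 and e^(-2S) with S =
  q^-(l+1) / (q - 1), and 2S is exactly the stated correction. Hence E is at least S^2 > 0, and at
  most 2S^2 plus the remaining omitted terms; with t = q^-l these two are at most t^2/2 and t^2,
  which stays below 2t^2.\<close>

lemma Z_remainder:
  assumes E: "E = (1 - Z q l) * qC q * q ^ ((l + 1)\<^sup>2) - 1 + 2 / (q\<^sup>2 - q) * (1 / q ^ l)"
  shows "0 < E" "E < 2 * (1 / q ^ (2 * l))"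
proof -
  define S where "S = (1 / q ^ Suc l) / (q - 1)"
  define t where "t = 1 / q ^ l"
  define a where "a = (\<lambda>i. q ^ ((l + 1)\<^sup>2) * (qC q)\<^sup>2 * durfee_term q (i + Suc l))"
  have S_t: "S = t / (q\<^sup>2 - q)"
    by (simp add: S_def t_def power2_eq_square field_simps)
  have t: "0 < t" using q by (simp add: t_def)
  have qq: "q\<^sup>2 - q \<ge> 2"
  proof -
    have "q * (q - 1) \<ge> 2 * 1" by (rule mult_mono) (use q in auto)
    then show ?thesis by (simp add: power2_eq_square algebra_simps)
  qed
  have S: "0 < S" "S \<le> t / 2"
    unfolding S_t using t qq divide_left_mono[OF qq, of t] by auto
  have a_eq: "a i = q ^ ((l + 1)\<^sup>2) / q ^ ((i + Suc l)\<^sup>2) * (qC q / qbr q (i + Suc l))\<^sup>2" for i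
    by (simp add: a_def durfee_term_def power_divide)
  have a_pos: "0 < a i" for i
    unfolding a_def using q qC_pos[OF q] durfee_term_pos by simp
  have summ: "summable a"
    unfolding a_def by (intro summable_mult summable_durfee_tail)
  have "(1 - Z q l) * qC q * q ^ ((l + 1)\<^sup>2) = (q ^ ((l + 1)\<^sup>2) * (qC q)\<^sup>2) * (\<Sum>i. durfee_term q (i + Suc l))"
    unfolding one_minus_Z by (simp add: power2_eq_square)
  also have "\<dots> = suminf a"
    unfolding a_def by (rule suminf_mult[OF summable_durfee_tail, symmetric])
  also have "\<dots> = a 0 + (\<Sum>i. a (Suc i))"
    using suminf_split_head[OF summ] by simp
  finally have E': "E = a 0 + (\<Sum>i. a (Suc i)) - 1 + 2 * S"
    unfolding E by (simp add: S_t t_def)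
  have a0: "a 0 = (qC q / qbr q (Suc l))\<^sup>2"
    using q by (simp add: a_eq)
  have tail_summ: "summable (\<lambda>i. a (Suc i))" using summ by (simp add: summable_Suc_iff)
  have "S < 1"
  proof -
    have "t \<le> 1" using q by (simp add: t_def)
    then show ?thesis using S by linarith
  qed
  have "(1 - S)\<^sup>2 \<le> a 0" unfolding a0
    by (rule power_mono) (use qC_ratio_ge[OF q, of "Suc l"] \<open>S < 1\<close> in \<open>auto simp: S_def\<close>)
  then have "1 - 2 * S + S\<^sup>2 \<le> a 0" by (simp add: power2_diff)
  moreover have "0 \<le> (\<Sum>i. a (Suc i))" by (rule suminf_nonneg[OF tail_summ]) (simp add: a_pos less_imp_le)
  moreover have "0 < S\<^sup>2" using S by simp
  ultimately show "0 < E" unfolding E' by linarith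

  have "a 0 \<le> (exp (- S))\<^sup>2" unfolding a0
    by (rule power_mono) (use qC_ratio_le[OF q, of "Suc l"] qC_pos[OF q] qbr_pos[OF q, of "Suc l"] in \<open>auto simp: S_def\<close>)
  also have "\<dots> = exp (- (2 * S))" by (simp add: power2_eq_square flip: exp_add)
  \<comment> \<open>With y = 2S, the bound e^-y \<le> 1 - y + y^2/2 follows from e^y \<ge> 1 + y +
    y^2/2, because the two quadratics multiply to 1 + y^4/4.\<close>
  also have "\<dots> \<le> 1 - 2 * S + (2 * S)\<^sup>2 / 2"
  proof -
    have "1 / exp (2 * S) \<le> 1 / (1 + 2 * S + (2 * S)\<^sup>2 / 2)"
      by (intro divide_left_mono mult_pos_pos exp_lower_Taylor_quadratic) (use S in \<open>auto intro: add_pos_nonneg\<close>)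
    also have "\<dots> \<le> 1 - 2 * S + (2 * S)\<^sup>2 / 2"
    proof -
      have "(1 + 2 * S + (2 * S)\<^sup>2 / 2) * (1 - 2 * S + (2 * S)\<^sup>2 / 2) = 1 + (2 * S) ^ 4 / 4"
        by (simp add: algebra_simps power2_eq_square power4_eq_xxxx)
      moreover have "1 + 2 * S + (2 * S)\<^sup>2 / 2 > 0" using S by (auto intro: add_pos_nonneg)
      ultimately show ?thesis by (simp add: divide_le_eq mult.commute)
    qed
    finally show ?thesis by (simp add: exp_minus inverse_eq_divide)
  qed
  finally have "a 0 \<le> 1 - 2 * S + 2 * S\<^sup>2" by (simp add: power2_eq_square)
  moreover have "S\<^sup>2 \<le> t\<^sup>2 / 4"
    using power_mono[OF S(2), of 2] S(1) by (simp add: power_divide)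
  moreover have "(\<Sum>i. a (Suc i)) \<le> t\<^sup>2"
  proof -
    have le: "a (Suc i) \<le> t\<^sup>2 / 2 * (1 / q ^ i)" for i
    proof -
      \<comment> \<open>The exponent exceeds (l + 1)^2 by at least 2l + i + 1: the 2l gives t^2, the
        1 gives a factor 1/q \<le> 1/2, and the i makes the series geometric with sum at most
        2.\<close>
      have "(Suc i + Suc l)\<^sup>2 = (l + 1)\<^sup>2 + (2 * l + i + 1 + (i * (2 * l) + i * i + 3 * i + 2))"
        by (simp add: power2_eq_square algebra_simps)
      then have "q ^ (Suc i + Suc l)\<^sup>2 = q ^ ((l + 1)\<^sup>2) * q ^ (2 * l + i + 1 + (i * (2 * l) + i * i + 3 * i + 2))"
        by (simp only: power_add)
      then have "q ^ ((l + 1)\<^sup>2) / q ^ ((Suc i + Suc l)\<^sup>2) = 1 / q ^ (2 * l + i + 1 + (i * (2 * l) + i * i + 3 * i + 2))"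
        using q by simp
      also have "\<dots> \<le> 1 / q ^ (2 * l + i + 1)"
        by (intro divide_left_mono power_increasing mult_pos_pos) (use q in auto)
      also have "\<dots> = t\<^sup>2 * (1 / q) * (1 / q ^ i)"
        by (simp add: t_def power_add power_divide mult.commute[of 2] power_mult)
      also have "\<dots> \<le> t\<^sup>2 * (1 / 2) * (1 / q ^ i)"
        by (intro mult_right_mono mult_left_mono) (use q in \<open>auto simp: divide_simps\<close>)
      finally have 1: "q ^ ((l + 1)\<^sup>2) / q ^ ((Suc i + Suc l)\<^sup>2) \<le> t\<^sup>2 / 2 * (1 / q ^ i)" by simp
      have "(qC q / qbr q (Suc i + Suc l))\<^sup>2 \<le> 1\<^sup>2"
        by (rule power_mono)
           (use qC_le_qbr[OF q, of "Suc i + Suc l"] qbr_pos[OF q, of "Suc i + Suc l"] qC_pos[OF q] in auto)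
      then have "a (Suc i) \<le> q ^ ((l + 1)\<^sup>2) / q ^ ((Suc i + Suc l)\<^sup>2) * 1"
        unfolding a_eq by (intro mult_left_mono) (use q in auto)
      with 1 show ?thesis by linarith
    qed
    have sums: "(\<lambda>i. t\<^sup>2 / 2 * (1 / q ^ i)) sums (t\<^sup>2 / 2 * (q / (q - 1)))"
      by (rule sums_mult[OF inv_pow_geometric])
    have "(\<Sum>i. a (Suc i)) \<le> t\<^sup>2 / 2 * (q / (q - 1))"
      using suminf_le[OF le tail_summ sums_summable[OF sums]] sums_unique[OF sums] by simp
    also have "\<dots> \<le> t\<^sup>2 / 2 * 2"
      by (rule mult_left_mono) (use q in \<open>auto simp: divide_simps\<close>)
    finally show ?thesis by simp
  qed
  moreover have "t\<^sup>2 > 0" using t by simp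
  moreover have "t\<^sup>2 = 1 / q ^ (2 * l)" by (simp add: t_def power_divide mult.commute[of 2] power_mult)
  ultimately show "E < 2 * (1 / q ^ (2 * l))" unfolding E' by linarith
qed

lemma Z_expansion:
  "\<exists>E :: nat \<Rightarrow> real. E \<in> O(\<lambda>l. 1 / q ^ (2 * l)) \<and>
     (\<forall>l\<ge>1. Z q l = 1 - 1 / qC q * (1 / q ^ ((l + 1)^2)) * (1 - 2 / (q^2 - q) * (1 / q ^ l) + E l) \<and>
            0 < E l \<and> E l < 2 * (1 / q ^ (2 * l)))"
proof -
  define E where "E l = (1 - Z q l) * qC q * q ^ ((l + 1)\<^sup>2) - 1 + 2 / (q\<^sup>2 - q) * (1 / q ^ l)" for l
  have bounds: "0 < E l" "E l < 2 * (1 / q ^ (2 * l))" for l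
    using Z_remainder[of "E l" l] by (simp_all add: E_def)
  have "E \<in> O(\<lambda>l. 1 / q ^ (2 * l))"
  proof (rule bigoI[of _ 2], intro always_eventually allI)
    fix l show "norm (E l) \<le> 2 * norm (1 / q ^ (2 * l))"
      using bounds[of l] q by simp
  qed
  moreover have "Z q l = 1 - 1 / qC q * (1 / q ^ ((l + 1)^2)) * (1 - 2 / (q^2 - q) * (1 / q ^ l) + E l)" for l
  proof -
    have "1 - 2 / (q^2 - q) * (1 / q ^ l) + E l = (1 - Z q l) * qC q * q ^ ((l + 1)\<^sup>2)"
      by (simp add: E_def)
    then show ?thesis using qC_pos[OF q] q by simp
  qed
  ultimately show ?thesis using bounds by blast
qed

section \<open>Bounds for 1 - Z_n and 1 - Z that are summable over the primes\<close>

lemma sum_inv_square_le: "(\<Sum>i\<in>{Suc l..n}. 1 / q ^ (i\<^sup>2)) \<le> 2 * (1 / q ^ ((Suc l)\<^sup>2))"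
proof -
  have "(\<Sum>i\<in>{Suc l..n}. 1 / q ^ (i\<^sup>2)) \<le> (\<Sum>i\<in>{Suc l..n}. 1 / q ^ ((Suc l)\<^sup>2) * (1 / q ^ (i - Suc l)))"
  proof (rule sum_mono)
    fix i assume "i \<in> {Suc l..n}"
    then obtain d where i: "i = Suc l + d" by (metis atLeastAtMost_iff le_Suc_ex)
    have "q ^ ((Suc l)\<^sup>2 + d) \<le> q ^ (i\<^sup>2)"
      by (rule power_increasing) (use q in \<open>auto simp: i power2_eq_square algebra_simps\<close>)
    then have "1 / q ^ (i\<^sup>2) \<le> 1 / q ^ ((Suc l)\<^sup>2 + d)"
      by (intro divide_left_mono) (use q in auto)
    then show "1 / q ^ (i\<^sup>2) \<le> 1 / q ^ ((Suc l)\<^sup>2) * (1 / q ^ (i - Suc l))"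
      by (simp add: i power_add)
  qed
  also have "\<dots> = 1 / q ^ ((Suc l)\<^sup>2) * (\<Sum>k<Suc n - Suc l. 1 / q ^ k)"
    unfolding sum_distrib_left
    by (rule sum.reindex_bij_witness[of _ "\<lambda>k. k + Suc l" "\<lambda>i. i - Suc l"]) auto
  also have "\<dots> \<le> 1 / q ^ ((Suc l)\<^sup>2) * 2"
  proof (rule mult_left_mono)
    have "(\<Sum>k<Suc n - Suc l. 1 / q ^ k) \<le> (\<Sum>k. 1 / q ^ k)"
      by (rule sum_le_suminf) (use inv_pow_geometric q sums_summable in auto)
    also have "\<dots> = q / (q - 1)" using inv_pow_geometric by (simp add: sums_iff)
    also have "\<dots> \<le> 2" using q by (simp add: divide_simps)
    finally show "(\<Sum>k<Suc n - Suc l. 1 / q ^ k) \<le> 2" .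
  qed (use q in auto)
  finally show ?thesis by simp
qed

text \<open>The bound does not depend on n, and for l \<ge> 1 its exponent is at least 4, which
  gives one summable majorant for all n. The constant is 16 from \<open>durfee_term_le\<close> times
  2 from \<open>sum_inv_square_le\<close>.\<close>

lemma one_minus_Zn_le:
  assumes "l \<le> n"
  shows "1 - Zn n q l \<le> 32 * (1 / q ^ ((Suc l)\<^sup>2))"
proof -
  have split: "{..n} = {..l} \<union> {Suc l..n}" using assms by auto
  have "1 - Zn n q l = qbr q n * (\<Sum>i\<in>{Suc l..n}. durfee_term q i * (qbr q n / qbr q (n - i)))"
    unfolding Zn_self[of n, symmetric] Zn_altdef split
    by (subst sum.union_disjoint) (auto simp: distrib_left)
  also have "\<dots> \<le> 1 * (\<Sum>i\<in>{Suc l..n}. 16 * (1 / q ^ (i\<^sup>2)) * 1)"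
    by (intro mult_mono sum_mono ratio_le_1 qbr_le_1[OF q] durfee_term_le sum_nonneg mult_nonneg_nonneg
        less_imp_le[OF divide_pos_pos[OF qbr_pos[OF q] qbr_pos[OF q]]] less_imp_le[OF durfee_term_pos]) (use q in auto)
  also have "\<dots> = 16 * (\<Sum>i\<in>{Suc l..n}. 1 / q ^ (i\<^sup>2))" by (simp add: sum_distrib_left)
  also have "\<dots> \<le> 16 * (2 * (1 / q ^ ((Suc l)\<^sup>2)))"
    by (intro mult_left_mono sum_inv_square_le) simp
  finally show ?thesis by simp
qed

lemma one_minus_Z_le: "1 - Z q l \<le> 32 * (1 / q ^ ((Suc l)\<^sup>2))"
  by (rule LIMSEQ_le_const2[OF tendsto_diff[OF tendsto_const Zn_tendsto_Z]]) (use one_minus_Zn_le in auto)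

end

section \<open>Products over the primes\<close>

lemma summable_inv_square: "summable (\<lambda>p::nat. c * (1 / real p ^ 2))"
  using inverse_power_summable[of 2, where 'a = real] by (intro summable_mult) (simp add: inverse_eq_divide)

lemma unit_factors_over_primes:
  assumes "\<And>p. prime p \<Longrightarrow> 0 < f p \<and> f p \<le> 1 \<and> 1 - f p \<le> c * (1 / real p ^ 2)" "0 \<le> c"
  shows "unit_factors (over_primes f) (\<lambda>p. c * (1 / real p ^ 2))"
  by standard (use assms summable_inv_square in \<open>auto simp: over_primes_def\<close>)

abbreviation qbr_ratio :: "nat \<Rightarrow> nat \<Rightarrow> real" where
  "qbr_ratio n \<equiv> over_primes (\<lambda>p. qbr (real p) n / qbr (real p) 1)"

abbreviation qC_ratio :: "nat \<Rightarrow> real" where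
  "qC_ratio \<equiv> over_primes (\<lambda>p. qC (real p) / qbr (real p) 1)"

abbreviation euler_factor :: "nat \<Rightarrow> nat \<Rightarrow> real" where
  "euler_factor j \<equiv> over_primes (\<lambda>p. 1 - 1 / real p ^ j)"

lemma prime_ge_2_real: "prime p \<Longrightarrow> 2 \<le> real p"
  using prime_ge_2_nat[of p] by linarith

lemma inv_pow_le_inv_square:
  assumes "2 \<le> (q::real)" "2 \<le> m"
  shows "1 / q ^ m \<le> 1 / q ^ 2"
  by (intro divide_left_mono power_increasing mult_pos_pos) (use assms in auto)

lemma two_le_Suc_square: "1 \<le> l \<Longrightarrow> 2 \<le> (Suc l)\<^sup>2"
  by (simp add: power2_eq_square)

lemma Zn_factors:
  assumes "1 \<le> l" "l \<le> n"
  shows "unit_factors (over_primes (\<lambda>p. Zn n (real p) l)) (\<lambda>p. 32 * (1 / real p ^ 2))"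
proof (rule unit_factors_over_primes)
  fix p :: nat assume "prime p"
  then have p: "2 \<le> real p" by (rule prime_ge_2_real)
  have "1 - Zn n (real p) l \<le> 32 * (1 / real p ^ ((Suc l)\<^sup>2))"
    by (rule one_minus_Zn_le[OF p assms(2)])
  also have "\<dots> \<le> 32 * (1 / real p ^ 2)"
    by (intro mult_left_mono inv_pow_le_inv_square[OF p] two_le_Suc_square assms) simp
  finally show "0 < Zn n (real p) l \<and> Zn n (real p) l \<le> 1 \<and> 1 - Zn n (real p) l \<le> 32 * (1 / real p ^ 2)"
    using Zn_pos[OF p] Zn_le_1[OF p assms(2)] by simp
qed simp

lemma Z_factors:
  assumes "1 \<le> l"
  shows "unit_factors (over_primes (\<lambda>p. Z (real p) l)) (\<lambda>p. 32 * (1 / real p ^ 2))"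
proof (rule unit_factors_over_primes)
  fix p :: nat assume "prime p"
  then have p: "2 \<le> real p" by (rule prime_ge_2_real)
  have "1 - Z (real p) l \<le> 32 * (1 / real p ^ ((Suc l)\<^sup>2))"
    by (rule one_minus_Z_le[OF p])
  also have "\<dots> \<le> 32 * (1 / real p ^ 2)"
    by (intro mult_left_mono inv_pow_le_inv_square[OF p] two_le_Suc_square assms) simp
  finally show "0 < Z (real p) l \<and> Z (real p) l \<le> 1 \<and> 1 - Z (real p) l \<le> 32 * (1 / real p ^ 2)"
    using Z_pos[OF p] Z_le_1[OF p] by simp
qed simp

lemma ratio_factors:
  assumes "1 \<le> n"
  shows "unit_factors (qbr_ratio n) (\<lambda>p. 2 * (1 / real p ^ 2))"
proof (rule unit_factors_over_primes)
  fix p :: nat assume "prime p"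
  then have p: "2 \<le> real p" by (rule prime_ge_2_real)
  show "0 < qbr (real p) n / qbr (real p) 1 \<and> qbr (real p) n / qbr (real p) 1 \<le> 1 \<and>
      1 - qbr (real p) n / qbr (real p) 1 \<le> 2 * (1 / real p ^ 2)"
    using qbr_ratio_1_ge[OF p assms] qbr_pos[OF p] qbr_antimono[OF p assms] by simp
qed simp

lemma qC_ratio_factors:
  "unit_factors qC_ratio (\<lambda>p. 2 * (1 / real p ^ 2))"
proof (rule unit_factors_over_primes)
  fix p :: nat assume "prime p"
  then have p: "2 \<le> real p" by (rule prime_ge_2_real)
  have "1 - 2 / (real p)\<^sup>2 \<le> qC (real p) / qbr (real p) 1"
    by (rule LIMSEQ_le_const[OF qC_ratio_tendsto[OF p]]) (use qbr_ratio_1_ge[OF p] in auto)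
  then show "0 < qC (real p) / qbr (real p) 1 \<and> qC (real p) / qbr (real p) 1 \<le> 1 \<and>
      1 - qC (real p) / qbr (real p) 1 \<le> 2 * (1 / real p ^ 2)"
    using qbr_pos[OF p, of 1] qC_pos[OF p] qC_le_qbr[OF p, of 1] by simp
qed simp

lemma over_primes_tendsto:
  assumes "\<And>p. prime p \<Longrightarrow> (\<lambda>n. f n p) \<longlonglongrightarrow> g p"
  shows "(\<lambda>n. over_primes (f n) i) \<longlonglongrightarrow> over_primes g i"
  using assms by (auto simp: over_primes_def)

lemma Zn_all_tendsto:
  assumes "1 \<le> l"
  shows "(\<lambda>n. Zn_all n l) \<longlonglongrightarrow> Z_all l"
proof (rule LIMSEQ_offset[of _ l])
  show "(\<lambda>n. Zn_all (n + l) l) \<longlonglongrightarrow> Z_all l"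
    unfolding Zn_all_def Z_all_def
    by (rule tendsto_prodinf[OF Zn_factors Z_factors])
       (use assms in \<open>auto intro!: over_primes_tendsto LIMSEQ_ignore_initial_segment[OF Zn_tendsto_Z] prime_ge_2_real\<close>)
qed

lemma over_primes_divide: "over_primes (\<lambda>p. f p / g p) n = over_primes f n / over_primes g n"
  by (simp add: over_primes_def)

lemma over_primes_cong: "(\<And>p. prime p \<Longrightarrow> f p = g p) \<Longrightarrow> over_primes f = over_primes g"
  by (auto simp: over_primes_def)

text \<open>\<open>Yn\<close> may exceed 1, so \<open>unit_factors\<close> does not cover it. It is
  the quotient of \<open>Zn\<close> by [p,n] / [p,1], and both of these are covered.\<close>

lemma
  assumes "1 \<le> l" "l \<le> n"
  shows convergent_prod_Yn: "convergent_prod (over_primes (\<lambda>p. Yn n (real p) l))"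
    and prodinf_Yn: "prodinf (over_primes (\<lambda>p. Yn n (real p) l))
      = Zn_all n l / prodinf (qbr_ratio n)"
proof -
  have n: "1 \<le> n" using assms by simp
  have eq: "over_primes (\<lambda>p. Yn n (real p) l)
      = (\<lambda>i. over_primes (\<lambda>p. Zn n (real p) l) i / qbr_ratio n i)"
    unfolding over_primes_divide[symmetric] by (auto simp: over_primes_def Yn_def)
  note c = unit_factors.convergent[OF Zn_factors[OF assms]] unit_factors.convergent[OF ratio_factors[OF n]]
  show "convergent_prod (over_primes (\<lambda>p. Yn n (real p) l))"
    unfolding eq by (intro convergent_prod_divide c)
  show "prodinf (over_primes (\<lambda>p. Yn n (real p) l))
      = Zn_all n l / prodinf (qbr_ratio n)"
    unfolding eq Zn_all_def by (rule prodinf_divide[OF c, symmetric])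
qed

lemma
  assumes "1 \<le> l"
  shows convergent_prod_Y: "convergent_prod (over_primes (\<lambda>p. Y (real p) l))"
    and prodinf_Y: "prodinf (over_primes (\<lambda>p. Y (real p) l))
      = Z_all l / prodinf qC_ratio"
proof -
  have "Y (real p) l = Z (real p) l / (qC (real p) / qbr (real p) 1)" if "prime p" for p
    using Z_eq_Y[OF prime_ge_2_real[OF that], of l] qC_pos[OF prime_ge_2_real[OF that]]
      qbr_pos[OF prime_ge_2_real[OF that], of 1] by (simp add: field_simps)
  then have "over_primes (\<lambda>p. Y (real p) l) = over_primes (\<lambda>p. Z (real p) l / (qC (real p) / qbr (real p) 1))"
    by (rule over_primes_cong)
  then have eq: "over_primes (\<lambda>p. Y (real p) l)
      = (\<lambda>i. over_primes (\<lambda>p. Z (real p) l) i / qC_ratio i)"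
    by (simp only: over_primes_divide[abs_def])
  note c = unit_factors.convergent[OF Z_factors[OF assms]] unit_factors.convergent[OF qC_ratio_factors]
  show "convergent_prod (over_primes (\<lambda>p. Y (real p) l))"
    unfolding eq by (intro convergent_prod_divide c)
  show "prodinf (over_primes (\<lambda>p. Y (real p) l))
      = Z_all l / prodinf qC_ratio"
    unfolding eq Z_all_def by (rule prodinf_divide[OF c, symmetric])
qed

section \<open>The Euler product of zeta, obtained by sieving\<close>

lemma euler_product:
  assumes j: "2 \<le> j"
  shows "prodinf (euler_factor j) * zeta (real j) = 1"
    and "convergent_prod (euler_factor j)"
proof -
  define a where "a m = 1 / real m ^ j" for m :: nat
  define ok where "ok N m \<longleftrightarrow> (\<forall>p<N. prime p \<longrightarrow> \<not> p dvd m)" for N m :: nat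
  \<comment> \<open>The series \<open>g N\<close> keeps the integers without a prime factor below N.
    Division by zero gives \<open>a 0 = 0\<close>, so the index may start at 0.\<close>
  define g where "g N m = (if ok N m then a m else 0)" for N m
  have a0: "a 0 = 0" and a1: "a 1 = 1" using j by (simp_all add: a_def)
  have a_nonneg: "0 \<le> a m" for m by (simp add: a_def)
  have a_summable: "summable a"
    using inverse_power_summable[OF j, where 'a = real] unfolding a_def by (simp add: inverse_eq_divide)
  have g_summable: "summable (g N)" for N
    by (rule summable_comparison_test'[OF a_summable, of 0]) (use a_nonneg in \<open>auto simp: g_def\<close>)
  have zeta: "zeta (real j) = suminf a"
    using suminf_split_head[OF a_summable] j by (simp add: zeta_def a0 a_def powr_realpow)
  have F: "unit_factors (euler_factor j) (\<lambda>p. 1 * (1 / real p ^ 2))"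
  proof (rule unit_factors_over_primes)
    fix p :: nat assume "prime p"
    then have p: "2 \<le> real p" by (rule prime_ge_2_real)
    have "1 / real p ^ Suc (j - 1) < 1" by (rule inv_pow_less_1[OF p])
    moreover have "1 / real p ^ j \<le> 1 / real p ^ 2" by (rule inv_pow_le_inv_square[OF p j])
    moreover have "0 < 1 / real p ^ j" by (rule inv_pow_pos[OF p])
    ultimately show "0 < 1 - 1 / real p ^ j \<and> 1 - 1 / real p ^ j \<le> 1 \<and> 1 - (1 - 1 / real p ^ j) \<le> 1 * (1 / real p ^ 2)"
      using j by simp
  qed simp
  then show "convergent_prod (euler_factor j)" by (rule unit_factors.convergent)

  \<comment> \<open>For prime N, the multiples of N among the kept integers are the N * m with m
    kept, and they contribute N^-j times the whole sum. Dropping them multiplies the sum by 1 -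
    N^-j.\<close>
  have step: "suminf (g (Suc N)) = suminf (g N) * euler_factor j N" for N
  proof (cases "prime N")
    case True
    define h where "h m = (if N dvd m then g N m else 0)" for m
    have ok_mult: "ok N (N * m) \<longleftrightarrow> ok N m" for m
      unfolding ok_def using True
      by (metis less_irrefl prime_dvd_mult_iff primes_dvd_imp_eq)
    have "g (Suc N) m = g N m - h m" for m
      using True by (auto simp: g_def h_def ok_def less_Suc_eq)
    moreover have "h (N * m) = 1 / real N ^ j * g N m" for m
      by (simp add: h_def g_def ok_mult a_def power_mult_distrib)
    then have "(\<lambda>m. h (N * m)) sums (1 / real N ^ j * suminf (g N))"
      using sums_mult[OF summable_sums[OF g_summable], of "1 / real N ^ j" N] by simp
    then have "h sums (1 / real N ^ j * suminf (g N))"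
      by (subst (asm) sums_mono_reindex)
         (use prime_gt_0_nat[OF True] in \<open>auto simp: strict_mono_def h_def\<close>)
    ultimately have "g (Suc N) sums (suminf (g N) - 1 / real N ^ j * suminf (g N))"
      using sums_diff[OF summable_sums[OF g_summable[of N]]] by presburger
    then show ?thesis using True by (simp add: over_primes_def sums_iff algebra_simps)
  next
    case False
    then have "g (Suc N) = g N" by (auto simp: g_def ok_def less_Suc_eq fun_eq_iff)
    then show ?thesis using False by (simp add: over_primes_def)
  qed
  have prod: "suminf (g N) = suminf a * (\<Prod>i<N. euler_factor j i)" for N
  proof (induction N)
    case 0
    show ?case by (simp add: g_def ok_def)
  next
    case (Suc N)
    then show ?case by (simp add: step)
  qed
  have lower: "1 \<le> suminf (g N)" for N
  proof -
    have "ok N 1" by (auto simp: ok_def)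
    then have "g N 1 = 1" using a1 by (simp add: g_def)
    then show ?thesis
      using sum_le_suminf[OF g_summable, of "{1}" N] a_nonneg by (simp add: g_def)
  qed
  \<comment> \<open>An integer strictly between 1 and N has a prime factor below N and is sieved
    out, so only 1 and a tail of the zeta series can remain.\<close>
  have upper: "suminf (g N) \<le> 1 + (\<Sum>m. a (m + N))" for N
  proof -
    have "g N m = (if m = 1 then 1 else 0)" if "m < N" for m
    proof -
      have "\<not> ok N m" if "m \<noteq> 1" "m \<noteq> 0"
      proof -
        obtain p where p: "prime p" "p dvd m" using prime_factor_nat[OF \<open>m \<noteq> 1\<close>] by blast
        have "p \<le> m" using p that by (intro dvd_imp_le) auto
        with \<open>m < N\<close> have "p < N" by simp
        with p show ?thesis unfolding ok_def by blast
      qed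
      moreover have "ok N 1" by (auto simp: ok_def)
      ultimately show ?thesis using a1 a0 by (cases "m = 0") (auto simp: g_def)
    qed
    then have "(\<Sum>m<N. g N m) = (\<Sum>m<N. if m = 1 then 1 else 0)"
      by (intro sum.cong) auto
    also have "\<dots> \<le> 1" by simp
    finally have "(\<Sum>m<N. g N m) \<le> 1" .
    moreover have "(\<Sum>m. g N (m + N)) \<le> (\<Sum>m. a (m + N))"
      by (rule suminf_le[OF _ summable_ignore_initial_segment[OF g_summable] summable_ignore_initial_segment[OF a_summable]])
         (simp add: g_def a_nonneg)
    moreover have "suminf (g N) = (\<Sum>m. g N (m + N)) + (\<Sum>m<N. g N m)"
      by (rule suminf_split_initial_segment[OF g_summable])
    ultimately show ?thesis by linarith
  qed
  have "(\<lambda>N. 1 + (\<Sum>m. a (m + N))) \<longlonglongrightarrow> 1 + 0"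
    by (intro tendsto_intros suminf_exist_split2 a_summable)
  then have "(\<lambda>N. suminf (g N)) \<longlonglongrightarrow> 1"
    by (intro tendsto_sandwich[of "\<lambda>_. 1" "\<lambda>N. suminf (g N)" _ "\<lambda>N. 1 + (\<Sum>m. a (m + N))"])
       (use lower upper in auto)
  moreover have "(\<lambda>N. suminf (g N)) \<longlonglongrightarrow> suminf a * prodinf (euler_factor j)"
    unfolding prod by (intro tendsto_mult tendsto_const unit_factors.tendsto[OF F])
  ultimately show "prodinf (euler_factor j) * zeta (real j) = 1"
    unfolding zeta using LIMSEQ_unique by (metis mult.commute)
qed

text \<open>[p,n] / [p,1] is the product of 1 - p^-j over 2 \<le> j \<le> n, so the product over the
  primes splits into the Euler products of zeta(2), ..., zeta(n).\<close>

lemma prodinf_ratio: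
  assumes "1 \<le> n"
  shows "prodinf (qbr_ratio n) = 1 / (\<Prod>i=2..n. zeta (real i))"
proof -
  have "qbr (real p) n / qbr (real p) 1 = (\<Prod>j=2..n. 1 - 1 / real p ^ j)" if "prime p" for p
  proof -
    have "qbr (real p) n = qbr (real p) 1 * (\<Prod>j=2..n. 1 - 1 / real p ^ j)"
      unfolding qbr_def using assms by (simp add: prod.atLeast_Suc_atMost numeral_2_eq_2)
    then show ?thesis using qbr_pos[OF prime_ge_2_real[OF that], of 1] by simp
  qed
  then have "qbr_ratio n
      = over_primes (\<lambda>p. \<Prod>j=2..n. 1 - 1 / real p ^ j)"
    by (rule over_primes_cong)
  also have "\<dots> = (\<lambda>i. \<Prod>j=2..n. euler_factor j i)"
    by (auto simp: over_primes_def)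
  finally have "prodinf (qbr_ratio n)
      = prodinf (\<lambda>i. \<Prod>j=2..n. euler_factor j i)" by simp
  also have "\<dots> = (\<Prod>j=2..n. prodinf (euler_factor j))"
    by (rule prodinf_prod) (use euler_product in auto)
  also have "\<dots> = (\<Prod>j=2..n. 1 / zeta (real j))"
  proof (rule prod.cong[OF refl])
    fix j assume "j \<in> {2..n}"
    then have *: "prodinf (euler_factor j) * zeta (real j) = 1"
      by (intro euler_product) simp
    then have "zeta (real j) \<noteq> 0" by auto
    with * show "prodinf (euler_factor j) = 1 / zeta (real j)"
      by (simp add: divide_simps)
  qed
  finally show ?thesis by (simp add: prod_dividef)
qed

text \<open>The zeta product is not estimated directly. By \<open>prodinf_ratio\<close> its partial
  products are reciprocals of products over primes, and these converge to the nonzero number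
  \<open>W\<close> by \<open>tendsto_prodinf\<close>.\<close>

lemma convergent_prod_zeta: "convergent_prod (\<lambda>i. zeta (real (i + 2)))"
  and prodinf_zeta: "prodinf qC_ratio
      = 1 / prodinf (\<lambda>i. zeta (real (i + 2)))"
proof -
  define W where "W = prodinf qC_ratio"
  have W: "W \<noteq> 0" using unit_factors.prodinf_pos[OF qC_ratio_factors] by (simp add: W_def)
  have nz: "zeta (real (i + 2)) \<noteq> 0" for i
  proof
    assume "zeta (real (i + 2)) = 0"
    then show False using euler_product(1)[of "i + 2"] by (simp only: mult_zero_right) simp
  qed
  have shift: "(\<Prod>i\<le>n. zeta (real (i + 2))) = (\<Prod>i=2..n+2. zeta (real i))" for n
    by (rule prod.reindex_bij_witness[of _ "\<lambda>i. i - 2" "\<lambda>i. i + 2"]) auto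
  have "(\<lambda>n. prodinf (qbr_ratio (n + 2))) \<longlonglongrightarrow> W"
    unfolding W_def
  proof (rule tendsto_prodinf[OF ratio_factors qC_ratio_factors])
    fix i
    show "(\<lambda>n. qbr_ratio (n + 2) i)
        \<longlonglongrightarrow> qC_ratio i"
    proof (rule over_primes_tendsto)
      fix p :: nat assume "prime p"
      then have p: "2 \<le> real p" by (rule prime_ge_2_real)
      show "(\<lambda>n. qbr (real p) (n + 2) / qbr (real p) 1) \<longlonglongrightarrow> qC (real p) / qbr (real p) 1"
        by (intro tendsto_divide LIMSEQ_ignore_initial_segment[OF qbr_tendsto[OF p]] tendsto_const)
           (use qbr_pos[OF p, of 1] in simp)
    qed
  qed simp
  then have "(\<lambda>n. 1 / (\<Prod>i\<le>n. zeta (real (i + 2)))) \<longlonglongrightarrow> W"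
    unfolding shift by (subst (asm) prodinf_ratio) auto
  from tendsto_divide[OF tendsto_const[of 1] this W]
  have lim: "(\<lambda>n. \<Prod>i\<le>n. zeta (real (i + 2))) \<longlonglongrightarrow> 1 / W"
    by (simp only: div_by_1 divide_divide_eq_right mult_1_left)
  have "1 / W \<noteq> 0" using W by simp
  with lim show conv: "convergent_prod (\<lambda>i. zeta (real (i + 2)))"
    unfolding convergent_prod_iff_nz_lim[of "\<lambda>i. zeta (real (i + 2))", OF nz] by blast
  have "prodinf (\<lambda>i. zeta (real (i + 2))) = 1 / W"
    by (rule LIMSEQ_unique[OF convergent_prod_LIMSEQ[OF conv] lim])
  then show "prodinf qC_ratio
      = 1 / prodinf (\<lambda>i. zeta (real (i + 2)))"
    unfolding W_def by (simp only: divide_divide_eq_right div_by_1 mult_1_left)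
qed

section \<open>The product of Z(p,l) over the primes for large l\<close>

lemma Z_all_mono:
  assumes "1 \<le> l" "l \<le> m"
  shows "Z_all l \<le> Z_all m"
  unfolding Z_all_def
proof (rule prodinf_le)
  have m: "1 \<le> m" using assms by simp
  show "over_primes (\<lambda>p. Z (real p) l) has_prod prodinf (over_primes (\<lambda>p. Z (real p) l))"
    using unit_factors.convergent[OF Z_factors[OF assms(1)]] by auto
  show "over_primes (\<lambda>p. Z (real p) m) has_prod prodinf (over_primes (\<lambda>p. Z (real p) m))"
    using unit_factors.convergent[OF Z_factors[OF m]] by auto
  show "0 \<le> over_primes (\<lambda>p. Z (real p) l) i \<and> over_primes (\<lambda>p. Z (real p) l) i \<le> over_primes (\<lambda>p. Z (real p) m) i" for i
    using Z_mono[OF prime_ge_2_real assms(2)] less_imp_le[OF Z_pos[OF prime_ge_2_real]]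
    by (auto simp: over_primes_def)
qed

lemma Z_all_increases_to: "increases_to 1 (\<lambda>l. Z_all l) 1"
proof -
  have "(\<lambda>l. Z_all l) \<longlonglongrightarrow> prodinf (over_primes (\<lambda>_. 1))"
  \<comment> \<open>The shift to l + 1 \<ge> 1 ensures the common majorant 32 / p^2, and every
    single factor tends to 1.\<close>
  proof (rule LIMSEQ_offset[of _ 1], unfold Z_all_def, rule tendsto_prodinf[OF Z_factors])
    show "unit_factors (over_primes (\<lambda>_. 1)) (\<lambda>p. 32 * (1 / real p ^ 2))"
      by (rule unit_factors_over_primes) auto
    show "(\<lambda>l. over_primes (\<lambda>p. Z (real p) (l + 1)) i) \<longlonglongrightarrow> over_primes (\<lambda>_. 1) i" for i
      by (rule over_primes_tendsto, rule LIMSEQ_ignore_initial_segment)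
         (use Z_increases_to[OF prime_ge_2_real] in \<open>auto simp: increases_to_def\<close>)
  qed simp
  then show ?thesis
    by (auto simp: increases_to_def over_primes_def intro!: mono_onI Z_all_mono)
qed

text \<open>The prime 2 dominates: all other primes are at least 3, and together they cost
  O(3^-((l+1)^2)).\<close>

lemma Z_all_near_Z_2:
  obtains C where "0 \<le> C" "\<And>l. 1 \<le> l \<Longrightarrow> Z_all l \<le> Z 2 l" "\<And>l. 1 \<le> l \<Longrightarrow> Z 2 l - Z_all l \<le> C / 3 ^ ((Suc l)\<^sup>2)"
proof -
  define K where "K = (\<Sum>i. 1 / real (i + 3) ^ 2)"
  have K_summable: "summable (\<lambda>i. 1 / real (i + 3) ^ 2)"
    using summable_ignore_initial_segment[OF summable_inv_square[of 1], of 3] by simp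
  have "0 \<le> K" unfolding K_def by (rule suminf_nonneg[OF K_summable]) simp
  \<comment> \<open>The indices 0 and 1 are not prime and contribute factors 1.\<close>
  have first3: "(\<Prod>i<3. over_primes (\<lambda>p. Z (real p) l) i) = Z 2 l" for l
    by (simp add: eval_nat_numeral lessThan_Suc over_primes_def two_is_prime_nat[unfolded numeral_2_eq_2])
  have "Z_all l \<le> Z 2 l" if "1 \<le> l" for l
    using unit_factors.partial_ge[OF Z_factors[OF that], of 3] by (simp add: first3 Z_all_def)
  moreover have "Z 2 l - Z_all l \<le> (32 * 9 * K) / 3 ^ ((Suc l)\<^sup>2)" if l: "1 \<le> l" for l
  proof -
    \<comment> \<open>Two powers of p are kept back to make the sum over p converge; the other s are
      bounded below by 3^s, which costs the factor 9 in the constant.\<close>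
    define s where "s = (Suc l)\<^sup>2 - 2"
    have s: "(Suc l)\<^sup>2 = s + 2" using two_le_Suc_square[OF l] by (simp add: s_def)
    define b where "b p = 32 * (1 / real p ^ ((Suc l)\<^sup>2))" for p
    have b_le: "b p \<le> 32 * (1 / real p ^ 2)" for p
    proof (cases "p = 0")
      case False
      then have "real p ^ 2 \<le> real p ^ ((Suc l)\<^sup>2)"
        by (intro power_increasing two_le_Suc_square[OF l]) auto
      then show ?thesis unfolding b_def using False by (intro mult_left_mono divide_left_mono) auto
    qed (simp add: b_def power_0_left)
    have "unit_factors (over_primes (\<lambda>p. Z (real p) l)) b"
    proof (unfold_locales)
      show "summable b"
        by (rule summable_comparison_test'[OF summable_inv_square[of 32], of 0]) (use b_le in \<open>auto simp: b_def\<close>)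
      show "1 - over_primes (\<lambda>p. Z (real p) l) n \<le> b n" for n
        using one_minus_Z_le[OF prime_ge_2_real] by (auto simp: over_primes_def b_def)
    qed (use unit_factors.pos[OF Z_factors[OF l]] unit_factors.le_1[OF Z_factors[OF l]] in auto)
    then interpret unit_factors "over_primes (\<lambda>p. Z (real p) l)" b .
    have "Z 2 l - Z_all l \<le> (\<Sum>i. b (i + 3))"
      using partial_le[of 3] by (simp add: first3 Z_all_def)
    also have "(\<Sum>i. b (i + 3)) \<le> (\<Sum>i. 32 * (1 / 3 ^ s) * (1 / real (i + 3) ^ 2))"
    proof (rule suminf_le)
      fix i
      have "(3::real) ^ s \<le> real (i + 3) ^ s" by (rule power_mono) auto
      then have "1 / real (i + 3) ^ s \<le> 1 / 3 ^ s" by (intro divide_left_mono) auto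
      then have "32 * (1 / real (i + 3) ^ s) * (1 / real (i + 3) ^ 2) \<le> 32 * (1 / 3 ^ s) * (1 / real (i + 3) ^ 2)"
        by (intro mult_right_mono mult_left_mono) auto
      moreover have "b (i + 3) = 32 * (1 / real (i + 3) ^ s) * (1 / real (i + 3) ^ 2)"
        by (simp only: b_def s power_add) simp
      ultimately show "b (i + 3) \<le> 32 * (1 / 3 ^ s) * (1 / real (i + 3) ^ 2)" by simp
    next
      show "summable (\<lambda>i. b (i + 3))" using summ by (rule summable_ignore_initial_segment)
      show "summable (\<lambda>i. 32 * (1 / 3 ^ s) * (1 / real (i + 3) ^ 2))" using K_summable by (rule summable_mult)
    qed
    also have "\<dots> = 32 * (1 / 3 ^ s) * K" unfolding K_def by (rule suminf_mult[OF K_summable])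
    also have "\<dots> = (32 * 9 * K) / 3 ^ ((Suc l)\<^sup>2)" by (simp only: s power_add) simp
    finally show ?thesis .
  qed
  moreover have "0 \<le> 32 * 9 * K" using \<open>0 \<le> K\<close> by simp
  ultimately show ?thesis by (intro that[of "32 * 9 * K"])
qed

lemma Z_all_expansion:
  "\<exists>E :: nat \<Rightarrow> real. E \<in> O(\<lambda>l. 1 / 4 ^ l) \<and>
     (\<forall>l\<ge>1. Z_all l = 1 - 1 / qC 2 * (1 / 2 ^ ((l + 1)^2)) * (1 - 1 / 2 ^ l + E l))"
proof -
  obtain C where C: "0 \<le> C" "\<And>l. 1 \<le> l \<Longrightarrow> Z_all l \<le> Z 2 l"
    "\<And>l. 1 \<le> l \<Longrightarrow> Z 2 l - Z_all l \<le> C / 3 ^ ((Suc l)\<^sup>2)"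
    using Z_all_near_Z_2 by blast
  obtain E0 where E0: "\<And>l. 1 \<le> l \<Longrightarrow> Z 2 l = 1 - 1 / qC 2 * (1 / 2 ^ ((l + 1)^2)) * (1 - 1 / 2 ^ l + E0 l)"
    "\<And>l. 1 \<le> l \<Longrightarrow> 0 < E0 l" "\<And>l. 1 \<le> l \<Longrightarrow> E0 l < 2 * (1 / 4 ^ l)"
    using Z_expansion[of 2] by (auto simp: power_mult)
  define E where "E l = E0 l + (Z 2 l - Z_all l) * qC 2 * 2 ^ ((l + 1)^2)" for l
  have qC: "0 < qC 2" "qC 2 \<le> 1"
    using qC_pos[of 2] qC_le_qbr[of 2 0] by auto
  have "E \<in> O(\<lambda>l. 1 / 4 ^ l)"
  proof (rule bigoI[of _ "2 + C"], rule eventually_sequentiallyI[of 1])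
    fix l :: nat assume l: "1 \<le> l"
    have "0 \<le> (Z 2 l - Z_all l) * qC 2 * 2 ^ ((l + 1)^2)"
      using C(2)[OF l] qC by simp
    moreover have "(Z 2 l - Z_all l) * qC 2 * 2 ^ ((l + 1)^2) \<le> C * (1 / 4 ^ l)"
    proof -
      have "(Z 2 l - Z_all l) * qC 2 * 2 ^ ((l + 1)^2) \<le> C / 3 ^ ((Suc l)\<^sup>2) * 1 * 2 ^ ((l + 1)^2)"
        by (intro mult_mono C(3)[OF l]) (use qC C(1) C(2)[OF l] in auto)
      also have "\<dots> = C * (2 / 3) ^ ((l + 1)\<^sup>2)" by (simp add: power_divide)
      \<comment> \<open>Normalising by 2^((l+1)^2) leaves (2/3)^((l+1)^2) from the other primes. As
        (l + 1)^2 \<ge> 4l and (2/3)^4 = 16/81 < 1/4, this is at most 4^-l.\<close>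
      also have "\<dots> \<le> C * (2 / 3) ^ (4 * l)"
      proof (intro mult_left_mono power_decreasing)
        have "4 * l + (l - 1)\<^sup>2 = (l + 1)\<^sup>2" using l
          by (cases l) (auto simp: power2_eq_square algebra_simps)
        then show "4 * l \<le> (l + 1)\<^sup>2" by linarith
      qed (use C in auto)
      also have "(2 / 3 :: real) ^ (4 * l) = (16 / 81) ^ l" by (simp add: power_mult power_divide)
      also have "C * (16 / 81) ^ l \<le> C * (1 / 4) ^ l"
        by (intro mult_left_mono power_mono C) auto
      finally show ?thesis by (simp add: power_divide)
    qed
    ultimately show "norm (E l) \<le> (2 + C) * norm (1 / 4 ^ l :: real)"
      using E0(2,3)[OF l] unfolding E_def by (simp add: add_divide_distrib)
  qed
  moreover have "Z_all l = 1 - 1 / qC 2 * (1 / 2 ^ ((l + 1)^2)) * (1 - 1 / 2 ^ l + E l)" if "1 \<le> l" for l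
  proof -
    have "1 / qC 2 * (1 / 2 ^ ((l + 1)^2)) * (1 - 1 / 2 ^ l + E l)
        = 1 / qC 2 * (1 / 2 ^ ((l + 1)^2)) * (1 - 1 / 2 ^ l + E0 l) + (Z 2 l - Z_all l)"
      using qC by (simp add: E_def divide_simps) (simp add: algebra_simps)
    then show ?thesis using E0(1)[OF that] by linarith
  qed
  ultimately show ?thesis by blast
qed

section \<open>The numerical value of 1 / C_2\<close>

lemma qbr_numeral: "qbr q (numeral k) = qbr q (pred_numeral k) * (1 - 1 / q ^ numeral k)"
  by (simp add: numeral_eq_Suc qbr_Suc)

lemma inverse_qC_2: "\<bar>1 / qC 2 - 3.46275\<bar> < 0.000005"
proof -
  have q1: "qbr 2 (Suc 0) = 1 / 2" by (simp add: qbr_Suc)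
  \<comment> \<open>Stopping after 22 factors changes the product by a relative error of at most
    2^-22 < 3/10^7, which the second factor in the first inequality absorbs.\<close>
  have lo: "288788 / 1000000 * (1 + 3/10000000) < qbr 2 22" and hi: "qbr 2 22 < 2887882 / 10000000"
    by (simp_all add: qbr_numeral q1)
  have "qC 2 \<ge> (1 - 1 / 2 ^ 22) * qbr 2 22"
    using qC_ratio_ge[of 2 22] qbr_pos[of 2 22] by (simp add: le_divide_eq)
  then have 1: "qC 2 > 288788 / 1000000" using lo by simp
  have 2: "qC 2 < 2887882 / 10000000"
    using qC_le_qbr[of 2 22] hi by simp
  have "1 / qC 2 < 1 / (288788 / 1000000)" "1 / (2887882 / 10000000) < 1 / qC 2"
    using 1 2 by (intro divide_strict_left_mono; simp)+
  then show ?thesis by (simp add: abs_less_iff)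
qed

section \<open>Existence of the Smith normal form\<close>

definition unimodular :: "nat \<Rightarrow> int mat \<Rightarrow> bool" where
  "unimodular n P \<longleftrightarrow> P \<in> carrier_mat n n \<and> (\<exists>P'\<in>carrier_mat n n. P * P' = 1\<^sub>m n \<and> P' * P = 1\<^sub>m n)"

lemma unimodularI:
  "P \<in> carrier_mat n n \<Longrightarrow> P' \<in> carrier_mat n n \<Longrightarrow> P * P' = 1\<^sub>m n \<Longrightarrow> P' * P = 1\<^sub>m n \<Longrightarrow> unimodular n P"
  unfolding unimodular_def by blast

lemma unimodular_carrier: "unimodular n P \<Longrightarrow> P \<in> carrier_mat n n"
  by (simp add: unimodular_def)

lemma unimodular_inverse:
  assumes "unimodular n P"
  obtains P' where "unimodular n P'" "P * P' = 1\<^sub>m n" "P' * P = 1\<^sub>m n"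
  using assms unfolding unimodular_def by blast

lemma unimodular_one: "unimodular n (1\<^sub>m n)"
  by (rule unimodularI[of _ _ "1\<^sub>m n"]) auto

lemma unimodular_mult:
  assumes "unimodular n P" "unimodular n Q"
  shows "unimodular n (P * Q)"
proof -
  obtain P' where P: "unimodular n P'" "P * P' = 1\<^sub>m n" "P' * P = 1\<^sub>m n"
    using unimodular_inverse[OF assms(1)] .
  obtain Q' where Q: "unimodular n Q'" "Q * Q' = 1\<^sub>m n" "Q' * Q = 1\<^sub>m n"
    using unimodular_inverse[OF assms(2)] .
  note carr = assms[THEN unimodular_carrier] P(1)[THEN unimodular_carrier] Q(1)[THEN unimodular_carrier]
  have "(P * Q) * (Q' * P') = P * ((Q * Q') * P')" "(Q' * P') * (P * Q) = Q' * ((P' * P) * Q)"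
    using carr by (simp_all add: assoc_mult_mat[of _ n n _ n _ n])
  then have "(P * Q) * (Q' * P') = 1\<^sub>m n" "(Q' * P') * (P * Q) = 1\<^sub>m n"
    unfolding P Q using carr P Q by simp_all
  then show ?thesis using carr by (intro unimodularI[of _ _ "Q' * P'"]) simp_all
qed

lemma unimodular_transpose:
  assumes "unimodular n P"
  shows "unimodular n P\<^sup>T"
proof -
  obtain P' where P: "unimodular n P'" "P * P' = 1\<^sub>m n" "P' * P = 1\<^sub>m n"
    using unimodular_inverse[OF assms] .
  then show ?thesis
    using assms[THEN unimodular_carrier] P(1)[THEN unimodular_carrier]
    by (intro unimodularI[of _ _ "P'\<^sup>T"]) (auto simp: transpose_mult[of _ n n _ n, symmetric])
qed

section \<open>Equivalence of integer matrices under unimodular row and column operations\<close>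

definition equivalent_mat :: "nat \<Rightarrow> int mat \<Rightarrow> int mat \<Rightarrow> bool" where
  "equivalent_mat n A B \<longleftrightarrow> A \<in> carrier_mat n n \<and> (\<exists>P Q. unimodular n P \<and> unimodular n Q \<and> B = P * A * Q)"

lemma equivalent_matI:
  "A \<in> carrier_mat n n \<Longrightarrow> unimodular n P \<Longrightarrow> unimodular n Q \<Longrightarrow> B = P * A * Q \<Longrightarrow> equivalent_mat n A B"
  unfolding equivalent_mat_def by blast

lemma equivalent_matE:
  assumes "equivalent_mat n A B"
  obtains P Q where "A \<in> carrier_mat n n" "unimodular n P" "unimodular n Q" "B = P * A * Q"
    "P \<in> carrier_mat n n" "Q \<in> carrier_mat n n"
  using assms unimodular_carrier unfolding equivalent_mat_def by blast

lemma equivalent_mat_carrier: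
  assumes "equivalent_mat n A B" shows "A \<in> carrier_mat n n" "B \<in> carrier_mat n n"
  using assms by (auto elim!: equivalent_matE)

lemma equivalent_mat_left: "A \<in> carrier_mat n n \<Longrightarrow> unimodular n P \<Longrightarrow> equivalent_mat n A (P * A)"
  by (rule equivalent_matI[OF _ _ unimodular_one]) (auto dest: unimodular_carrier)

lemma equivalent_mat_refl: "A \<in> carrier_mat n n \<Longrightarrow> equivalent_mat n A A"
  using equivalent_mat_left[OF _ unimodular_one, of A n] by simp

lemma equivalent_mat_trans:
  assumes "equivalent_mat n A B" "equivalent_mat n B C"
  shows "equivalent_mat n A C"
proof -
  obtain P Q where 1: "A \<in> carrier_mat n n" "unimodular n P" "unimodular n Q" "B = P * A * Q"
    "P \<in> carrier_mat n n" "Q \<in> carrier_mat n n" using equivalent_matE[OF assms(1)] .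
  obtain R S where 2: "unimodular n R" "unimodular n S" "C = R * B * S"
    "R \<in> carrier_mat n n" "S \<in> carrier_mat n n" using equivalent_matE[OF assms(2)] .
  have "C = R * P * A * (Q * S)"
    unfolding 2(3) 1(4) using 1(1,5,6) 2(4,5) by (simp add: assoc_mult_mat[of _ n n _ n _ n])
  then show ?thesis by (rule equivalent_matI[OF 1(1) unimodular_mult[OF 2(1) 1(2)] unimodular_mult[OF 1(3) 2(2)]])
qed

lemma equivalent_mat_transpose:
  assumes "equivalent_mat n A B"
  shows "equivalent_mat n A\<^sup>T B\<^sup>T"
proof -
  obtain P Q where 1: "A \<in> carrier_mat n n" "unimodular n P" "unimodular n Q" "B = P * A * Q"
    "P \<in> carrier_mat n n" "Q \<in> carrier_mat n n" using equivalent_matE[OF assms] .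
  have "B\<^sup>T = Q\<^sup>T * A\<^sup>T * P\<^sup>T"
    using 1(1,5,6) unfolding 1(4) by (simp add: transpose_mult[of _ n n _ n] assoc_mult_mat[of _ n n _ n _ n])
  moreover have "A\<^sup>T \<in> carrier_mat n n" using 1(1) by simp
  ultimately show ?thesis
    by (intro equivalent_matI[OF _ unimodular_transpose[OF 1(3)] unimodular_transpose[OF 1(2)]])
qed

lemma equivalent_mat_addrow:
  assumes "A \<in> carrier_mat n n" "k < n" "l < n" "k \<noteq> l"
  shows "equivalent_mat n A (addrow a k l A)"
proof -
  have "addrow_mat n a k l * addrow_mat n (- a) k l = 1\<^sub>m n" "addrow_mat n (- a) k l * addrow_mat n a k l = 1\<^sub>m n"
    using addrow_mat_inv[of k n l a] addrow_mat_inv[of k n l "- a"] assms by auto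
  then show ?thesis
    unfolding addrow_mat[OF assms(1,3)]
    by (intro equivalent_mat_left assms unimodularI[of _ _ "addrow_mat n (- a) k l"]) auto
qed

lemma equivalent_mat_swaprows:
  assumes "A \<in> carrier_mat n n" "k < n" "l < n"
  shows "equivalent_mat n A (swaprows k l A)"
  unfolding swaprows_mat[OF assms]
  by (intro equivalent_mat_left[OF assms(1)] unimodularI[OF _ _ swaprows_mat_inv swaprows_mat_inv]) (use assms in auto)

lemma equivalent_mat_uminus:
  assumes "A \<in> carrier_mat n n"
  shows "equivalent_mat n A (- A)"
proof -
  have "equivalent_mat n A (- 1\<^sub>m n * A)"
    by (intro equivalent_mat_left[OF assms] unimodularI[of _ _ "- 1\<^sub>m n"]) auto
  then show ?thesis using assms by simp
qed

text \<open>Minimality over the whole equivalence class replaces the descent of Euclidean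
  elimination: a nonzero remainder below d would be an entry of an equivalent matrix. It also
  persists under all later operations, which stay inside the class.\<close>

definition min_entry :: "nat \<Rightarrow> int mat \<Rightarrow> int \<Rightarrow> bool" where
  "min_entry n A d \<longleftrightarrow> 0 < d \<and>
     (\<forall>B i j. equivalent_mat n A B \<longrightarrow> i < n \<longrightarrow> j < n \<longrightarrow> B $$ (i, j) \<noteq> 0 \<longrightarrow> d \<le> \<bar>B $$ (i, j)\<bar>)"

lemma min_entry_transpose:
  assumes "min_entry n A d"
  shows "min_entry n A\<^sup>T d"
  unfolding min_entry_def
proof (intro conjI allI impI)
  fix B i j assume B: "equivalent_mat n A\<^sup>T B" "i < n" "j < n" "B $$ (i, j) \<noteq> 0"
  have "equivalent_mat n A B\<^sup>T" using equivalent_mat_transpose[OF B(1)] by simp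
  moreover have "B\<^sup>T $$ (j, i) = B $$ (i, j)" using equivalent_mat_carrier[OF B(1)] B by auto
  ultimately show "d \<le> \<bar>B $$ (i, j)\<bar>" using assms B unfolding min_entry_def by metis
qed (use assms in \<open>auto simp: min_entry_def\<close>)

lemma min_entry_dvd_column:
  assumes m: "min_entry n A d" and C: "equivalent_mat n A C" "C $$ (0, 0) = d" and i: "0 < i" "i < n"
  shows "d dvd C $$ (i, 0)"
proof -
  define C' where "C' = addrow (- (C $$ (i, 0) div d)) i 0 C"
  have carr: "C \<in> carrier_mat n n" using equivalent_mat_carrier[OF C(1)] by simp
  have "equivalent_mat n A C'"
    unfolding C'_def by (rule equivalent_mat_trans[OF C(1) equivalent_mat_addrow[OF carr]]) (use i in auto)
  moreover have eq: "C' $$ (i, 0) = C $$ (i, 0) mod d"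
    using carr i C(2) by (simp add: C'_def minus_div_mult_eq_mod[symmetric])
  ultimately have "C $$ (i, 0) mod d \<noteq> 0 \<Longrightarrow> d \<le> \<bar>C $$ (i, 0) mod d\<bar>"
    using m i unfolding min_entry_def by (metis gr_implies_not0 not_gr_zero)
  moreover have "0 \<le> C $$ (i, 0) mod d" "C $$ (i, 0) mod d < d"
    using m unfolding min_entry_def by auto
  ultimately show ?thesis by (auto simp: dvd_eq_mod_eq_0)
qed

text \<open>Only multiples of row 0 are added to other rows, so row 0 stays intact. That clause
  permits a second pass on the transpose without refilling the column cleared in the first
  pass.\<close>

lemma clear_column:
  assumes m: "min_entry n A d" and C: "equivalent_mat n A C" "C $$ (0, 0) = d" and k: "k \<le> n"
  shows "\<exists>D. equivalent_mat n A D \<and> (\<forall>j<n. D $$ (0, j) = C $$ (0, j)) \<and> (\<forall>i. 0 < i \<and> i < k \<longrightarrow> D $$ (i, 0) = 0)"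
  using k
proof (induction k)
  case 0
  then show ?case using C by auto
next
  case (Suc k)
  then obtain D where D: "equivalent_mat n A D" "\<And>j. j < n \<Longrightarrow> D $$ (0, j) = C $$ (0, j)"
    "\<And>i. 0 < i \<Longrightarrow> i < k \<Longrightarrow> D $$ (i, 0) = 0" by auto
  show ?case
  proof (cases "k = 0")
    case False
    have n: "k < n" "0 < n" using Suc by auto
    have carr: "D \<in> carrier_mat n n" using equivalent_mat_carrier[OF D(1)] by simp
    have D0: "D $$ (0, 0) = d" using D(2)[OF n(2)] C by simp
    have "d dvd D $$ (k, 0)" by (rule min_entry_dvd_column[OF m D(1) D0]) (use False n in auto)
    then obtain c where c: "D $$ (k, 0) = d * c" by auto
    define D' where "D' = addrow (- c) k 0 D"
    have "equivalent_mat n A D'"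
      unfolding D'_def by (rule equivalent_mat_trans[OF D(1) equivalent_mat_addrow[OF carr]]) (use n False in auto)
    moreover have "D' $$ (0, j) = C $$ (0, j)" if "j < n" for j
      using that n False carr D(2) by (simp add: D'_def)
    moreover have "D' $$ (i, 0) = 0" if "0 < i" "i < Suc k" for i
      using that n False carr D(3)[of i] c D0 by (auto simp: D'_def less_Suc_eq)
    ultimately show ?thesis by blast
  qed (use D in auto)
qed

lemma exists_min_entry:
  assumes A: "A \<in> carrier_mat n n" and "A \<noteq> 0\<^sub>m n n"
  obtains d C where "min_entry n A d" "equivalent_mat n A C" "C $$ (0, 0) = d"
proof -
  define S where "S d \<longleftrightarrow> (\<exists>B i j. equivalent_mat n A B \<and> i < n \<and> j < n \<and> B $$ (i, j) \<noteq> 0 \<and> nat \<bar>B $$ (i, j)\<bar> = d)" for d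
  obtain i j where "i < n" "j < n" "A $$ (i, j) \<noteq> 0"
    using assms by (metis carrier_matD eq_matI index_zero_mat)
  then have "S (nat \<bar>A $$ (i, j)\<bar>)" unfolding S_def using equivalent_mat_refl[OF A] by blast
  then have "S (LEAST d. S d)" by (rule LeastI)
  then obtain B i j where B: "equivalent_mat n A B" "i < n" "j < n" "B $$ (i, j) \<noteq> 0"
    "nat \<bar>B $$ (i, j)\<bar> = (LEAST d. S d)" unfolding S_def by blast
  define d where "d = \<bar>B $$ (i, j)\<bar>"
  have min: "min_entry n A d"
    unfolding min_entry_def
  proof (intro conjI allI impI)
    fix B' i' j' assume "equivalent_mat n A B'" "i' < n" "j' < n" "B' $$ (i', j') \<noteq> 0"
    then have "S (nat \<bar>B' $$ (i', j')\<bar>)" unfolding S_def by blast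
    then have "(LEAST d. S d) \<le> nat \<bar>B' $$ (i', j')\<bar>" by (rule Least_le)
    then show "d \<le> \<bar>B' $$ (i', j')\<bar>" using B(5) unfolding d_def by linarith
  qed (use B in \<open>simp add: d_def\<close>)
  have carrB: "B \<in> carrier_mat n n" using equivalent_mat_carrier[OF B(1)] by simp
  define C1 where "C1 = swaprows 0 i B"
  have C1: "equivalent_mat n A C1" "C1 \<in> carrier_mat n n" "C1 $$ (0, j) = B $$ (i, j)"
    using equivalent_mat_trans[OF B(1) equivalent_mat_swaprows[OF carrB _ B(2)]] B carrB by (auto simp: C1_def)
  define C2 where "C2 = (swaprows 0 j C1\<^sup>T)\<^sup>T"
  have "equivalent_mat n C1\<^sup>T (swaprows 0 j C1\<^sup>T)"
    by (rule equivalent_mat_swaprows) (use C1 B in auto)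
  from equivalent_mat_transpose[OF this] have "equivalent_mat n C1 C2" by (simp add: C2_def)
  then have C2: "equivalent_mat n A C2" using equivalent_mat_trans[OF C1(1)] by blast
  have C2_00: "C2 $$ (0, 0) = B $$ (i, j)" using C1 B by (simp add: C2_def)
  have carr2: "C2 \<in> carrier_mat n n" using equivalent_mat_carrier[OF C2] by simp
  show ?thesis
  proof (cases "B $$ (i, j) > 0")
    case True
    then show ?thesis using that[OF min C2] C2_00 by (simp add: d_def)
  next
    case False
    have "equivalent_mat n A (- C2)" by (rule equivalent_mat_trans[OF C2 equivalent_mat_uminus[OF carr2]])
    moreover have "(- C2) $$ (0, 0) = d" using False C2_00 B carr2 by (simp add: d_def)
    ultimately show ?thesis using that[OF min] by blast
  qed
qed

section \<open>Splitting off the minimal entry, and induction on the remaining block\<close>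

definition border :: "int mat \<Rightarrow> nat \<Rightarrow> int mat \<Rightarrow> int mat" where
  "border x m X = four_block_mat x (0\<^sub>m 1 m) (0\<^sub>m m 1) X"

lemma border_carrier: "x \<in> carrier_mat 1 1 \<Longrightarrow> X \<in> carrier_mat m m \<Longrightarrow> border x m X \<in> carrier_mat (Suc m) (Suc m)"
  by (auto simp: border_def)

lemma border_mult:
  fixes x y X Y :: "int mat"
  assumes "x \<in> carrier_mat 1 1" "y \<in> carrier_mat 1 1" "X \<in> carrier_mat m m" "Y \<in> carrier_mat m m"
  shows "border x m X * border y m Y = border (x * y) m (X * Y)"
  unfolding border_def using assms by (subst mult_four_block_mat[of _ 1 1 _ m _ m _ _ 1 _ m]) auto

lemma split_off_min_entry:
  assumes A: "A \<in> carrier_mat (Suc m) (Suc m)" and "A \<noteq> 0\<^sub>m (Suc m) (Suc m)"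
  obtains d E where "0 < d" "E \<in> carrier_mat m m" "\<And>i j. i < m \<Longrightarrow> j < m \<Longrightarrow> d dvd E $$ (i, j)"
    "equivalent_mat (Suc m) A (border (mat 1 1 (\<lambda>_. d)) m E)"
proof -
  obtain d C where min: "min_entry (Suc m) A d" and C: "equivalent_mat (Suc m) A C" "C $$ (0, 0) = d"
    using exists_min_entry[OF assms] by blast
  note minT = min_entry_transpose[OF min]
  obtain C1 where C1: "equivalent_mat (Suc m) A C1" "\<And>j. j < Suc m \<Longrightarrow> C1 $$ (0, j) = C $$ (0, j)"
    "\<And>i. 0 < i \<Longrightarrow> i < Suc m \<Longrightarrow> C1 $$ (i, 0) = 0"
    using clear_column[OF min C order_refl] by blast
  have carr1: "C1 \<in> carrier_mat (Suc m) (Suc m)" using equivalent_mat_carrier[OF C1(1)] by simp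
  have "C1\<^sup>T $$ (0, 0) = d" using C1(2)[of 0] C carr1 by simp
  then obtain C2 where C2: "equivalent_mat (Suc m) A\<^sup>T C2" "\<And>j. j < Suc m \<Longrightarrow> C2 $$ (0, j) = C1\<^sup>T $$ (0, j)"
    "\<And>i. 0 < i \<Longrightarrow> i < Suc m \<Longrightarrow> C2 $$ (i, 0) = 0"
    using clear_column[OF minT equivalent_mat_transpose[OF C1(1)] _ order_refl] by blast
  define F where "F = C2\<^sup>T"
  have F: "equivalent_mat (Suc m) A F" using equivalent_mat_transpose[OF C2(1)] by (simp add: F_def)
  have carr: "F \<in> carrier_mat (Suc m) (Suc m)" using equivalent_mat_carrier[OF F] by simp
  have carr2: "C2 \<in> carrier_mat (Suc m) (Suc m)" using equivalent_mat_carrier[OF C2(1)] by simp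
  have F0: "F $$ (0, 0) = d" "\<And>i. 0 < i \<Longrightarrow> i < Suc m \<Longrightarrow> F $$ (i, 0) = 0"
    "\<And>j. 0 < j \<Longrightarrow> j < Suc m \<Longrightarrow> F $$ (0, j) = 0"
    using C2(2,3) C1(2)[of 0] C1(3) C carr1 carr2 by (auto simp: F_def)
  define E where "E = mat m m (\<lambda>(i, j). F $$ (Suc i, Suc j))"
  have E: "E \<in> carrier_mat m m" by (simp add: E_def)
  have "F = border (mat 1 1 (\<lambda>_. d)) m E"
    by (rule eq_matI) (use carr F0 in \<open>auto simp: E_def border_def\<close>)
  moreover have "d dvd E $$ (i, j)" if ij: "i < m" "j < m" for i j
  proof -
    \<comment> \<open>Adding row i + 1 to row 0 keeps d in the corner, as column 0 is cleared, and
      copies row i of E into row 0. There \<open>min_entry_dvd_column\<close> reaches its entries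
      through the transpose.\<close>
    define G where "G = addrow 1 0 (Suc i) F"
    have G: "equivalent_mat (Suc m) A G"
      unfolding G_def by (rule equivalent_mat_trans[OF F equivalent_mat_addrow[OF carr]]) (use ij in auto)
    have carrG: "G \<in> carrier_mat (Suc m) (Suc m)" using equivalent_mat_carrier[OF G] by simp
    have "G\<^sup>T $$ (0, 0) = d" using F0 ij carr by (simp add: G_def)
    from min_entry_dvd_column[OF minT equivalent_mat_transpose[OF G] this, of "Suc j"]
    have "d dvd G $$ (0, Suc j)" using ij carrG by simp
    then show ?thesis using F0 ij carr by (simp add: G_def E_def)
  qed
  moreover have "0 < d" using min by (simp add: min_entry_def)
  ultimately show ?thesis using that E F by blast
qed

lemma mult_mat_entry:
  fixes A B :: "int mat"
  assumes "A \<in> carrier_mat n n" "B \<in> carrier_mat n n" "i < n" "j < n"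
  shows "(A * B) $$ (i, j) = (\<Sum>k<n. A $$ (i, k) * B $$ (k, j))"
  using assms by (simp add: scalar_prod_def atLeast0LessThan)

text \<open>The entries of P A Q are integer combinations of those of A. This carries divisibility
  by d from the remaining block to its Smith form and so yields the first link of the divisibility
  chain.\<close>

lemma equivalent_mat_dvd:
  assumes "equivalent_mat n A B" "\<And>i j. i < n \<Longrightarrow> j < n \<Longrightarrow> d dvd A $$ (i, j)" "i < n" "j < n"
  shows "d dvd B $$ (i, j)"
proof -
  obtain P Q where 1: "A \<in> carrier_mat n n" "P \<in> carrier_mat n n" "Q \<in> carrier_mat n n" "B = P * A * Q"
    using equivalent_matE[OF assms(1)] .
  have "P * A \<in> carrier_mat n n" using 1 by simp
  then have eq: "B $$ (i, j) = (\<Sum>k<n. (\<Sum>m<n. P $$ (i, m) * A $$ (m, k)) * Q $$ (k, j))"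
    unfolding 1(4) using assms(3,4) 1(1-3)
    by (simp add: mult_mat_entry[of "P * A" n Q] mult_mat_entry[of P n A] del: index_mult_mat assoc_mult_mat)
  have "d dvd (\<Sum>m<n. P $$ (i, m) * A $$ (m, k))" if "k < n" for k
    using assms(2) that by (intro dvd_sum dvd_mult) auto
  then show ?thesis unfolding eq by (intro dvd_sum) (simp add: dvd_mult2)
qed

lemma unimodular_border:
  assumes "unimodular m P"
  shows "unimodular (Suc m) (border (1\<^sub>m 1) m P)"
proof -
  obtain P' where P: "unimodular m P'" "P * P' = 1\<^sub>m m" "P' * P = 1\<^sub>m m"
    using unimodular_inverse[OF assms] .
  have "border (1\<^sub>m 1) m (1\<^sub>m m) = 1\<^sub>m (Suc m)"
    unfolding border_def by (rule eq_matI) auto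
  then show ?thesis
    using assms[THEN unimodular_carrier] P(1)[THEN unimodular_carrier] P(2,3)
    by (intro unimodularI[of _ _ "border (1\<^sub>m 1) m P'"]) (simp_all add: border_mult border_carrier)
qed

lemma equivalent_mat_border:
  assumes "equivalent_mat m A B"
  shows "equivalent_mat (Suc m) (border (mat 1 1 (\<lambda>_. d)) m A) (border (mat 1 1 (\<lambda>_. d)) m B)"
proof -
  obtain P Q where 1: "A \<in> carrier_mat m m" "unimodular m P" "unimodular m Q" "B = P * A * Q"
    "P \<in> carrier_mat m m" "Q \<in> carrier_mat m m" using equivalent_matE[OF assms] .
  show ?thesis
    by (rule equivalent_matI[OF _ unimodular_border[OF 1(2)] unimodular_border[OF 1(3)]])
       (use 1 in \<open>simp_all add: border_mult border_carrier\<close>)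
qed

theorem smith_form_exists:
  assumes "A \<in> carrier_mat n n"
  shows "\<exists>D. smith_form n D \<and> equivalent_mat n A D"
  using assms
proof (induction n arbitrary: A)
  case 0
  then show ?case using equivalent_mat_refl[OF 0]
    by (intro exI[of _ A]) (auto simp: smith_form_def diagonal_mat_def)
next
  case (Suc m)
  show ?case
  proof (cases "A = 0\<^sub>m (Suc m) (Suc m)")
    case True
    then show ?thesis using equivalent_mat_refl[OF Suc.prems]
      by (intro exI[of _ A]) (auto simp: smith_form_def diagonal_mat_def)
  next
    case False
    obtain d E where E: "0 < d" "E \<in> carrier_mat m m" "\<And>i j. i < m \<Longrightarrow> j < m \<Longrightarrow> d dvd E $$ (i, j)"
      "equivalent_mat (Suc m) A (border (mat 1 1 (\<lambda>_. d)) m E)"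
      using split_off_min_entry[OF Suc.prems False] by blast
    obtain D where D: "smith_form m D" "equivalent_mat m E D" using Suc.IH[OF E(2)] by blast
    define F where "F = border (mat 1 1 (\<lambda>_. d)) m D"
    have "equivalent_mat (Suc m) A F"
      unfolding F_def by (rule equivalent_mat_trans[OF E(4) equivalent_mat_border[OF D(2)]])
    moreover have "smith_form (Suc m) F"
    proof -
      have carrD: "D \<in> carrier_mat m m" using D by (simp add: smith_form_def)
      have entry: "F $$ (0, Suc j) = 0" "F $$ (Suc j, 0) = 0" if "j < m" for j
        using that carrD by (auto simp: F_def border_def)
      have entry0: "F $$ (0, 0) = d" using carrD by (simp add: F_def border_def)
      have entryS: "F $$ (Suc i, Suc j) = D $$ (i, j)" if "i < m" "j < m" for i j
        using that carrD by (simp add: F_def border_def)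
      have carrF: "F \<in> carrier_mat (Suc m) (Suc m)" using carrD by (auto simp: F_def border_def)
      have diag: "diagonal_mat F"
        unfolding diagonal_mat_def
      proof (intro allI impI)
        fix i j assume "i < dim_row F" "j < dim_col F" "i \<noteq> j"
        then show "F $$ (i, j) = 0"
          using carrF carrD D(1) entry entryS
          by (cases i; cases j) (auto simp: smith_form_def diagonal_mat_def)
      qed
      have nonneg: "0 \<le> F $$ (i, i)" if "i < Suc m" for i
        using that entry0 entryS[of "i - 1" "i - 1"] E(1) D(1) by (cases i) (auto simp: smith_form_def)
      have dvd: "F $$ (i, i) dvd F $$ (Suc i, Suc i)" if "Suc i < Suc m" for i
      proof (cases i)
        case 0
        then show ?thesis using that equivalent_mat_dvd[OF D(2) E(3), of 0 0] entry0 entryS[of 0 0] by simp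
      next
        case (Suc k)
        then show ?thesis using that D(1) entryS[of k k] entryS[of i i] by (simp add: smith_form_def)
      qed
      show ?thesis using carrF diag nonneg dvd by (simp add: smith_form_def)
    qed
    ultimately show ?thesis by blast
  qed
qed

section \<open>Rank modulo a prime\<close>

abbreviation int_funs :: "'a set \<Rightarrow> int set \<Rightarrow> ('a \<Rightarrow> int) set" where
  "int_funs I A \<equiv> PiE_dflt I 0 (\<lambda>_. A)"

text \<open>Residues in {0..<p}, and 0 outside the first n positions, make congruent vectors equal
  as functions, so that images modulo p are finite sets whose elements can be counted.\<close>

definition red_vec :: "nat \<Rightarrow> nat \<Rightarrow> (nat \<Rightarrow> int) \<Rightarrow> nat \<Rightarrow> int" where
  "red_vec p n f = (\<lambda>i. if i < n then f i mod int p else 0)"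

lemma red_vec_cong: "(\<And>i. i < n \<Longrightarrow> [f i = g i] (mod int p)) \<Longrightarrow> red_vec p n f = red_vec p n g"
  by (auto simp: red_vec_def cong_def)

definition im_mod :: "nat \<Rightarrow> nat \<Rightarrow> int mat \<Rightarrow> (nat \<Rightarrow> int) set" where
  "im_mod p n A = range (\<lambda>v. red_vec p n (\<lambda>i. \<Sum>j<n. A $$ (i, j) * v j))"

lemma red_vec_in: "p > 0 \<Longrightarrow> red_vec p n f \<in> int_funs {..<n} {0..<int p}"
  by (auto simp: red_vec_def PiE_dflt_def)

lemma im_mod_subset: "p > 0 \<Longrightarrow> im_mod p n A \<subseteq> int_funs {..<n} {0..<int p}"
  by (auto simp: im_mod_def intro: red_vec_in)

lemma finite_im_mod:
  assumes "p > 0" shows "finite (im_mod p n A)"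
  by (rule finite_subset[OF im_mod_subset[OF assms]]) auto

lemma im_mod_cong:
  assumes "mat_cong p n A B" shows "im_mod p n A = im_mod p n B"
proof -
  have "red_vec p n (\<lambda>i. \<Sum>j<n. A $$ (i, j) * v j) = red_vec p n (\<lambda>i. \<Sum>j<n. B $$ (i, j) * v j)" for v
    using assms unfolding mat_cong_def
    by (intro red_vec_cong cong_sum cong_mult) auto
  then show ?thesis by (simp add: im_mod_def)
qed

lemma sum_mult_mat:
  fixes A B :: "int mat"
  assumes "A \<in> carrier_mat n n" "B \<in> carrier_mat n n" "i < n"
  shows "(\<Sum>j<n. (A * B) $$ (i, j) * v j) = (\<Sum>k<n. A $$ (i, k) * (\<Sum>j<n. B $$ (k, j) * v j))"
proof -
  have "(\<Sum>j<n. (A * B) $$ (i, j) * v j) = (\<Sum>j<n. \<Sum>k<n. A $$ (i, k) * B $$ (k, j) * v j)"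
    using assms by (intro sum.cong) (auto simp: mult_mat_entry[of A n B] sum_distrib_right simp del: index_mult_mat)
  also have "\<dots> = (\<Sum>k<n. \<Sum>j<n. A $$ (i, k) * B $$ (k, j) * v j)" by (rule sum.swap)
  finally show ?thesis by (simp add: sum_distrib_left mult.assoc)
qed

lemma im_mod_mult_right:
  assumes "A \<in> carrier_mat n n" "Q \<in> carrier_mat n n"
  shows "im_mod p n (A * Q) \<subseteq> im_mod p n A"
proof
  fix w assume "w \<in> im_mod p n (A * Q)"
  then obtain v where "w = red_vec p n (\<lambda>i. \<Sum>j<n. (A * Q) $$ (i, j) * v j)" by (auto simp: im_mod_def)
  also have "\<dots> = red_vec p n (\<lambda>i. \<Sum>k<n. A $$ (i, k) * (\<Sum>j<n. Q $$ (k, j) * v j))"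
    by (rule red_vec_cong) (simp add: sum_mult_mat[OF assms] del: index_mult_mat)
  finally show "w \<in> im_mod p n A" unfolding im_mod_def by (rule range_eqI[of _ _ "\<lambda>k. \<Sum>j<n. Q $$ (k, j) * v j"])
qed

lemma im_mod_mult_left:
  assumes "P \<in> carrier_mat n n" "A \<in> carrier_mat n n"
  shows "im_mod p n (P * A) \<subseteq> (\<lambda>w. red_vec p n (\<lambda>i. \<Sum>k<n. P $$ (i, k) * w k)) ` im_mod p n A"
proof
  fix u assume "u \<in> im_mod p n (P * A)"
  then obtain v where u: "u = red_vec p n (\<lambda>i. \<Sum>j<n. (P * A) $$ (i, j) * v j)" by (auto simp: im_mod_def)
  define w where "w = red_vec p n (\<lambda>k. \<Sum>j<n. A $$ (k, j) * v j)"
  have "u = red_vec p n (\<lambda>i. \<Sum>k<n. P $$ (i, k) * w k)"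
    unfolding u
  proof (rule red_vec_cong)
    fix i assume "i < n"
    show "[(\<Sum>j<n. (P * A) $$ (i, j) * v j) = (\<Sum>k<n. P $$ (i, k) * w k)] (mod int p)"
      unfolding sum_mult_mat[OF assms \<open>i < n\<close>]
      by (intro cong_sum cong_mult cong_refl) (simp add: w_def red_vec_def cong_def)
  qed
  moreover have "w \<in> im_mod p n A" unfolding w_def im_mod_def by blast
  ultimately show "u \<in> (\<lambda>w. red_vec p n (\<lambda>i. \<Sum>k<n. P $$ (i, k) * w k)) ` im_mod p n A" by blast
qed

lemma card_im_mod_mult_le:
  assumes "P \<in> carrier_mat n n" "A \<in> carrier_mat n n" "Q \<in> carrier_mat n n" "p > 0"
  shows "card (im_mod p n (P * A * Q)) \<le> card (im_mod p n A)"
proof -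
  have "card (im_mod p n (P * A * Q)) \<le> card (im_mod p n (P * A))"
    by (rule card_mono[OF finite_im_mod im_mod_mult_right]) (use assms in auto)
  also have "\<dots> \<le> card ((\<lambda>w. red_vec p n (\<lambda>i. \<Sum>k<n. P $$ (i, k) * w k)) ` im_mod p n A)"
    by (rule card_mono[OF finite_imageI[OF finite_im_mod] im_mod_mult_left]) (use assms in auto)
  also have "\<dots> \<le> card (im_mod p n A)"
    by (rule card_image_le[OF finite_im_mod[OF assms(4)]])
  finally show ?thesis .
qed

lemma equivalent_mat_sym:
  assumes "equivalent_mat n A B"
  shows "equivalent_mat n B A"
proof -
  obtain P Q where 1: "A \<in> carrier_mat n n" "unimodular n P" "unimodular n Q" "B = P * A * Q"
    "P \<in> carrier_mat n n" "Q \<in> carrier_mat n n" using equivalent_matE[OF assms] .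
  obtain P' where P: "unimodular n P'" "P * P' = 1\<^sub>m n" "P' * P = 1\<^sub>m n"
    using unimodular_inverse[OF 1(2)] .
  obtain Q' where Q: "unimodular n Q'" "Q * Q' = 1\<^sub>m n" "Q' * Q = 1\<^sub>m n"
    using unimodular_inverse[OF 1(3)] .
  have "P' * B * Q' = (P' * P) * A * (Q * Q')"
    unfolding 1(4) using 1(1,5,6) P(1)[THEN unimodular_carrier] Q(1)[THEN unimodular_carrier]
    by (simp add: assoc_mult_mat[of _ n n _ n _ n])
  also have "\<dots> = A" unfolding P Q using 1(1) by simp
  finally show ?thesis by (intro equivalent_matI[OF _ P(1) Q(1)]) (use 1 in auto)
qed

lemma card_im_mod_equivalent:
  assumes "equivalent_mat n A B" "p > 0"
  shows "card (im_mod p n A) = card (im_mod p n B)"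
proof -
  have "card (im_mod p n B) \<le> card (im_mod p n A)" if "equivalent_mat n A B" for A B
    using that assms(2) card_im_mod_mult_le by (auto elim!: equivalent_matE simp del: assoc_mult_mat)
  then show ?thesis using assms(1) equivalent_mat_sym by (meson le_antisym)
qed

definition units_mod :: "nat \<Rightarrow> nat \<Rightarrow> int mat \<Rightarrow> nat set" where
  "units_mod p n D = {i. i < n \<and> \<not> int p dvd D $$ (i, i)}"

lemma finite_units_mod [simp]: "finite (units_mod p n D)"
  by (simp add: units_mod_def)

text \<open>The image of a diagonal matrix is a product, over the rows, of either {0} or all
  residues. The off-diagonal entries are assumed to vanish only modulo p, so that Smith forms over
  the integers and modulo p are treated alike.\<close>

lemma card_im_mod_diagonal:
  assumes p: "prime p" and off: "\<And>i j. i < n \<Longrightarrow> j < n \<Longrightarrow> i \<noteq> j \<Longrightarrow> [D $$ (i, j) = 0] (mod int p)"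
  shows "card (im_mod p n D) = p ^ card (units_mod p n D)"
proof -
  define W where "W i = (if int p dvd D $$ (i, i) then {0} else {0..<int p})" for i
  have p0: "int p > 0" using prime_gt_0_nat[OF p] by simp
  have diag: "(\<Sum>j<n. D $$ (i, j) * v j) mod int p = D $$ (i, i) * v i mod int p" if i: "i < n" for i v
  proof -
    have "[(\<Sum>j<n. D $$ (i, j) * v j) = (\<Sum>j<n. if j = i then D $$ (i, i) * v i else 0)] (mod int p)"
    proof (rule cong_sum)
      fix j assume "j \<in> {..<n}"
      then show "[D $$ (i, j) * v j = (if j = i then D $$ (i, i) * v i else 0)] (mod int p)"
        using off[of i j] i cong_scalar_right[of "D $$ (i, j)" 0 "int p" "v j"] by auto
    qed
    then show ?thesis using i by (simp add: cong_def)
  qed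
  have red: "red_vec p n (\<lambda>i. \<Sum>j<n. D $$ (i, j) * v j) = red_vec p n (\<lambda>i. D $$ (i, i) * v i)" for v
    by (auto simp: red_vec_def diag)
  have "im_mod p n D = PiE_dflt {..<n} 0 W"
  proof (intro equalityI subsetI)
    fix w assume "w \<in> im_mod p n D"
    then obtain v where "w = red_vec p n (\<lambda>i. D $$ (i, i) * v i)" by (auto simp: im_mod_def red)
    then show "w \<in> PiE_dflt {..<n} 0 W"
      using p0 by (auto simp: W_def red_vec_def PiE_dflt_def)
  next
    fix g assume g: "g \<in> PiE_dflt {..<n} 0 W"
    have "\<exists>x. D $$ (i, i) * x mod int p = g i" if "i < n" for i
    proof (cases "int p dvd D $$ (i, i)")
      case True
      then have "g i = 0" using g that by (auto simp: W_def PiE_dflt_def dest!: spec[of _ i])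
      then show ?thesis by (intro exI[of _ 0]) simp
    next
      case False
      then have "coprime (D $$ (i, i)) (int p)"
        using p by (metis coprime_commute prime_imp_coprime prime_nat_int_transfer)
      then obtain x where x: "[D $$ (i, i) * x = 1] (mod int p)" using cong_solve_coprime_int by blast
      have "[D $$ (i, i) * x * g i = 1 * g i] (mod int p)" by (rule cong_scalar_right[OF x])
      moreover have "g i mod int p = g i"
        using g that False by (auto simp: W_def PiE_dflt_def dest!: spec[of _ i])
      ultimately show ?thesis by (intro exI[of _ "x * g i"]) (simp add: cong_def mult.assoc)
    qed
    then obtain v where v: "\<And>i. i < n \<Longrightarrow> D $$ (i, i) * v i mod int p = g i" by metis
    have "g = red_vec p n (\<lambda>i. \<Sum>j<n. D $$ (i, j) * v j)"
      unfolding red using g by (auto simp: red_vec_def v PiE_dflt_def)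
    then show "g \<in> im_mod p n D" unfolding im_mod_def by blast
  qed
  then have "card (im_mod p n D) = card (PiE_dflt {..<n} 0 W)" by simp
  also have "\<dots> = (\<Prod>i<n. card (W i))" by (subst card_PiE_dflt) (auto simp: W_def)
  also have "\<dots> = (\<Prod>i<n. if \<not> int p dvd D $$ (i, i) then p else 1)"
    by (rule prod.cong) (auto simp: W_def)
  also have "\<dots> = p ^ card (units_mod p n D)"
    by (subst prod.If_cases) (auto simp: units_mod_def intro!: arg_cong[of _ _ card] arg_cong[of _ _ "\<lambda>k. p ^ k"])
  finally show ?thesis .
qed

lemma card_split:
  "card {i. i < n \<and> P i} + card {i. i < n \<and> \<not> P i} = (n::nat)"
proof -
  have "card ({i. i < n \<and> P i} \<union> {i. i < n \<and> \<not> P i}) = card {i. i < n \<and> P i} + card {i. i < n \<and> \<not> P i}"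
    by (rule card_Un_disjoint) auto
  moreover have "{i. i < n \<and> P i} \<union> {i. i < n \<and> \<not> P i} = {..<n}" by auto
  ultimately show ?thesis by simp
qed

section \<open>The Smith form conditions expressed by ranks modulo primes\<close>

lemma smith_form_dvd:
  assumes "smith_form n D" "i \<le> j" "j < n"
  shows "D $$ (i, i) dvd D $$ (j, j)"
  using assms(2,3)
proof (induction j rule: dec_induct)
  case (step j)
  then show ?case using assms(1) by (auto simp: smith_form_def intro: dvd_trans)
qed simp

lemma smith_form_off:
  assumes "smith_form n D" "i < n" "j < n" "i \<noteq> j"
  shows "[D $$ (i, j) = 0] (mod int p)"
  using assms by (auto simp: smith_form_def diagonal_mat_def)

lemma unimodular_iff_invertible_mat: "unimodular n P \<longleftrightarrow> P \<in> carrier_mat n n \<and> invertible_mat P"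
proof
  assume *: "P \<in> carrier_mat n n \<and> invertible_mat P"
  then have P: "P \<in> carrier_mat n n" "invertible_mat P" by blast+
  then obtain B where B: "P * B = 1\<^sub>m n" "B * P = 1\<^sub>m (dim_row B)"
    unfolding invertible_mat_def inverts_mat_def by auto
  \<comment> \<open>\<open>invertible_mat\<close> leaves the dimensions of the inverse open; they
    are read off from the two identity matrices.\<close>
  have "dim_col B = n" using arg_cong[OF B(1), of dim_col] by simp
  moreover have "dim_row B = n" using arg_cong[OF B(2), of dim_col] P by simp
  ultimately show "unimodular n P" using B P by (intro unimodularI[of _ _ B]) auto
qed (auto simp: unimodular_def invertible_mat_def inverts_mat_def)

lemma is_snf_iff: "M \<in> carrier_mat n n \<Longrightarrow> is_snf n M D \<longleftrightarrow> smith_form n D \<and> equivalent_mat n M D"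
  unfolding is_snf_def equivalent_mat_def unimodular_iff_invertible_mat by blast

text \<open>Diagonal entries 1 stay units modulo every prime. Conversely, a prime dividing the first
  entry different from 1 divides all later ones, so the rank modulo this prime is at most the number
  of leading ones, which is below n - l if more than l entries differ from 1.\<close>

theorem snf_in_snf_T_iff:
  assumes M: "M \<in> carrier_mat n n" and l: "l \<le> n"
  shows "(\<exists>D\<in>snf_T n l. is_snf n M D) \<longleftrightarrow> (\<forall>p. prime p \<longrightarrow> p ^ (n - l) \<le> card (im_mod p n M))"
proof
  assume "\<exists>D\<in>snf_T n l. is_snf n M D"
  then obtain D where D: "smith_form n D" "card {i. i < n \<and> D $$ (i, i) \<noteq> 1} \<le> l" "equivalent_mat n M D"
    using M by (auto simp: snf_T_def is_snf_iff)
  show "\<forall>p. prime p \<longrightarrow> p ^ (n - l) \<le> card (im_mod p n M)"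
  proof (intro allI impI)
    fix p :: nat assume p: "prime p"
    have "n - l \<le> card {i. i < n \<and> D $$ (i, i) = 1}"
      using card_split[of n "\<lambda>i. D $$ (i, i) = 1"] D(2) by simp
    also have "\<dots> \<le> card (units_mod p n D)"
      using prime_gt_1_nat[OF p] by (intro card_mono) (auto simp: units_mod_def zdvd1_eq)
    finally have "p ^ (n - l) \<le> p ^ card (units_mod p n D)"
      using prime_gt_0_nat[OF p] by (intro power_increasing) auto
    also have "\<dots> = card (im_mod p n D)"
      by (rule card_im_mod_diagonal[OF p smith_form_off[OF D(1)], symmetric])
    also have "\<dots> = card (im_mod p n M)"
      using card_im_mod_equivalent[OF D(3)] prime_gt_0_nat[OF p] by simp
    finally show "p ^ (n - l) \<le> card (im_mod p n M)" .
  qed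
next
  assume big: "\<forall>p. prime p \<longrightarrow> p ^ (n - l) \<le> card (im_mod p n M)"
  obtain D where D: "smith_form n D" "equivalent_mat n M D" using smith_form_exists[OF M] by blast
  define N where "N = {i. i < n \<and> D $$ (i, i) \<noteq> 1}"
  have finN: "finite N" unfolding N_def by auto
  have "card N \<le> l"
  proof (rule ccontr)
    assume "\<not> card N \<le> l"
    then have cN: "l < card N" by simp
    then have "N \<noteq> {}" by auto
    define i0 where "i0 = Min N"
    have i0: "i0 \<in> N" "\<And>i. i \<in> N \<Longrightarrow> i0 \<le> i" using finN \<open>N \<noteq> {}\<close> by (auto simp: i0_def)
    have "D $$ (i0, i0) \<ge> 0" "D $$ (i0, i0) \<noteq> 1" using i0 D(1) by (auto simp: N_def smith_form_def)
    \<comment> \<open>The entry 0 is included: it differs from 1, and every prime divides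
      it.\<close>
    then have "nat (D $$ (i0, i0)) \<noteq> 1" by auto
    then obtain p where p: "prime p" "p dvd nat (D $$ (i0, i0))" using prime_factor_nat by blast
    have p_dvd: "int p dvd D $$ (i0, i0)" using p(2) \<open>D $$ (i0, i0) \<ge> 0\<close> by (simp add: int_dvd_int_iff[symmetric])
    have "N \<subseteq> {i0..<n}" using i0 by (auto simp: N_def)
    then have "card N \<le> n - i0" using card_mono[of "{i0..<n}" N] by simp
    moreover have "units_mod p n D \<subseteq> {..<i0}"
    proof
      fix i assume i: "i \<in> units_mod p n D"
      show "i \<in> {..<i0}"
      proof (rule ccontr)
        assume "i \<notin> {..<i0}"
        then have "D $$ (i0, i0) dvd D $$ (i, i)" using smith_form_dvd[OF D(1)] i by (simp add: units_mod_def)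
        then show False using p_dvd i dvd_trans unfolding units_mod_def by blast
      qed
    qed
    then have "card (units_mod p n D) \<le> i0"
      using card_mono[of "{..<i0}"] by fastforce
    ultimately have "card (units_mod p n D) < n - l" using cN by linarith
    then have "p ^ card (units_mod p n D) < p ^ (n - l)"
      using prime_gt_1_nat[OF p(1)] by (rule power_strict_increasing)
    moreover have "card (im_mod p n M) = p ^ card (units_mod p n D)"
      using card_im_mod_equivalent[OF D(2)] card_im_mod_diagonal[OF p(1) smith_form_off[OF D(1)]]
        prime_gt_0_nat[OF p(1)] by simp
    ultimately show False using big p(1) by (metis not_le)
  qed
  then show "\<exists>D\<in>snf_T n l. is_snf n M D"
    using D M by (intro bexI[of _ D]) (auto simp: snf_T_def is_snf_iff N_def)
qed

lemma mat_cong_refl: "A = B \<Longrightarrow> mat_cong p n A B"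
  by (simp add: mat_cong_def)

lemma unimodular_invertible_mod: "unimodular n P \<Longrightarrow> invertible_mod p n P"
  unfolding unimodular_def invertible_mod_def by (metis mat_cong_refl)

text \<open>The integral Smith form of a representative, read modulo p, is a Smith form over Z/p, so
  no separate elimination over Z/p has to be carried out.\<close>

theorem snf_mod_in_snf_T_iff:
  assumes M: "M \<in> carrier_mat n n" and l: "l \<le> n" and p: "prime p"
  shows "(\<exists>D\<in>snf_T n l. \<exists>E. is_snf_mod p n M E \<and> same_diagonal_mod p n D E)
    \<longleftrightarrow> p ^ (n - l) \<le> card (im_mod p n M)"
proof
  assume "\<exists>D\<in>snf_T n l. \<exists>E. is_snf_mod p n M E \<and> same_diagonal_mod p n D E"
  then obtain D E P Q where D: "smith_form n D" "card {i. i < n \<and> D $$ (i, i) \<noteq> 1} \<le> l"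
    and E: "smith_form_mod p n E" and same: "same_diagonal_mod p n D E"
    and PQ: "P \<in> carrier_mat n n" "Q \<in> carrier_mat n n" and cong: "mat_cong p n E (P * M * Q)"
    by (auto simp: snf_T_def is_snf_mod_def)
  have "n - l \<le> card {i. i < n \<and> D $$ (i, i) = 1}"
    using card_split[of n "\<lambda>i. D $$ (i, i) = 1"] D(2) by simp
  also have "\<dots> \<le> card (units_mod p n E)"
  proof (rule card_mono)
    show "{i. i < n \<and> D $$ (i, i) = 1} \<subseteq> units_mod p n E"
      unfolding units_mod_def
    proof safe
      fix i assume i: "i < n" "D $$ (i, i) = 1" "int p dvd E $$ (i, i)"
      then obtain u where "[1 = u * E $$ (i, i)] (mod int p)"
        using same by (auto simp: same_diagonal_mod_def)
      then have "int p dvd 1" using i(3) by (metis cong_0_iff cong_trans dvd_mult)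
      then show False using prime_gt_1_nat[OF p] by simp
    qed
  qed simp
  finally have "p ^ (n - l) \<le> p ^ card (units_mod p n E)"
    using prime_gt_0_nat[OF p] by (intro power_increasing) auto
  also have "\<dots> = card (im_mod p n E)"
    by (rule card_im_mod_diagonal[OF p, symmetric]) (use E in \<open>auto simp: smith_form_mod_def\<close>)
  also have "\<dots> \<le> card (im_mod p n M)"
    unfolding im_mod_cong[OF cong] by (rule card_im_mod_mult_le[OF PQ(1) M PQ(2) prime_gt_0_nat[OF p]])
  finally show "p ^ (n - l) \<le> card (im_mod p n M)" .
next
  assume big: "p ^ (n - l) \<le> card (im_mod p n M)"
  obtain E where E: "smith_form n E" "equivalent_mat n M E" using smith_form_exists[OF M] by blast
  then obtain P Q where 1: "unimodular n P" "unimodular n Q" "E = P * M * Q" "P \<in> carrier_mat n n" "Q \<in> carrier_mat n n"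
    by (auto elim: equivalent_matE)
  have inv: "invertible_mod p n P" "invertible_mod p n Q"
    using 1(1,2) by (simp_all add: unimodular_invertible_mod)
  have "smith_form_mod p n E"
    unfolding smith_form_mod_def
  proof (intro conjI allI impI)
    fix i assume "Suc i < n"
    then obtain c where "E $$ (Suc i, Suc i) = E $$ (i, i) * c" using E(1) by (auto simp: smith_form_def dvd_def)
    then show "\<exists>c. [E $$ (Suc i, Suc i) = E $$ (i, i) * c] (mod int p)" by (intro exI[of _ c]) simp
  qed (use E(1) smith_form_off[OF E(1)] in \<open>auto simp: smith_form_def\<close>)
  then have "is_snf_mod p n M E"
    unfolding is_snf_mod_def using inv 1 by (auto intro!: mat_cong_refl)
  \<comment> \<open>The divisibility chain of E places its units modulo p first, so this 0/1 matrix
    is a Smith form over the integers; modulo p its diagonal agrees with that of E up to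
    units.\<close>
  moreover define D :: "int mat" where
    "D = mat n n (\<lambda>(i, j). if i = j \<and> \<not> int p dvd E $$ (i, i) then 1 else 0)"
  have "same_diagonal_mod p n D E"
    unfolding same_diagonal_mod_def
  proof (intro allI impI)
    fix i assume i: "i < n"
    show "\<exists>u. coprime u (int p) \<and> [D $$ (i, i) = u * E $$ (i, i)] (mod int p)"
    proof (cases "int p dvd E $$ (i, i)")
      case True
      then show ?thesis using i by (intro exI[of _ 1]) (auto simp: D_def cong_def)
    next
      case False
      then have "coprime (E $$ (i, i)) (int p)"
        using p by (metis coprime_commute prime_imp_coprime prime_nat_int_transfer)
      then obtain x where x: "[E $$ (i, i) * x = 1] (mod int p)" using cong_solve_coprime_int by blast
      then have "coprime x (int p)" using coprime_iff_invertible_int by (metis mult.commute)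
      then show ?thesis using x i False
        by (intro exI[of _ x]) (auto simp: D_def mult.commute intro: cong_sym)
    qed
  qed
  moreover have "D \<in> snf_T n l"
  proof -
    have "p ^ (n - l) \<le> p ^ card (units_mod p n E)"
      using big card_im_mod_equivalent[OF E(2)] card_im_mod_diagonal[OF p smith_form_off[OF E(1)]]
        prime_gt_0_nat[OF p] by simp
    then have "n - l \<le> card (units_mod p n E)"
      using prime_gt_1_nat[OF p] by (metis power_le_imp_le_exp)
    then have "card {i. i < n \<and> \<not> \<not> int p dvd E $$ (i, i)} \<le> l"
      using card_split[of n "\<lambda>i. \<not> int p dvd E $$ (i, i)"] l unfolding units_mod_def by linarith
    moreover have "{i. i < n \<and> D $$ (i, i) \<noteq> 1} = {i. i < n \<and> \<not> \<not> int p dvd E $$ (i, i)}"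
      by (auto simp: D_def split: if_splits)
    moreover have "D $$ (i, i) dvd D $$ (Suc i, Suc i)" if "Suc i < n" for i
      using that smith_form_dvd[OF E(1), of i "Suc i"] dvd_trans by (auto simp: D_def)
    ultimately show ?thesis
      by (auto simp: snf_T_def smith_form_def diagonal_mat_def D_def)
  qed
  ultimately show "\<exists>D\<in>snf_T n l. \<exists>E. is_snf_mod p n M E \<and> same_diagonal_mod p n D E" by blast
qed

section \<open>Counting matrices of given rank\<close>

definition vecs :: "nat \<Rightarrow> nat \<Rightarrow> (nat \<Rightarrow> int) set" where
  "vecs p n = int_funs {..<n} {0..<int p}"

lemma finite_vecs [simp]: "finite (vecs p n)"
  by (auto simp: vecs_def)

lemma card_vecs: "card (vecs p n) = p ^ n"
  by (simp add: vecs_def card_PiE_dflt)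

lemma red_vec_vecs: "v \<in> vecs p n \<Longrightarrow> red_vec p n v = v"
  by (auto simp: vecs_def PiE_dflt_def red_vec_def fun_eq_iff)

lemma red_vec_in_vecs: "p > 0 \<Longrightarrow> red_vec p n v \<in> vecs p n"
  using red_vec_in by (simp add: vecs_def)

lemma red_vec_eq_iff: "red_vec p n f = red_vec p n g \<longleftrightarrow> (\<forall>i<n. [f i = g i] (mod int p))"
  by (auto simp: red_vec_def fun_eq_iff cong_def)

text \<open>The recursion adds one column at a time; the head of the list is the column revealed
  last.\<close>

fun span_mod :: "nat \<Rightarrow> nat \<Rightarrow> (nat \<Rightarrow> int) list \<Rightarrow> (nat \<Rightarrow> int) set" where
  "span_mod p n [] = {\<lambda>_. 0}"
| "span_mod p n (c # cs) = {red_vec p n (\<lambda>i. w i + a * c i) | w a. w \<in> span_mod p n cs}"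

lemma span_mod_subset: "p > 0 \<Longrightarrow> span_mod p n cs \<subseteq> vecs p n"
  by (cases cs) (auto simp: red_vec_in_vecs, auto simp: vecs_def PiE_dflt_def)

lemma finite_span_mod: "p > 0 \<Longrightarrow> finite (span_mod p n cs)"
  using finite_subset[OF span_mod_subset finite_vecs] .

lemma span_mod_ConsI: "w \<in> span_mod p n cs \<Longrightarrow> red_vec p n (\<lambda>i. w i + a * c i) \<in> span_mod p n (c # cs)"
  by auto

lemma zero_in_span_mod: "(\<lambda>_. 0) \<in> span_mod p n cs"
proof (induction cs)
  case (Cons c cs)
  have "red_vec p n (\<lambda>i. 0 + 0 * c i) \<in> span_mod p n (c # cs)"
    using span_mod_ConsI[OF Cons] .
  moreover have "red_vec p n (\<lambda>i. 0 + 0 * c i) = (\<lambda>_. 0)" by (simp add: red_vec_def fun_eq_iff)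
  ultimately show ?case by (simp only:)
qed simp

lemma span_mod_comb:
  assumes "p > 0" "v \<in> span_mod p n cs" "w \<in> span_mod p n cs"
  shows "red_vec p n (\<lambda>i. v i + b * w i) \<in> span_mod p n cs"
  using assms(2,3)
proof (induction cs arbitrary: v w)
  case Nil
  then show ?case by (simp add: red_vec_def fun_eq_iff)
next
  case (Cons c cs)
  then obtain v' a w' a' where v: "v' \<in> span_mod p n cs" "v = red_vec p n (\<lambda>i. v' i + a * c i)"
    and w: "w' \<in> span_mod p n cs" "w = red_vec p n (\<lambda>i. w' i + a' * c i)" by auto
  define u where "u = red_vec p n (\<lambda>i. v' i + b * w' i)"
  have u: "u \<in> span_mod p n cs" unfolding u_def by (rule Cons.IH[OF v(1) w(1)])
  have "red_vec p n (\<lambda>i. v i + b * w i) = red_vec p n (\<lambda>i. u i + (a + b * a') * c i)"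
  proof (rule red_vec_cong)
    fix i assume "i < n"
    then have "[v i = v' i + a * c i] (mod int p)" "[w i = w' i + a' * c i] (mod int p)"
      "[u i = v' i + b * w' i] (mod int p)"
      by (simp_all add: v(2) w(2) u_def red_vec_def cong_def)
    then have "[v i + b * w i = (v' i + a * c i) + b * (w' i + a' * c i)] (mod int p)"
      "[u i + (a + b * a') * c i = v' i + b * w' i + (a + b * a') * c i] (mod int p)"
      by (auto intro!: cong_add cong_mult)
    moreover have "(v' i + a * c i) + b * (w' i + a' * c i) = v' i + b * w' i + (a + b * a') * c i"
      by (simp add: algebra_simps)
    ultimately show "[v i + b * w i = u i + (a + b * a') * c i] (mod int p)"
      by (metis cong_sym cong_trans)
  qed
  then show ?case using span_mod_ConsI[OF u] by simp
qed

lemma span_mod_scale: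
  assumes "p > 0" "w \<in> span_mod p n cs"
  shows "red_vec p n (\<lambda>i. b * w i) \<in> span_mod p n cs"
  using span_mod_comb[OF assms(1) zero_in_span_mod assms(2), of b] by simp

lemma span_mod_Cons_in:
  assumes "p > 0" "c \<in> span_mod p n cs"
  shows "span_mod p n (c # cs) = span_mod p n cs"
proof (intro equalityI subsetI)
  fix w assume "w \<in> span_mod p n (c # cs)"
  then show "w \<in> span_mod p n cs" using span_mod_comb[OF assms(1) _ assms(2)] by auto
next
  fix w assume w: "w \<in> span_mod p n cs"
  then have "w = red_vec p n (\<lambda>i. w i + 0 * c i)"
    using span_mod_subset[OF assms(1)] by (simp add: red_vec_vecs subset_iff)
  then show "w \<in> span_mod p n (c # cs)" using w by (simp only: span_mod.simps) blast
qed

text \<open>The map from (a, w) to w + a c is injective: a collision with a \<noteq> a' could be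
  divided by a - a', which is invertible modulo p, and would put c into the span.\<close>

lemma card_span_mod_Cons_notin:
  assumes p: "prime p" and c: "c \<in> vecs p n" "c \<notin> span_mod p n cs"
  shows "card (span_mod p n (c # cs)) = p * card (span_mod p n cs)"
proof -
  have p0: "p > 0" using prime_gt_0_nat[OF p] .
  define F where "F = (\<lambda>(a, w). red_vec p n (\<lambda>i. w i + a * c i))"
  have "inj_on F ({0..<int p} \<times> span_mod p n cs)"
  proof (rule inj_onI, clarify)
    fix a w a' w'
    assume a: "a \<in> {0..<int p}" "a' \<in> {0..<int p}" and w: "w \<in> span_mod p n cs" "w' \<in> span_mod p n cs"
      and "F (a, w) = F (a', w')"
    then have eq: "[w i + a * c i = w' i + a' * c i] (mod int p)" if "i < n" for i
      using that by (simp add: F_def red_vec_eq_iff)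
    have "a = a'"
    proof (rule ccontr)
      assume "a \<noteq> a'"
      have "\<not> int p dvd (a - a')"
      proof
        assume "int p dvd (a - a')"
        then have "\<bar>a - a'\<bar> \<ge> int p" using \<open>a \<noteq> a'\<close> dvd_imp_le_int[of "a - a'" "int p"] by simp
        then show False using a by auto
      qed
      then have "coprime (a - a') (int p)"
        using p by (metis coprime_commute prime_imp_coprime prime_nat_int_transfer)
      then obtain x where x: "[(a - a') * x = 1] (mod int p)" using cong_solve_coprime_int by blast
      define u where "u = red_vec p n (\<lambda>i. w' i + (- 1) * w i)"
      have u: "u \<in> span_mod p n cs" unfolding u_def by (rule span_mod_comb[OF p0 w(2,1)])
      have "c = red_vec p n (\<lambda>i. x * u i)"
      proof -
        have "red_vec p n c = red_vec p n (\<lambda>i. x * u i)"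
        proof (rule red_vec_cong)
          fix i assume i: "i < n"
          have "[(a - a') * c i = w' i - w i] (mod int p)"
            using cong_diff[OF eq[OF i] cong_refl[of "w i + a' * c i"]] by (simp add: algebra_simps)
          moreover have "[u i = w' i - w i] (mod int p)" using i by (simp add: u_def red_vec_def cong_def)
          ultimately have "[x * u i = x * ((a - a') * c i)] (mod int p)"
            by (intro cong_scalar_left) (metis cong_sym cong_trans)
          moreover have "[x * ((a - a') * c i) = c i] (mod int p)"
            using cong_scalar_right[OF x, of "c i"] by (simp add: ac_simps)
          ultimately show "[c i = x * u i] (mod int p)" by (metis cong_sym cong_trans)
        qed
        then show ?thesis using red_vec_vecs[OF c(1)] by simp
      qed
      then show False using c(2) span_mod_scale[OF p0 u] by simp
    qed
    moreover have "w = w'"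
    proof -
      have "red_vec p n w = red_vec p n w'"
        by (rule red_vec_cong) (use eq \<open>a = a'\<close> in \<open>auto simp: cong_add_rcancel\<close>)
      then show ?thesis
        using w span_mod_subset[OF p0] by (metis red_vec_vecs subsetD)
    qed
    ultimately show "a = a' \<and> w = w'" by simp
  qed
  moreover have "span_mod p n (c # cs) = F ` ({0..<int p} \<times> span_mod p n cs)"
  proof (intro equalityI subsetI)
    fix v assume "v \<in> span_mod p n (c # cs)"
    then obtain w a where v: "v = red_vec p n (\<lambda>i. w i + a * c i)" "w \<in> span_mod p n cs" by auto
    have "v = F (a mod int p, w)"
      unfolding v(1) F_def by (auto intro!: red_vec_cong cong_add cong_mult simp: cong_def)
    moreover have "a mod int p \<in> {0..<int p}" using p0 by simp
    ultimately show "v \<in> F ` ({0..<int p} \<times> span_mod p n cs)" using v(2) by blast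
  qed (auto simp: F_def)
  ultimately have "card (span_mod p n (c # cs)) = card ({0..<int p} \<times> span_mod p n cs)"
    by (simp only: card_image)
  then show ?thesis by (simp add: card_cartesian_product)
qed

text \<open>This is the rank over Z/p: it counts the columns that enlarge the span of those behind
  them in the list.\<close>

fun rank_mod :: "nat \<Rightarrow> nat \<Rightarrow> (nat \<Rightarrow> int) list \<Rightarrow> nat" where
  "rank_mod p n [] = 0"
| "rank_mod p n (c # cs) = rank_mod p n cs + (if c \<in> span_mod p n cs then 0 else 1)"

lemma card_span_mod:
  assumes "prime p" "set cs \<subseteq> vecs p n"
  shows "card (span_mod p n cs) = p ^ rank_mod p n cs"
  using assms(2)
proof (induction cs)
  case (Cons c cs)
  then show ?case
    using span_mod_Cons_in[of p c n cs] card_span_mod_Cons_notin[OF assms(1), of c n cs] prime_gt_0_nat[OF assms(1)]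
    by (cases "c \<in> span_mod p n cs") (simp_all del: span_mod.simps(2))
qed simp

section \<open>Counting lists of columns by their rank\<close>

definition rank_lists :: "nat \<Rightarrow> nat \<Rightarrow> nat \<Rightarrow> nat \<Rightarrow> (nat \<Rightarrow> int) list set" where
  "rank_lists p n m r = {cs. length cs = m \<and> set cs \<subseteq> vecs p n \<and> rank_mod p n cs = r}"

lemma finite_rank_lists [simp]: "finite (rank_lists p n m r)"
  by (rule finite_subset[OF _ finite_lists_length_eq[OF finite_vecs, of p n m]]) (auto simp: rank_lists_def)

text \<open>A span of rank r has p^r elements, so p^r choices of the new column keep the rank and
  p^n - p^r raise it. This is the counting form of \<open>rank_prob_Suc_0\<close> and
  \<open>rank_prob_Suc_Suc\<close>.\<close>

lemma card_rank_lists_Suc: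
  assumes p: "prime p"
  shows "card (rank_lists p n (Suc m) r) = card (rank_lists p n m r) * p ^ r
    + (if r = 0 then 0 else card (rank_lists p n m (r - 1)) * (p ^ n - p ^ (r - 1)))"
proof -
  have p0: "p > 0" using prime_gt_0_nat[OF p] .
  define A where "A = Sigma (rank_lists p n m r) (\<lambda>cs. span_mod p n cs)"
  define B where "B = Sigma (if r = 0 then {} else rank_lists p n m (r - 1)) (\<lambda>cs. vecs p n - span_mod p n cs)"
  define G where "G = (\<lambda>(cs, c :: nat \<Rightarrow> int). c # cs)"
  have inj: "inj_on G X" for X by (auto simp: inj_on_def G_def)
  have "rank_lists p n (Suc m) r = G ` (A \<union> B)"
  proof (intro equalityI subsetI)
    fix xs assume xs: "xs \<in> rank_lists p n (Suc m) r"
    then obtain c cs where [simp]: "xs = c # cs" by (auto simp: rank_lists_def length_Suc_conv)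
    have "(cs, c) \<in> A \<union> B" using xs by (auto simp: A_def B_def rank_lists_def split: if_splits)
    then show "xs \<in> G ` (A \<union> B)" by (force simp: G_def)
  next
    fix xs assume "xs \<in> G ` (A \<union> B)"
    then show "xs \<in> rank_lists p n (Suc m) r"
      by (auto simp: G_def A_def B_def rank_lists_def split: if_splits dest: subsetD[OF span_mod_subset[OF p0]])
  qed
  then have "card (rank_lists p n (Suc m) r) = card (A \<union> B)" by (simp add: card_image[OF inj])
  also have "\<dots> = card A + card B"
  proof (rule card_Un_disjoint)
    show "finite A" unfolding A_def by (intro finite_SigmaI finite_rank_lists finite_span_mod p0)
    show "finite B" unfolding B_def by (intro finite_SigmaI) auto
    show "A \<inter> B = {}" by (auto simp: A_def B_def)
  qed
  also have "card A = (\<Sum>cs\<in>rank_lists p n m r. p ^ r)"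
  proof -
    have "card A = (\<Sum>cs\<in>rank_lists p n m r. card (span_mod p n cs))"
      unfolding A_def by (subst card_SigmaI) (auto simp: finite_span_mod[OF p0])
    also have "\<dots> = (\<Sum>cs\<in>rank_lists p n m r. p ^ r)"
      by (rule sum.cong) (auto simp: rank_lists_def card_span_mod[OF p])
    finally show ?thesis .
  qed
  also have "card B = (if r = 0 then 0 else card (rank_lists p n m (r - 1)) * (p ^ n - p ^ (r - 1)))"
  proof (cases "r = 0")
    case False
    have "card B = (\<Sum>cs\<in>rank_lists p n m (r - 1). card (vecs p n - span_mod p n cs))"
      unfolding B_def using False by (subst card_SigmaI) auto
    also have "\<dots> = (\<Sum>cs\<in>rank_lists p n m (r - 1). p ^ n - p ^ (r - 1))"
    proof (rule sum.cong[OF refl])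
      fix cs assume "cs \<in> rank_lists p n m (r - 1)"
      then show "card (vecs p n - span_mod p n cs) = p ^ n - p ^ (r - 1)"
        by (subst card_Diff_subset)
           (auto simp: finite_span_mod[OF p0] span_mod_subset[OF p0] card_vecs card_span_mod[OF p] rank_lists_def)
    qed
    finally show ?thesis using False by simp
  qed (simp add: B_def)
  finally show ?thesis by simp
qed

lemma rank_lists_empty:
  assumes "prime p" "n < r" shows "rank_lists p n m r = {}"
proof -
  have "rank_mod p n cs \<le> n" if "set cs \<subseteq> vecs p n" for cs
  proof -
    have "p ^ rank_mod p n cs \<le> p ^ n"
      using card_mono[OF finite_vecs span_mod_subset, of p n cs] card_span_mod[OF assms(1) that]
        prime_gt_0_nat[OF assms(1)] by (simp add: card_vecs)
    then show ?thesis using prime_gt_1_nat[OF assms(1)] by (metis power_le_imp_le_exp)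
  qed
  then show ?thesis using assms(2) by (force simp: rank_lists_def)
qed

text \<open>Multiplying \<open>rank_prob\<close> by the number p^(n m) of all lists turns its
  recursion in m into that of the counts.\<close>

lemma card_rank_lists:
  assumes p: "prime p"
  shows "real (card (rank_lists p n m r)) = real p ^ (n * m) * rank_prob (real p) n m r"
proof (induction m arbitrary: r)
  case 0
  have "rank_lists p n 0 r = (if r = 0 then {[]} else {})" by (auto simp: rank_lists_def)
  moreover have "2 \<le> real p" using prime_ge_2_nat[OF p] by simp
  ultimately show ?case using qbr_pos[of "real p" n] by (simp add: rank_prob_def)
next
  case (Suc m)
  have p2: "2 \<le> real p" using prime_ge_2_nat[OF p] by simp
  show ?case
  proof (cases "r \<le> n")
    case False
    then show ?thesis using rank_lists_empty[OF p, of n r] by (simp add: rank_prob_def)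
  next
    case True
    show ?thesis
    proof (cases r)
      case 0
      then show ?thesis using p2
        by (simp add: card_rank_lists_Suc[OF p] Suc rank_prob_Suc_0[OF p2] power_add)
    next
      case (Suc r')
      have le: "p ^ r' \<le> p ^ n"
        using True Suc prime_gt_0_nat[OF p] by (intro power_increasing) auto
      have e1: "real p ^ n = real p ^ r * real p ^ (n - r)" "real p ^ n = real p ^ r' * real p ^ (n - r')"
        using True Suc by (metis le_add_diff_inverse power_add Suc_leD)+
      have "real (card (rank_lists p n (Suc m) r))
          = real (card (rank_lists p n m r)) * real p ^ r + real (card (rank_lists p n m r')) * (real p ^ n - real p ^ r')"
        using le by (simp add: card_rank_lists_Suc[OF p] Suc of_nat_diff)
      also have "\<dots> = real p ^ (n * m) * (rank_prob (real p) n m r * real p ^ r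
          + rank_prob (real p) n m r' * (real p ^ n - real p ^ r'))"
        by (simp add: Suc.IH distrib_left)
      also have "rank_prob (real p) n m r * real p ^ r + rank_prob (real p) n m r' * (real p ^ n - real p ^ r')
          = real p ^ n * rank_prob (real p) n (Suc m) r"
      proof -
        have "real p ^ n * (rank_prob (real p) n m r / real p ^ (n - r)) = rank_prob (real p) n m r * real p ^ r"
          using p2 by (subst e1(1)) simp
        moreover have "real p ^ n * (1 - 1 / real p ^ (n - r')) = real p ^ n - real p ^ r'"
          using p2 by (simp add: right_diff_distrib) (subst e1(2), simp)
        moreover have "rank_prob (real p) n (Suc m) r
            = rank_prob (real p) n m r / real p ^ (n - r) + rank_prob (real p) n m r' * (1 - 1 / real p ^ (n - r'))"
          using rank_prob_Suc_Suc[OF p2, of r' n m] True Suc by simp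
        ultimately show ?thesis by (simp add: distrib_left mult.left_commute)
      qed
      finally show ?thesis by (simp add: power_add mult.assoc mult.left_commute)
    qed
  qed
qed

section \<open>From lists of columns to random matrices\<close>

abbreviation square :: "nat \<Rightarrow> (nat \<times> nat) set" where
  "square n \<equiv> {..<n} \<times> {..<n}"

definition columns :: "nat \<Rightarrow> (nat \<times> nat \<Rightarrow> int) \<Rightarrow> (nat \<Rightarrow> int) list" where
  "columns n f = map (\<lambda>j i. if i < n then f (i, j) else 0) [0..<n]"

text \<open>This identifies the span built column by column with the set of all linear combinations.
  As the indices are distinct, the coefficient of the new column can be changed in \<open>v\<close>
  without disturbing the others.\<close>

lemma span_mod_map:
  assumes "p > 0" "distinct js"
  shows "span_mod p n (map c js) = range (\<lambda>v. red_vec p n (\<lambda>i. \<Sum>j\<in>set js. c j i * v j))"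
  using assms(2)
proof (induction js)
  case Nil
  then show ?case by (auto simp: red_vec_def fun_eq_iff)
next
  case (Cons j js)
  let ?S = "\<lambda>v i. \<Sum>k\<in>set js. c k i * v k"
  have sum: "(\<Sum>k\<in>set (j # js). c k i * v k) = c j i * v j + ?S v i" for v i
    using Cons.prems by simp
  have red: "red_vec p n (\<lambda>i. red_vec p n (?S v) i + a * c j i) = red_vec p n (\<lambda>i. a * c j i + ?S v i)" for v a
    by (rule red_vec_cong) (simp add: red_vec_def cong_def mod_add_left_eq add.commute mod_add_right_eq)
  have IH: "span_mod p n (map c js) = range (\<lambda>v. red_vec p n (?S v))" using Cons by simp
  show ?case
  proof (intro equalityI subsetI)
    fix w assume "w \<in> span_mod p n (map c (j # js))"
    then obtain v a where "w = red_vec p n (\<lambda>i. red_vec p n (?S v) i + a * c j i)"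
      unfolding list.map span_mod.simps IH by blast
    also have "\<dots> = red_vec p n (\<lambda>i. \<Sum>k\<in>set (j # js). c k i * (v(j := a)) k)"
    proof -
      have "?S (v(j := a)) i = ?S v i" for i
        by (rule sum.cong) (use Cons.prems in auto)
      then show ?thesis unfolding red sum by (simp add: mult.commute)
    qed
    finally show "w \<in> range (\<lambda>v. red_vec p n (\<lambda>i. \<Sum>k\<in>set (j # js). c k i * v k))"
      by (rule range_eqI[of _ _ "v(j := a)"])
  next
    fix w assume "w \<in> range (\<lambda>v. red_vec p n (\<lambda>i. \<Sum>k\<in>set (j # js). c k i * v k))"
    then obtain v where "w = red_vec p n (\<lambda>i. c j i * v j + ?S v i)" unfolding sum by blast
    then have "w = red_vec p n (\<lambda>i. red_vec p n (?S v) i + v j * c j i)"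
      unfolding red by (simp add: mult.commute)
    then show "w \<in> span_mod p n (map c (j # js))"
      unfolding list.map span_mod.simps IH by blast
  qed
qed

lemma im_mod_eq_span:
  assumes "p > 0"
  shows "im_mod p n (mat n n f) = span_mod p n (columns n f)"
proof -
  have "red_vec p n (\<lambda>i. \<Sum>j<n. mat n n f $$ (i, j) * v j)
      = red_vec p n (\<lambda>i. \<Sum>j\<in>set [0..<n]. (if i < n then f (i, j) else 0) * v j)" for v
    by (auto simp: red_vec_def atLeast0LessThan intro!: arg_cong[of _ _ "\<lambda>x. x mod int p"] sum.cong)
  then show ?thesis
    unfolding im_mod_def columns_def span_mod_map[OF assms distinct_upt] by simp
qed

definition entries :: "nat \<Rightarrow> (nat \<Rightarrow> int) list \<Rightarrow> nat \<times> nat \<Rightarrow> int" where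
  "entries n cs = (\<lambda>(i, j). if i < n \<and> j < n then (cs ! j) i else 0)"

lemma bij_betw_columns:
  assumes "p > 0"
  shows "bij_betw (columns n) (int_funs (square n) {0..<int p})
    {cs. length cs = n \<and> set cs \<subseteq> vecs p n}"
proof (rule bij_betw_byWitness[where f' = "entries n"])
  show "\<forall>f\<in>int_funs (square n) {0..<int p}.
      entries n (columns n f) = f"
    by (auto simp: entries_def columns_def PiE_dflt_def fun_eq_iff)
  show "\<forall>cs\<in>{cs. length cs = n \<and> set cs \<subseteq> vecs p n}.
      columns n (entries n cs) = cs"
  proof clarify
    fix cs :: "(nat \<Rightarrow> int) list" assume cs: "set cs \<subseteq> vecs p (length cs)" 
    show "columns (length cs) (entries (length cs) cs) = cs"
    proof (rule nth_equalityI)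
      fix j assume "j < length (columns (length cs) (entries (length cs) cs))"
      then have j: "j < length cs" by (simp add: columns_def)
      then have "cs ! j \<in> vecs p (length cs)" using cs by auto
      then show "columns (length cs) (entries (length cs) cs) ! j = cs ! j"
        using j by (auto simp: entries_def columns_def vecs_def PiE_dflt_def fun_eq_iff)
    qed (simp add: columns_def)
  qed
  show "columns n ` int_funs (square n) {0..<int p} \<subseteq> {cs. length cs = n \<and> set cs \<subseteq> vecs p n}"
    by (auto simp: columns_def vecs_def PiE_dflt_def)
  show "entries n ` {cs. length cs = n \<and> set cs \<subseteq> vecs p n}
      \<subseteq> int_funs (square n) {0..<int p}"
  proof clarify
    fix cs :: "(nat \<Rightarrow> int) list" assume cs: "set cs \<subseteq> vecs p (length cs)"
    have "(cs ! j) i \<in> {0..<int p}" if "i < length cs" "j < length cs" for i j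
    proof -
      have "cs ! j \<in> vecs p (length cs)" using cs that by auto
      then show ?thesis using that by (simp add: vecs_def PiE_dflt_def)
    qed
    then show "(entries (length cs) cs)
        \<in> PiE_dflt ({..<length cs} \<times> {..<length cs}) 0 (\<lambda>_. {0..<int p})"
      by (auto simp: entries_def PiE_dflt_def)
  qed
qed

lemma prob_random_mat:
  assumes "finite A" "A \<noteq> {}"
  shows "measure_pmf.prob (random_mat n A) S
    = real (card {f \<in> int_funs (square n) A. mat n n f \<in> S}) / real (card A) ^ (n * n)"
proof -
  have "measure_pmf.prob (random_mat n A) S
      = measure_pmf.prob (pmf_of_set (int_funs (square n) A)) (mat n n -` S)"
    unfolding random_mat_def measure_map_pmf using assms by (subst Pi_pmf_of_set) auto
  also have "\<dots> = real (card (int_funs (square n) A \<inter> mat n n -` S))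
      / real (card (int_funs (square n) A))"
    by (rule measure_pmf_of_set) (use assms in auto)
  also have "card (int_funs (square n) A) = card A ^ (n * n)"
    by (subst card_PiE_dflt) (use assms in \<open>auto simp: card_cartesian_product\<close>)
  finally show ?thesis by (simp add: Int_def)
qed

lemma prob_rank_ge:
  assumes p: "prime p" and l: "l \<le> n"
  shows "measure_pmf.prob (random_mat n {0..<int p}) {M. p ^ (n - l) \<le> card (im_mod p n M)} = Zn n (real p) l"
proof -
  have p0: "p > 0" using prime_gt_0_nat[OF p] .
  have p2: "2 \<le> real p" using prime_ge_2_nat[OF p] by simp
  define X where "X = int_funs (square n) {0..<int p}"
  define L where "L = {cs. length cs = n \<and> set cs \<subseteq> vecs p n}"
  have bij: "bij_betw (columns n) X L" unfolding X_def L_def by (rule bij_betw_columns[OF p0])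
  have big: "p ^ (n - l) \<le> card (im_mod p n (mat n n f)) \<longleftrightarrow> n - l \<le> rank_mod p n (columns n f)" if "f \<in> X" for f
  proof -
    have "set (columns n f) \<subseteq> vecs p n" using bij_betwE[OF bij] that by (auto simp: L_def)
    then show ?thesis
      unfolding im_mod_eq_span[OF p0] card_span_mod[OF p \<open>set (columns n f) \<subseteq> vecs p n\<close>]
      using prime_gt_1_nat[OF p] by simp
  qed
  have rank_le: "rank_mod p n cs \<le> n" if "cs \<in> L" for cs
  proof (rule ccontr)
    assume "\<not> rank_mod p n cs \<le> n"
    then have "rank_lists p n n (rank_mod p n cs) = {}" by (intro rank_lists_empty[OF p]) simp
    then show False using that by (auto simp: L_def rank_lists_def)
  qed
  have "{f \<in> X. mat n n f \<in> {M. p ^ (n - l) \<le> card (im_mod p n M)}} = {f \<in> X. n - l \<le> rank_mod p n (columns n f)}"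
    using big by auto
  moreover have "card \<dots> = card (columns n ` {f \<in> X. n - l \<le> rank_mod p n (columns n f)})"
    by (rule card_image[symmetric]) (use bij in \<open>auto simp: bij_betw_def intro: inj_on_subset\<close>)
  moreover have "columns n ` {f \<in> X. n - l \<le> rank_mod p n (columns n f)} = {cs \<in> L. n - l \<le> rank_mod p n cs}"
    using bij unfolding bij_betw_def by blast
  moreover have "\<dots> = (\<Union>i\<in>{..l}. rank_lists p n n (n - i))"
  proof (intro equalityI subsetI)
    fix cs assume cs: "cs \<in> {cs \<in> L. n - l \<le> rank_mod p n cs}"
    then have "rank_mod p n cs \<le> n" using rank_le by simp
    then have "cs \<in> rank_lists p n n (n - (n - rank_mod p n cs))" "n - rank_mod p n cs \<le> l"
      using cs by (auto simp: L_def rank_lists_def)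
    then show "cs \<in> (\<Union>i\<in>{..l}. rank_lists p n n (n - i))" by blast
  qed (auto simp: L_def rank_lists_def)
  moreover have "card (\<Union>i\<in>{..l}. rank_lists p n n (n - i)) = (\<Sum>i\<le>l. card (rank_lists p n n (n - i)))"
  proof (rule card_UN_disjoint)
    \<comment> \<open>Since l \<le> n, the subtraction n - i is not truncated, and different coranks
      give different ranks.\<close>
    show "\<forall>i\<in>{..l}. \<forall>j\<in>{..l}. i \<noteq> j \<longrightarrow> rank_lists p n n (n - i) \<inter> rank_lists p n n (n - j) = {}"
      using l by (auto simp: rank_lists_def)
  qed auto
  ultimately have "real (card {f \<in> X. mat n n f \<in> {M. p ^ (n - l) \<le> card (im_mod p n M)}})
      = (\<Sum>i\<le>l. real (card (rank_lists p n n (n - i))))" by simp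
  also have "\<dots> = real p ^ (n * n) * Zn n (real p) l"
    by (simp add: card_rank_lists[OF p] Zn_eq_sum_rank_prob[OF p2 l] sum_distrib_left)
  finally have "real (card {f \<in> X. mat n n f \<in> {M. p ^ (n - l) \<le> card (im_mod p n M)}})
      = real p ^ (n * n) * Zn n (real p) l" .
  then show ?thesis using p0 by (subst prob_random_mat) (auto simp flip: X_def)
qed

lemma random_mat_carrier: "M \<in> set_pmf (random_mat n A) \<Longrightarrow> M \<in> carrier_mat n n"
  by (auto simp: random_mat_def)

lemma mu_mod_snf_T:
  assumes "prime p" "l \<le> n"
  shows "mu_mod p n (snf_T n l) = Zn n (real p) l"
proof -
  have "mu_mod p n (snf_T n l) = measure_pmf.prob (random_mat n {0..<int p}) {M. p ^ (n - l) \<le> card (im_mod p n M)}"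
    unfolding mu_mod_def
    by (rule measure_pmf.finite_measure_eq_AE)
       (auto simp: AE_measure_pmf_iff snf_mod_in_snf_T_iff[OF random_mat_carrier assms(2,1)])
  then show ?thesis using prob_rank_ge[OF assms] by simp
qed

section \<open>Equidistribution in boxes\<close>

lemma card_residue_block:
  assumes "0 < N" "0 \<le> c" "c < int N"
  shows "card {x \<in> {a..<a + int (t * N)}. x mod int N = c} = t"
proof (induction t)
  case (Suc t)
  define b where "b = a + int (t * N)"
  have fin: "finite {x \<in> {l..<u}. x mod int N = c}" for l u
    by (rule finite_subset[of _ "{l..<u}"]) auto
  have "{x \<in> {b..<b + int N}. x mod int N = c} = {b + (c - b) mod int N}"
  proof (intro equalityI subsetI)
    fix x assume x: "x \<in> {x \<in> {b..<b + int N}. x mod int N = c}"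
    then have "(x - b) mod int N = x - b" by (intro mod_pos_pos_trivial) auto
    moreover have "(x - b) mod int N = (c - b) mod int N"
      using x assms by (intro mod_diff_cong) auto
    ultimately have "x = b + (c - b) mod int N" by linarith
    then show "x \<in> {b + (c - b) mod int N}" by blast
  next
    fix x assume x: "x \<in> {b + (c - b) mod int N}"
    have "(b + (c - b) mod int N) mod int N = c" using assms by (simp add: mod_add_right_eq)
    moreover have "0 \<le> (c - b) mod int N" "(c - b) mod int N < int N" using assms by auto
    ultimately show "x \<in> {x \<in> {b..<b + int N}. x mod int N = c}" using x by simp
  qed
  then have block: "card {x \<in> {b..<b + int N}. x mod int N = c} = 1" by simp
  have ab: "a \<le> b" and end_eq: "a + int (Suc t * N) = b + int N" by (simp_all add: b_def)
  have "{x \<in> {a..<a + int (Suc t * N)}. x mod int N = c}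
      = {x \<in> {a..<b}. x mod int N = c} \<union> {x \<in> {b..<b + int N}. x mod int N = c}"
    unfolding end_eq using ab by auto
  moreover have "card ({x \<in> {a..<b}. x mod int N = c} \<union> {x \<in> {b..<b + int N}. x mod int N = c})
      = card {x \<in> {a..<b}. x mod int N = c} + card {x \<in> {b..<b + int N}. x mod int N = c}"
    by (rule card_Un_disjoint[OF fin fin]) auto
  moreover have "card {x \<in> {a..<b}. x mod int N = c} = t" unfolding b_def by (rule Suc.IH)
  ultimately show ?case unfolding block by (simp only: Suc_eq_plus1)
next
  case 0
  have "{x \<in> {a..<a + int (0 * N)}. x mod int N = c} = {}" by auto
  then show ?case by (simp only: card.empty)
qed

text \<open>With t the integer quotient of 2k + 1 by N, the box contains t full periods and is
  contained in t + 1 of them.\<close>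

lemma
  assumes "0 < N" "0 \<le> c" "c < int N"
  shows card_residue_le: "card {x \<in> {- int k..int k}. x mod int N = c} \<le> (2 * k + 1) div N + 1"
    and card_residue_ge: "(2 * k + 1) div N \<le> card {x \<in> {- int k..int k}. x mod int N = c}"
proof -
  define t where "t = (2 * k + 1) div N"
  have "t * N \<le> 2 * k + 1" "2 * k + 1 < N + t * N"
    unfolding t_def by (rule div_times_less_eq_dividend, rule dividend_less_div_times[OF assms(1)])
  then have "int (t * N) \<le> int (2 * k + 1)" "int (2 * k + 1) < int (N + t * N)"
    unfolding of_nat_le_iff of_nat_less_iff by blast+
  moreover have "int (2 * k + 1) = int k + int k + 1" "int (N + t * N) = int (Suc t * N)" by simp_all
  ultimately have t: "int (t * N) \<le> int k + int k + 1" "int k + int k + 1 < int (Suc t * N)"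
    by presburger+
  have sub1: "{- int k..int k} \<subseteq> {- int k..<- int k + int (Suc t * N)}" using t(2) by fastforce
  have sub2: "{- int k..<- int k + int (t * N)} \<subseteq> {- int k..int k}" using t(1) by fastforce
  have fin: "finite {x \<in> {l..<u}. x mod int N = c}" for l u
    by (rule finite_subset[of _ "{l..<u}"]) auto
  have fin': "finite {x \<in> {l..u}. x mod int N = c}" for l u
    by (rule finite_subset[of _ "{l..u}"]) auto
  have "card {x \<in> {- int k..int k}. x mod int N = c}
      \<le> card {x \<in> {- int k..<- int k + int (Suc t * N)}. x mod int N = c}"
    using sub1 by (intro card_mono[OF fin]) blast
  also have "\<dots> = Suc t" by (rule card_residue_block[OF assms])
  finally show "card {x \<in> {- int k..int k}. x mod int N = c} \<le> (2 * k + 1) div N + 1"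
    by (simp add: t_def)
  have "t = card {x \<in> {- int k..<- int k + int (t * N)}. x mod int N = c}"
    by (rule card_residue_block[OF assms, symmetric])
  also have "\<dots> \<le> card {x \<in> {- int k..int k}. x mod int N = c}"
    using sub2 by (intro card_mono[OF fin']) blast
  finally show "(2 * k + 1) div N \<le> card {x \<in> {- int k..int k}. x mod int N = c}"
    by (simp add: t_def)
qed

lemma residue_density:
  assumes "0 < N" "0 \<le> c" "c < int N"
  shows "(\<lambda>k. real (card {x \<in> {- int k..int k}. x mod int N = c}) / real (2 * k + 1)) \<longlonglongrightarrow> 1 / real N"
proof -
  have lim: "(\<lambda>k. 1 / real (2 * k + 1)) \<longlonglongrightarrow> 0"
    by real_asymp
  have bound: "\<bar>real (card {x \<in> {- int k..int k}. x mod int N = c}) / real (2 * k + 1) - 1 / real N\<bar> \<le> 1 / real (2 * k + 1)" for k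
  proof -
    let ?L = "2 * k + 1"
    let ?r = "real (card {x \<in> {- int k..int k}. x mod int N = c})"
    have "real (?L div N) * real N \<le> real ?L"
      by (metis div_times_less_eq_dividend of_nat_le_iff of_nat_mult)
    then have "real (?L div N) \<le> real ?L / real N" "real ?L / real N \<le> real (?L div N) + 1"
      using of_nat_mono[OF less_imp_le[OF dividend_less_div_times[OF assms(1), of ?L]], where 'a = real] assms(1)
      by (simp_all add: pos_le_divide_eq pos_divide_le_eq distrib_right)
    moreover have "real (?L div N) \<le> ?r" "?r \<le> real (?L div N) + 1"
      using card_residue_le[OF assms, of k] card_residue_ge[OF assms, of k] by linarith+
    ultimately have "\<bar>?r - real ?L / real N\<bar> \<le> 1" by linarith
    then have "\<bar>?r - real ?L / real N\<bar> / real ?L \<le> 1 / real ?L" by (rule divide_right_mono) simp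
    moreover have "?r / real ?L - 1 / real N = (?r - real ?L / real N) / real ?L"
      by (simp add: diff_divide_distrib)
    ultimately show ?thesis by (simp add: abs_divide)
  qed
  have "(\<lambda>k. real (card {x \<in> {- int k..int k}. x mod int N = c}) / real (2 * k + 1) - 1 / real N) \<longlonglongrightarrow> 0"
    by (rule Lim_null_comparison[OF _ lim]) (use bound in \<open>auto simp del: of_nat_add of_nat_mult\<close>)
  then show ?thesis by (rule LIM_zero_cancel)
qed

section \<open>Densities of periodic events and the Chinese remainder theorem\<close>

definition int_density :: "'a set \<Rightarrow> int set \<Rightarrow> (('a \<Rightarrow> int) \<Rightarrow> bool) \<Rightarrow> real" where
  "int_density I A E = real (card {f \<in> int_funs I A. E f}) / real (card A) ^ card I"

definition periodic :: "nat \<Rightarrow> (('a \<Rightarrow> int) \<Rightarrow> bool) \<Rightarrow> bool" where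
  "periodic N E \<longleftrightarrow> (\<forall>f. E f \<longleftrightarrow> E (\<lambda>x. f x mod int N))"

text \<open>Sorting the functions by their residues modulo N splits the event into finitely many
  disjoint product sets, and each of their factors has density tending to 1/N.\<close>

lemma density_box_tendsto:
  assumes I: "finite I" and N: "0 < N" and E: "periodic N E"
  shows "(\<lambda>k. int_density I {- int k..int k} E) \<longlonglongrightarrow> int_density I {0..<int N} E"
proof -
  define R where "R = {g \<in> int_funs I {0..<int N}. E g}"
  define c where "c k a = {x \<in> {- int k..int k}. x mod int N = a}" for k a
  have finR: "finite R"
    by (rule finite_subset[of _ "int_funs I {0..<int N}"]) (use I in \<open>auto simp: R_def\<close>)
  have finc: "finite (c k a)" for k a
    by (rule finite_subset[of _ "{- int k..int k}"]) (auto simp: c_def)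
  have "{f \<in> int_funs I {- int k..int k}. E f} = (\<Union>g\<in>R. PiE_dflt I 0 (\<lambda>x. c k (g x)))" for k
  proof (intro equalityI subsetI)
    fix f assume f: "f \<in> {f \<in> int_funs I {- int k..int k}. E f}"
    then have "(\<lambda>x. f x mod int N) \<in> R" using N E by (auto simp: R_def PiE_dflt_def periodic_def)
    moreover have "f \<in> PiE_dflt I 0 (\<lambda>x. c k (f x mod int N))"
      using f by (auto simp: PiE_dflt_def c_def)
    ultimately show "f \<in> (\<Union>g\<in>R. PiE_dflt I 0 (\<lambda>x. c k (g x)))" by blast
  next
    fix f assume "f \<in> (\<Union>g\<in>R. PiE_dflt I 0 (\<lambda>x. c k (g x)))"
    then obtain g where g: "g \<in> R" "f \<in> PiE_dflt I 0 (\<lambda>x. c k (g x))" by blast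
    have "f x mod int N = g x" for x
      using g by (cases "x \<in> I") (auto simp: R_def PiE_dflt_def c_def)
    then have "E f" using g(1) E unfolding periodic_def R_def by (metis (no_types, lifting) mem_Collect_eq ext)
    then show "f \<in> {f \<in> int_funs I {- int k..int k}. E f}"
      using g(2) by (auto simp: PiE_dflt_def c_def)
  qed
  moreover have "card (\<Union>g\<in>R. PiE_dflt I 0 (\<lambda>x. c k (g x))) = (\<Sum>g\<in>R. card (PiE_dflt I 0 (\<lambda>x. c k (g x))))" for k
  proof (rule card_UN_disjoint[OF finR])
    show "\<forall>g\<in>R. finite (PiE_dflt I 0 (\<lambda>x. c k (g x)))" by (intro ballI finite_PiE_dflt I finc)
    show "\<forall>g\<in>R. \<forall>h\<in>R. g \<noteq> h \<longrightarrow> PiE_dflt I 0 (\<lambda>x. c k (g x)) \<inter> PiE_dflt I 0 (\<lambda>x. c k (h x)) = {}"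
    proof (intro ballI impI)
      fix g h assume gh: "g \<in> R" "h \<in> R" "g \<noteq> h"
      then obtain x where x: "g x \<noteq> h x" by auto
      then have "x \<in> I" using gh by (auto simp: R_def PiE_dflt_def)
      then show "PiE_dflt I 0 (\<lambda>x. c k (g x)) \<inter> PiE_dflt I 0 (\<lambda>x. c k (h x)) = {}"
        using x by (auto simp: PiE_dflt_def c_def)
    qed
  qed
  moreover have "card (PiE_dflt I 0 (\<lambda>x. c k (g x))) = (\<Prod>x\<in>I. card (c k (g x)))" for k g
    by (rule card_PiE_dflt[OF I finc])
  ultimately have "int_density I {- int k..int k} E = (\<Sum>g\<in>R. (\<Prod>x\<in>I. real (card (c k (g x))) / real (2 * k + 1)))" for k
    by (simp add: int_density_def sum_divide_distrib prod_dividef nat_add_distrib algebra_simps)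
  moreover have "(\<lambda>k. \<Sum>g\<in>R. (\<Prod>x\<in>I. real (card (c k (g x))) / real (2 * k + 1))) \<longlonglongrightarrow> (\<Sum>g\<in>R. (\<Prod>x\<in>I. 1 / real N))"
    unfolding c_def
    by (intro tendsto_sum tendsto_prod residue_density N) (auto simp: R_def PiE_dflt_def)
  moreover have "(\<Sum>g\<in>R. (\<Prod>x\<in>I. 1 / real N)) = int_density I {0..<int N} E"
    by (simp add: int_density_def R_def power_divide)
  ultimately show ?thesis by simp
qed

text \<open>Chinese remainder theorem: the map \<open>\<Phi>\<close> to pairs of residue functions
  is injective by coprimality, and surjective because both sides have the same number of
  elements.\<close>

lemma density_mult:
  assumes I: "finite I" and N: "0 < M" "0 < N" "coprime M N" and E: "periodic M E" and F: "periodic N F"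
  shows "int_density I {0..<int (M * N)} (\<lambda>f. E f \<and> F f) = int_density I {0..<int M} E * int_density I {0..<int N} F"
proof -
  define X where "X K = int_funs I {0..<int K}" for K
  define \<Phi> where "\<Phi> f = (\<lambda>x. f x mod int M, \<lambda>x. f x mod int N)" for f :: "'a \<Rightarrow> int"
  have finX: "finite (X K)" for K unfolding X_def using I by auto
  have cardX: "card (X K) = K ^ card I" for K unfolding X_def by (simp add: card_PiE_dflt[OF I])
  have inj: "inj_on \<Phi> (X (M * N))"
  proof (rule inj_onI)
    fix f g assume fg: "f \<in> X (M * N)" "g \<in> X (M * N)" "\<Phi> f = \<Phi> g"
    show "f = g"
    proof
      fix x
      have "f x mod int M = g x mod int M" "f x mod int N = g x mod int N"
        using fg(3) by (auto simp: \<Phi>_def fun_eq_iff)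
      then have "[f x = g x] (mod (int M * int N))"
        using N(3) by (intro coprime_cong_mult) (auto simp: cong_def)
      then show "f x = g x"
        using fg(1,2) by (cases "x \<in> I") (auto simp: X_def PiE_dflt_def cong_def mod_pos_pos_trivial)
    qed
  qed
  have "\<Phi> ` X (M * N) \<subseteq> X M \<times> X N" using N by (auto simp: \<Phi>_def X_def PiE_dflt_def)
  moreover have "card (\<Phi> ` X (M * N)) = card (X M \<times> X N)"
    by (simp add: card_image[OF inj] cardX card_cartesian_product power_mult_distrib)
  ultimately have img: "\<Phi> ` X (M * N) = X M \<times> X N"
    by (intro card_subset_eq) (auto simp: finX)
  have ev: "E f \<longleftrightarrow> E (fst (\<Phi> f))" "F f \<longleftrightarrow> F (snd (\<Phi> f))" for f
    using E F by (auto simp: periodic_def \<Phi>_def)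
  have "\<Phi> ` {f \<in> X (M * N). E f \<and> F f} = {f \<in> X M. E f} \<times> {f \<in> X N. F f}"
  proof (intro equalityI subsetI)
    fix w assume "w \<in> \<Phi> ` {f \<in> X (M * N). E f \<and> F f}"
    then obtain f where f: "f \<in> X (M * N)" "E f" "F f" "w = \<Phi> f" by blast
    then have "\<Phi> f \<in> X M \<times> X N" using img by blast
    then show "w \<in> {f \<in> X M. E f} \<times> {f \<in> X N. F f}" using f ev by (auto simp: mem_Times_iff)
  next
    fix w assume w: "w \<in> {f \<in> X M. E f} \<times> {f \<in> X N. F f}"
    then have "w \<in> \<Phi> ` X (M * N)" unfolding img by auto
    then obtain f where "f \<in> X (M * N)" "w = \<Phi> f" by blast
    then show "w \<in> \<Phi> ` {f \<in> X (M * N). E f \<and> F f}" using w ev by (auto simp: mem_Times_iff)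
  qed
  then have "card {f \<in> X (M * N). E f \<and> F f} = card ({f \<in> X M. E f} \<times> {f \<in> X N. F f})"
    using card_image[OF inj_on_subset[OF inj], of "{f \<in> X (M * N). E f \<and> F f}"] by auto
  then show ?thesis
    by (simp add: int_density_def X_def card_cartesian_product power_mult_distrib)
qed

lemma periodic_dvd:
  assumes "periodic M E" "M dvd N"
  shows "periodic N E"
  unfolding periodic_def
proof
  fix f :: "'a \<Rightarrow> int"
  have "(\<lambda>x. f x mod int N mod int M) = (\<lambda>x. f x mod int M)"
    using assms(2) by (simp add: mod_mod_cancel)
  moreover have "E f \<longleftrightarrow> E (\<lambda>x. f x mod int M)" using assms(1) by (simp only: periodic_def)
  moreover have "E (\<lambda>x. f x mod int N) \<longleftrightarrow> E (\<lambda>x. f x mod int N mod int M)"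
    using assms(1) unfolding periodic_def by (rule allE)
  ultimately show "E f \<longleftrightarrow> E (\<lambda>x. f x mod int N)" by (simp only:)
qed

lemma periodic_Ball: "(\<And>p. p \<in> P \<Longrightarrow> periodic N (E p)) \<Longrightarrow> periodic N (\<lambda>f. \<forall>p\<in>P. E p f)"
  unfolding periodic_def by blast

lemma density_primes:
  assumes I: "finite I" and P: "finite P" "\<And>p. p \<in> P \<Longrightarrow> prime p" and E: "\<And>p. p \<in> P \<Longrightarrow> periodic p (E p)"
  shows "int_density I {0..<int (\<Prod>P)} (\<lambda>f. \<forall>p\<in>P. E p f) = (\<Prod>p\<in>P. int_density I {0..<int p} (E p))"
  using P E
proof (induction P rule: finite_induct)
  case empty
  \<comment> \<open>The empty product is the modulus 1, which leaves only the zero function; the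
    empty condition then has density 1.\<close>
  have "{0..<1::int} = {0}" by auto
  then have "PiE_dflt I 0 (\<lambda>_. {0..<1::int}) = {\<lambda>_. 0}" by (auto simp: PiE_dflt_def fun_eq_iff)
  then show ?case by (simp add: int_density_def)
next
  case (insert p P)
  have "coprime p (\<Prod>P)"
    using insert by (intro prod_coprime_right) (metis insertCI primes_coprime)
  moreover have "0 < \<Prod>P" using insert prime_gt_0_nat by (intro prod_pos) auto
  moreover have "periodic (\<Prod>P) (\<lambda>f. \<forall>q\<in>P. E q f)"
    using insert by (intro periodic_Ball periodic_dvd[of _ _ "\<Prod>P"]) (auto intro: dvd_prodI)
  ultimately have "int_density I {0..<int (p * \<Prod>P)} (\<lambda>f. E p f \<and> (\<forall>q\<in>P. E q f))
      = int_density I {0..<int p} (E p) * int_density I {0..<int (\<Prod>P)} (\<lambda>f. \<forall>q\<in>P. E q f)"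
    using insert prime_gt_0_nat by (intro density_mult I) auto
  then show ?case using insert by simp
qed

lemma density_box_primes_tendsto:
  assumes I: "finite I" and P: "finite P" "\<And>p. p \<in> P \<Longrightarrow> prime p" and E: "\<And>p. p \<in> P \<Longrightarrow> periodic p (E p)"
  shows "(\<lambda>k. int_density I {- int k..int k} (\<lambda>f. \<forall>p\<in>P. E p f)) \<longlonglongrightarrow> (\<Prod>p\<in>P. int_density I {0..<int p} (E p))"
proof -
  have "0 < \<Prod>P" using P prime_gt_0_nat by (intro prod_pos) auto
  moreover have "periodic (\<Prod>P) (\<lambda>f. \<forall>p\<in>P. E p f)"
    using P E by (intro periodic_Ball periodic_dvd[of _ _ "\<Prod>P"]) (auto intro: dvd_prodI)
  ultimately have "(\<lambda>k. int_density I {- int k..int k} (\<lambda>f. \<forall>p\<in>P. E p f))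
      \<longlonglongrightarrow> int_density I {0..<int (\<Prod>P)} (\<lambda>f. \<forall>p\<in>P. E p f)"
    by (intro density_box_tendsto I)
  also have "int_density I {0..<int (\<Prod>P)} (\<lambda>f. \<forall>p\<in>P. E p f) = (\<Prod>p\<in>P. int_density I {0..<int p} (E p))"
    by (rule density_primes) (use assms in auto)
  finally show ?thesis .
qed

section \<open>Large primes\<close>

text \<open>What matters is that Leibniz' formula bounds the determinant by a polynomial in the size
  of the entries. This limits how many primes above the box size can divide a nonzero minor.\<close>

lemma det_bound:
  fixes A :: "int mat"
  assumes A: "A \<in> carrier_mat m m" and b: "\<And>i j. i < m \<Longrightarrow> j < m \<Longrightarrow> \<bar>A $$ (i, j)\<bar> \<le> c"
  shows "\<bar>Determinant.det A\<bar> \<le> fact m * c ^ m"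
proof -
  have "\<bar>Determinant.det A\<bar> = \<bar>\<Sum>p | p permutes {0..<m}. signof p * (\<Prod>i = 0..<m. A $$ (i, p i))\<bar>"
    using A by (simp add: Determinant.det_def)
  also have "\<dots> \<le> (\<Sum>p | p permutes {0..<m}. \<bar>signof p * (\<Prod>i = 0..<m. A $$ (i, p i))\<bar>)"
    by (rule sum_abs)
  also have "\<dots> \<le> (\<Sum>p | p permutes {0..<m}. c ^ m)"
  proof (rule sum_mono)
    fix p assume "p \<in> {p. p permutes {0..<m}}"
    then have p: "p permutes {0..<m}" by simp
    have "\<bar>signof p * (\<Prod>i = 0..<m. A $$ (i, p i))\<bar> = (\<Prod>i = 0..<m. \<bar>A $$ (i, p i)\<bar>)"
      by (simp add: abs_mult sign_def abs_prod)
    also have "\<dots> \<le> (\<Prod>i = 0..<m. c)"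
    proof (rule prod_mono)
      fix i assume "i \<in> {0..<m}"
      moreover have "p i < m" using permutes_in_image[OF p, of i] \<open>i \<in> {0..<m}\<close> by simp
      ultimately show "0 \<le> \<bar>A $$ (i, p i)\<bar> \<and> \<bar>A $$ (i, p i)\<bar> \<le> c" using b by simp
    qed
    finally show "\<bar>signof p * (\<Prod>i = 0..<m. A $$ (i, p i))\<bar> \<le> c ^ m" by simp
  qed
  also have "\<dots> = fact m * c ^ m"
    by (simp add: card_permutations[of "{0..<m}" m])
  finally show ?thesis .
qed

text \<open>Two maximal minors of the upper left \<open>(m + 1) \<times> m\<close> block: omit the last row, or the last but one.\<close>

definition minor1 :: "nat \<Rightarrow> (nat \<times> nat \<Rightarrow> int) \<Rightarrow> int" where
  "minor1 m f = Determinant.det (mat m m f)"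

definition minor2 :: "nat \<Rightarrow> (nat \<times> nat \<Rightarrow> int) \<Rightarrow> int" where
  "minor2 m f = Determinant.det (mat m m (\<lambda>(i, j). f (if Suc i = m then m else i, j)))"

text \<open>The coefficients of the Laplace expansion along row m. That row is deleted in them, so
  they stay the same when row m + 1 takes its place, and both minors become values of one linear
  form.\<close>

definition last_cofactor :: "nat \<Rightarrow> (nat \<times> nat \<Rightarrow> int) \<Rightarrow> nat \<Rightarrow> int" where
  "last_cofactor m f j = cofactor (mat (Suc m) (Suc m) f) m j"

lemma last_cofactor_cong:
  assumes "\<And>i j. i < m \<Longrightarrow> j \<le> m \<Longrightarrow> f (i, j) = g (i, j)"
  shows "last_cofactor m f j = last_cofactor m g j"
proof -
  have "mat_delete (mat (Suc m) (Suc m) f) m j = mat_delete (mat (Suc m) (Suc m) g) m j"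
    unfolding mat_delete_def using assms by (intro eq_matI) auto
  then show ?thesis by (simp add: last_cofactor_def cofactor_def)
qed

lemma minor1_Suc: "minor1 (Suc m) f = (\<Sum>j\<le>m. f (m, j) * last_cofactor m f j)"
  unfolding minor1_def last_cofactor_def
  by (subst laplace_expansion_row[of _ "Suc m" m]) (auto simp: lessThan_Suc_atMost)

lemma minor2_Suc: "minor2 (Suc m) f = (\<Sum>j\<le>m. f (Suc m, j) * last_cofactor m f j)"
proof -
  define g where "g = (\<lambda>(i, j). f (if Suc i = Suc m then Suc m else i, j))"
  have "minor2 (Suc m) f = minor1 (Suc m) g" by (simp add: minor1_def minor2_def g_def)
  also have "\<dots> = (\<Sum>j\<le>m. g (m, j) * last_cofactor m g j)" by (rule minor1_Suc)
  also have "\<dots> = (\<Sum>j\<le>m. f (Suc m, j) * last_cofactor m f j)"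
    by (intro sum.cong refl arg_cong2[of _ _ _ _ "(*)"] last_cofactor_cong) (auto simp: g_def)
  finally show ?thesis .
qed

lemma minor1_swap: "minor1 m (f \<circ> prod.swap) = minor1 m f"
proof -
  have "mat m m (f \<circ> prod.swap) = (mat m m f)\<^sup>T" by (intro eq_matI) auto
  then show ?thesis unfolding minor1_def by (simp add: Determinant.det_transpose[of _ m])
qed

lemma last_cofactor_last: "\<bar>last_cofactor m f m\<bar> = \<bar>minor1 m f\<bar>"
proof -
  have "mat_delete (mat (Suc m) (Suc m) f) m m = mat m m f"
    unfolding mat_delete_def by (intro eq_matI) auto
  then show ?thesis by (simp add: last_cofactor_def cofactor_def minor1_def abs_mult power_add)
qed

text \<open>Together with \<open>last_cofactor_last\<close> this shows that the last two
  coefficients are, up to sign, the two minors of the next smaller block after transposition. If all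
  coefficients vanish modulo p, the smaller problem therefore recurs with
  \<open>prod.swap\<close>.\<close>

lemma last_cofactor_penultimate: "\<bar>last_cofactor (Suc m) f m\<bar> = \<bar>minor2 (Suc m) (f \<circ> prod.swap)\<bar>"
proof -
  have "mat_delete (mat (Suc (Suc m)) (Suc (Suc m)) f) (Suc m) m
      = (mat (Suc m) (Suc m) (\<lambda>(i, j). (f \<circ> prod.swap) (if Suc i = Suc m then Suc m else i, j)))\<^sup>T"
    unfolding mat_delete_def by (intro eq_matI) (auto simp: less_Suc_eq)
  then show ?thesis
    by (simp add: last_cofactor_def cofactor_def minor2_def abs_mult power_add Determinant.det_transpose[of _ "Suc m"])
qed

section \<open>Common prime divisors of the two minors, and the rank they control\<close>

definition minors_vanish :: "nat \<Rightarrow> nat \<Rightarrow> (nat \<times> nat \<Rightarrow> int) \<Rightarrow> bool" where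
  "minors_vanish m p f \<longleftrightarrow> int p dvd minor1 m f \<and> int p dvd minor2 m f"

definition minors_vanish_above :: "nat \<Rightarrow> nat \<Rightarrow> (nat \<times> nat \<Rightarrow> int) \<Rightarrow> bool" where
  "minors_vanish_above B m f \<longleftrightarrow> (\<exists>p. prime p \<and> B < p \<and> minors_vanish m p f)"

lemma minors_vanish_0: "prime p \<Longrightarrow> \<not> minors_vanish 0 p f"
  using prime_gt_1_nat[of p] by (auto simp: minors_vanish_def minor1_def det_dim_zero)

lemma minors_vanish_Suc:
  assumes "prime p" "minors_vanish (Suc m) p f" "\<not> minors_vanish m p (f \<circ> prod.swap)"
  shows "\<exists>j\<le>m. \<not> int p dvd last_cofactor m f j"
proof (cases m)
  \<comment> \<open>There is no column before the last one here; the only coefficient is the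
    determinant of the empty matrix, 1 up to sign.\<close>
  case 0
  have "\<not> int p dvd minor1 0 f"
    using minors_vanish_0[OF assms(1), of f] prime_gt_1_nat[OF assms(1)]
    by (auto simp: minors_vanish_def minor1_def det_dim_zero)
  then have "\<not> int p dvd last_cofactor m f m"
    unfolding 0 using last_cofactor_last[of 0 f] dvd_abs_iff[of "int p"] by metis
  then show ?thesis by blast
next
  case (Suc k)
  then have "\<not> int p dvd minor1 m f \<or> \<not> int p dvd minor2 m (f \<circ> prod.swap)"
    using assms(3) by (simp add: minors_vanish_def minor1_swap)
  then show ?thesis
  proof
    assume "\<not> int p dvd minor1 m f"
    then have "\<not> int p dvd last_cofactor m f m"
      using last_cofactor_last[of m f] dvd_abs_iff[of "int p"] by metis
    then show ?thesis by blast
  next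
    assume "\<not> int p dvd minor2 m (f \<circ> prod.swap)"
    then have "\<not> int p dvd last_cofactor m f k"
      unfolding Suc using last_cofactor_penultimate[of k f] dvd_abs_iff[of "int p"] by metis
    moreover have "k \<le> m" using Suc by simp
    ultimately show ?thesis by blast
  qed
qed

text \<open>The p^m vectors supported on the first m coordinates have different images: by the
  adjugate, the minor times the difference of two vectors with equal image is 0 modulo p, and p does
  not divide the minor.\<close>

lemma minors_not_vanish_im:
  assumes p: "prime p" and nv: "\<not> minors_vanish m p f"
  shows "p ^ m \<le> card (im_mod p (Suc m) (mat (Suc m) (Suc m) f))"
proof -
  have p0: "p > 0" using prime_gt_0_nat[OF p] .
  \<comment> \<open>The rows of a minor not divisible by p: those of \<open>minor2\<close> if p
    divides \<open>minor1\<close>, and those of \<open>minor1\<close> otherwise.\<close>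
  define \<rho> where "\<rho> i = (if int p dvd minor1 m f then (if Suc i = m then m else i) else i)" for i
  define B where "B = mat m m (\<lambda>(i, j). f (\<rho> i, j))"
  have B: "B \<in> carrier_mat m m" by (simp add: B_def)
  have \<rho>: "\<rho> i < Suc m" if "i < m" for i using that by (auto simp: \<rho>_def)
  have det: "\<not> int p dvd Determinant.det B"
  proof (cases "int p dvd minor1 m f")
    case True
    then have "B = mat m m (\<lambda>(i, j). f (if Suc i = m then m else i, j))" by (simp add: B_def \<rho>_def)
    then show ?thesis using nv True by (simp add: minors_vanish_def minor2_def)
  next
    case False
    then have "B = mat m m f" unfolding B_def by (intro cong_mat) (auto simp: \<rho>_def)
    then show ?thesis using False by (simp add: minor1_def)
  qed
  define X where "X = int_funs {..<m} {0..<int p}"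
  define F where "F w = red_vec p (Suc m) (\<lambda>i. \<Sum>j<Suc m. mat (Suc m) (Suc m) f $$ (i, j) * w j)" for w
  have "inj_on F X"
  proof (rule inj_onI)
    fix w w' assume w: "w \<in> X" "w' \<in> X" "F w = F w'"
    define u where "u j = w j - w' j" for j
    have Bu: "int p dvd (\<Sum>j<m. B $$ (i, j) * u j)" if i: "i < m" for i
    proof -
      have r: "\<rho> i < Suc m" using \<rho>[OF i] .
      \<comment> \<open>The default value 0 at index m removes the last column from the
        sums.\<close>
      have "w m = 0" "w' m = 0" using w by (auto simp: X_def PiE_dflt_def)
      moreover have "F w (\<rho> i) = F w' (\<rho> i)" using w by simp
      ultimately have "[(\<Sum>j<m. f (\<rho> i, j) * w j) = (\<Sum>j<m. f (\<rho> i, j) * w' j)] (mod int p)"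
        using r by (simp add: F_def red_vec_def cong_def)
      then have "int p dvd (\<Sum>j<m. f (\<rho> i, j) * w j) - (\<Sum>j<m. f (\<rho> i, j) * w' j)"
        by (simp add: cong_iff_dvd_diff)
      then show ?thesis using i by (simp add: B_def u_def right_diff_distrib sum_subtractf)
    qed
    show "w = w'"
    proof
      fix k
      show "w k = w' k"
      proof (cases "k < m")
        case True
        have adj: "adj_mat B \<in> carrier_mat m m" "adj_mat B * B = Determinant.det B \<cdot>\<^sub>m 1\<^sub>m m"
          using adj_mat[OF B] by auto
        have "(\<Sum>i<m. adj_mat B $$ (k, i) * (\<Sum>j<m. B $$ (i, j) * u j)) = (\<Sum>j<m. (adj_mat B * B) $$ (k, j) * u j)"
          by (rule sum_mult_mat[OF adj(1) B True, symmetric])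
        also have "\<dots> = (\<Sum>j<m. if j = k then Determinant.det B * u k else 0)"
          unfolding adj(2) using True by (intro sum.cong) auto
        also have "\<dots> = Determinant.det B * u k" using True by simp
        finally have "int p dvd Determinant.det B * u k"
          by (rule subst) (intro dvd_sum dvd_mult Bu, simp)
        then have "int p dvd u k"
          using det p by (metis prime_dvd_mult_iff prime_nat_int_transfer)
        then have "[w k = w' k] (mod int p)" by (simp add: u_def cong_iff_dvd_diff)
        then show ?thesis using w True by (auto simp: X_def PiE_dflt_def cong_def)
      next
        case False
        then show ?thesis using w by (simp add: X_def PiE_dflt_def)
      qed
    qed
  qed
  moreover have "F ` X \<subseteq> im_mod p (Suc m) (mat (Suc m) (Suc m) f)"
    by (auto simp: F_def im_mod_def)
  ultimately have "card X \<le> card (im_mod p (Suc m) (mat (Suc m) (Suc m) f))"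
    using card_inj_on_le finite_im_mod[OF p0] by blast
  then show ?thesis by (simp add: X_def card_PiE_dflt)
qed

section \<open>Pairs of linear congruences, and the density of the large primes\<close>

lemma card_roots_le:
  assumes p: "prime p" and u: "\<not> int p dvd u"
  shows "card {x \<in> {- int k..int k}. int p dvd u * x + c} \<le> (2 * k + 1) div p + 1"
proof (cases "{x \<in> {- int k..int k}. int p dvd u * x + c} = {}")
  case False
  then obtain x0 where x0: "int p dvd u * x0 + c" by blast
  have "{x \<in> {- int k..int k}. int p dvd u * x + c} \<subseteq> {x \<in> {- int k..int k}. x mod int p = x0 mod int p}"
  proof safe
    fix x assume "int p dvd u * x + c"
    then have "int p dvd (u * x + c) - (u * x0 + c)" using x0 by (rule dvd_diff)
    then have "int p dvd u * (x - x0)" by (simp add: algebra_simps)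
    then have "int p dvd x - x0" using u p by (metis prime_dvd_mult_iff prime_nat_int_transfer)
    then show "x mod int p = x0 mod int p" by (simp add: mod_eq_dvd_iff)
  qed
  then have "card {x \<in> {- int k..int k}. int p dvd u * x + c} \<le> card {x \<in> {- int k..int k}. x mod int p = x0 mod int p}"
    by (intro card_mono finite_subset[of "{x \<in> {- int k..int k}. x mod int p = x0 mod int p}" "{- int k..int k}"]) auto
  also have "\<dots> \<le> (2 * k + 1) div p + 1"
    by (rule card_residue_le) (use prime_gt_0_nat[OF p] in auto)
  finally show ?thesis .
next
  case True
  then show ?thesis by (metis card.empty le0)
qed

text \<open>Distinct primes are coprime, so the product of those in question divides w. If there are
  s of them, then N^s \<le> |w| \<le> K N^m \<le> N^(K+m), since K \<le> 2^K \<le> N^K.\<close>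

lemma card_large_prime_divisors:
  assumes w: "w \<noteq> (0::int)" and N: "2 \<le> N" and bound: "\<bar>w\<bar> \<le> int K * int N ^ m"
  shows "finite {p. prime p \<and> N < p \<and> int p dvd w}" "card {p. prime p \<and> N < p \<and> int p dvd w} \<le> K + m"
proof -
  define F where "F = {p. prime p \<and> N < p \<and> int p dvd w}"
  have dvd: "p dvd nat \<bar>w\<bar>" if "p \<in> F" for p using that by (simp add: F_def flip: int_dvd_int_iff)
  have w0: "nat \<bar>w\<bar> > 0" using w by simp
  have fin: "finite F"
    by (rule finite_subset[of _ "{..nat \<bar>w\<bar>}"]) (use dvd w0 dvd_imp_le in auto)
  then show "finite {p. prime p \<and> N < p \<and> int p dvd w}" by (simp add: F_def)
  have prime: "prime p" if "p \<in> F" for p using that by (simp add: F_def)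
  have "\<Prod>F dvd nat \<bar>w\<bar>"
    using fin dvd prime
  proof (induction F rule: finite_induct)
    case (insert p G)
    have "coprime p (\<Prod>G)"
      using insert by (intro prod_coprime_right) (metis insertCI primes_coprime)
    then have "p * \<Prod>G dvd nat \<bar>w\<bar>"
      using insert.IH insert.prems by (intro divides_mult) blast+
    moreover have "\<Prod>(insert p G) = p * \<Prod>G" using insert.hyps by simp
    ultimately show ?case by (simp only:)
  qed simp
  then have "\<Prod>F \<le> nat \<bar>w\<bar>" using w0 by (rule dvd_imp_le)
  moreover have "(\<Prod>p\<in>F. N) \<le> \<Prod>F" by (rule prod_mono) (auto simp: F_def)
  ultimately have "N ^ card F \<le> nat \<bar>w\<bar>" by simp
  also have "nat \<bar>w\<bar> \<le> K * N ^ m" using bound by (simp add: nat_le_iff)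
  also have "\<dots> \<le> N ^ K * N ^ m"
  proof (rule mult_right_mono)
    have "K \<le> 2 ^ K" by (rule less_imp_le[OF less_exp])
    also have "\<dots> \<le> N ^ K" using N by (rule power_mono) simp
    finally show "K \<le> N ^ K" .
  qed simp
  finally have "N ^ card F \<le> N ^ (K + m)" by (simp add: power_add)
  then have "card F \<le> K + m" using N by (simp add: power_le_imp_le_exp)
  then show "card {p. prime p \<and> N < p \<and> int p dvd w} \<le> K + m" by (simp add: F_def)
qed


definition square_tail :: "nat \<Rightarrow> real" where
  "square_tail B = (\<Sum>i. 1 / real (i + Suc B) ^ 2)"

lemma summable_inverse_squares: "summable (\<lambda>i. 1 / real i ^ 2)"
  using inverse_power_summable[of 2, where 'a = real] by (simp add: inverse_eq_divide)

lemma square_tail_tendsto: "square_tail \<longlonglongrightarrow> 0"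
proof -
  have "(\<lambda>B. \<Sum>i. 1 / real (i + B) ^ 2) \<longlonglongrightarrow> 0"
    by (rule suminf_exist_split2[OF summable_inverse_squares])
  then show ?thesis unfolding square_tail_def by (rule LIMSEQ_Suc)
qed

lemma sum_le_square_tail: "(\<Sum>p\<in>{Suc B..N}. 1 / real p ^ 2) \<le> square_tail B"
proof -
  have "(\<Sum>p\<in>{Suc B..N}. 1 / real p ^ 2) = (\<Sum>i<Suc N - Suc B. 1 / real (i + Suc B) ^ 2)"
    by (rule sum.reindex_bij_witness[of _ "\<lambda>i. i + Suc B" "\<lambda>p. p - Suc B"]) auto
  also have "\<dots> \<le> square_tail B"
    unfolding square_tail_def
    by (rule sum_le_suminf[OF summable_ignore_initial_segment[OF summable_inverse_squares]]) auto
  finally show ?thesis .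
qed

text \<open>Every pair has one of three causes. For p \<le> N each congruence has at most N/p + 1
  \<le> 2N/p solutions, hence there are at most 4N^2/p^2 pairs. The equation u x + c = 0 with
  nonzero u leaves at most one x and N values of y. Otherwise some p > N divides a nonzero value u x
  + c: there are at most K + m such primes for each x, and at most one y for each prime.\<close>

lemma card_bad_pairs:
  fixes u c d :: int
  assumes k: "1 \<le> k" and A: "A = {- int k..int k}" and N: "N = 2 * k + 1"
    and bound: "\<And>x. x \<in> A \<Longrightarrow> \<bar>u * x + c\<bar> \<le> int K * int N ^ m"
  shows "real (card {(x, y) \<in> A \<times> A. \<exists>p. prime p \<and> B < p \<and> \<not> int p dvd u \<and> int p dvd u * x + c \<and> int p dvd u * y + d})
    \<le> 4 * real N ^ 2 * square_tail B + real N * real (1 + K + m)" (is "real (card ?S) \<le> _")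
proof -
  define R where "R p c = {x \<in> A. int p dvd u * x + c}" for p c
  define P where "P = {p \<in> {Suc B..N}. prime p \<and> \<not> int p dvd u}"
  define L where "L x = {p. prime p \<and> N < p \<and> int p dvd u * x + c}" for x
  define S1 where "S1 = (\<Union>p\<in>P. R p c \<times> R p d)"
  define S2 where "S2 = (if u = 0 then {} else {x \<in> A. u * x + c = 0} \<times> A)"
  define S3 where "S3 = (SIGMA x:{x \<in> A. u * x + c \<noteq> 0}. \<Union>p\<in>{p \<in> L x. \<not> int p dvd u}. R p d)"
  have finA: "finite A" and cardA: "card A = N" unfolding A N by simp_all
  have finR: "finite (R p c)" for p c
    by (rule finite_subset[OF _ finA]) (auto simp: R_def)
  have finP: "finite P" by (rule finite_subset[of _ "{Suc B..N}"]) (auto simp: P_def)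
  have card_R: "card (R p e) \<le> N div p + 1" if "prime p" "\<not> int p dvd u" for p e
    unfolding R_def A N by (rule card_roots_le[OF that])
  have N2: "2 \<le> N" using k N by simp
  have "?S
      \<subseteq> S1 \<union> (S2 \<union> S3)"
  proof
    fix z assume "z \<in> ?S"
    then obtain x y p where z: "z = (x, y)" and xy: "x \<in> A" "y \<in> A" and p: "prime p" "B < p" "\<not> int p dvd u"
      "int p dvd u * x + c" "int p dvd u * y + d" by blast
    show "z \<in> S1 \<union> (S2 \<union> S3)"
    proof (cases "p \<le> N")
      case True
      then have "p \<in> P" using p by (simp add: P_def)
      then have "z \<in> S1" using z xy p by (auto simp: S1_def R_def)
      then show ?thesis by blast
    next
      case False
      have "u \<noteq> 0" using p(3) by auto
      show ?thesis
      proof (cases "u * x + c = 0")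
        case True
        then have "z \<in> S2" using z xy \<open>u \<noteq> 0\<close> by (auto simp: S2_def)
        then show ?thesis by blast
      next
        case nonzero: False
        have "p \<in> L x" using False p by (simp add: L_def)
        then have "z \<in> S3" using z xy p nonzero by (auto simp: S3_def R_def)
        then show ?thesis by blast
      qed
    qed
  qed
  moreover have fin1: "finite S1" unfolding S1_def using finP finR by blast
  moreover have fin2: "finite S2" unfolding S2_def using finA by simp
  moreover have finL: "finite (L x)" "card (L x) \<le> K + m" if "x \<in> A" "u * x + c \<noteq> 0" for x
    unfolding L_def using card_large_prime_divisors[OF that(2) N2 bound[OF that(1)]] by simp_all
  have finU: "finite (\<Union>p\<in>{p \<in> L x. \<not> int p dvd u}. R p d)" if "x \<in> {x \<in> A. u * x + c \<noteq> 0}" for x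
    using finL(1)[of x] that finR by auto
  have finA': "finite {x \<in> A. u * x + c \<noteq> 0}" using finA by simp
  have fin3: "finite S3" unfolding S3_def by (intro finite_SigmaI finA' finU)
  ultimately have "card ?S
      \<le> card (S1 \<union> (S2 \<union> S3))"
    by (intro card_mono) simp_all
  also have "\<dots> \<le> card S1 + (card S2 + card S3)"
    by (rule order_trans[OF card_Un_le add_left_mono[OF card_Un_le]])
  finally have total: "card ?S
      \<le> card S1 + (card S2 + card S3)" .
  have "real (card S1) \<le> 4 * real N ^ 2 * square_tail B"
  proof -
    have "card S1 \<le> (\<Sum>p\<in>P. card (R p c \<times> R p d))"
      unfolding S1_def by (rule card_UN_le[OF finP])
    then have "real (card S1) \<le> (\<Sum>p\<in>P. real (card (R p c)) * real (card (R p d)))"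
      unfolding card_cartesian_product by (simp flip: of_nat_mult of_nat_sum)
    also have "\<dots> \<le> (\<Sum>p\<in>P. 4 * real N ^ 2 * (1 / real p ^ 2))"
    proof (rule sum_mono)
      fix p assume p: "p \<in> P"
      then have p0: "0 < real p" "real p \<le> real N" by (auto simp: P_def)
      have "real (card (R p e)) \<le> 2 * real N / real p" for e
      proof -
        have "real (card (R p e)) \<le> real (N div p) + 1" using card_R[of p e] p by (auto simp: P_def)
        also have "real (N div p) \<le> real N / real p" by (rule of_nat_div_le_of_nat)
        also have "1 \<le> real N / real p" using p0 by simp
        finally show ?thesis by simp
      qed
      then have "real (card (R p c)) * real (card (R p d)) \<le> (2 * real N / real p) * (2 * real N / real p)"
        by (intro mult_mono) auto
      then show "real (card (R p c)) * real (card (R p d)) \<le> 4 * real N ^ 2 * (1 / real p ^ 2)"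
        by (simp add: power2_eq_square)
    qed
    also have "\<dots> \<le> (\<Sum>p\<in>{Suc B..N}. 4 * real N ^ 2 * (1 / real p ^ 2))"
      by (rule sum_mono2) (auto simp: P_def)
    also have "\<dots> = 4 * real N ^ 2 * (\<Sum>p\<in>{Suc B..N}. 1 / real p ^ 2)" by (simp only: sum_distrib_left)
    also have "\<dots> \<le> 4 * real N ^ 2 * square_tail B"
      by (intro mult_left_mono sum_le_square_tail) simp
    finally show ?thesis .
  qed
  moreover have "card S2 \<le> N"
  proof (cases "u = 0")
    case False
    have "card {x \<in> A. u * x + c = 0} \<le> Suc 0"
      using finA False by (subst card_le_Suc0_iff_eq) (auto, metis add_right_cancel mult_left_cancel)
    then have "card {x \<in> A. u * x + c = 0} * card A \<le> Suc 0 * card A" by (rule mult_le_mono1)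
    then show ?thesis using False by (simp add: S2_def card_cartesian_product cardA)
  qed (simp add: S2_def)
  moreover have "card S3 \<le> N * (K + m)"
  proof -
    have "card S3 = (\<Sum>x\<in>{x \<in> A. u * x + c \<noteq> 0}. card (\<Union>p\<in>{p \<in> L x. \<not> int p dvd u}. R p d))"
      unfolding S3_def by (rule card_SigmaI) (use finA' finU in auto)
    also have "\<dots> \<le> (\<Sum>x\<in>{x \<in> A. u * x + c \<noteq> 0}. K + m)"
    proof (rule sum_mono)
      fix x assume x: "x \<in> {x \<in> A. u * x + c \<noteq> 0}"
      have finL': "finite {p \<in> L x. \<not> int p dvd u}" using finL(1)[of x] x by simp
      have "card (\<Union>p\<in>{p \<in> L x. \<not> int p dvd u}. R p d) \<le> (\<Sum>p\<in>{p \<in> L x. \<not> int p dvd u}. card (R p d))"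
        by (rule card_UN_le[OF finL'])
      also have "\<dots> \<le> (\<Sum>p\<in>{p \<in> L x. \<not> int p dvd u}. 1)"
      proof (rule sum_mono)
        fix p assume p: "p \<in> {p \<in> L x. \<not> int p dvd u}"
        then have "N div p = 0" by (simp add: L_def)
        then show "card (R p d) \<le> 1" using card_R[of p d] p by (simp add: L_def)
      qed
      also have "\<dots> = card {p \<in> L x. \<not> int p dvd u}" by simp
      also have "\<dots> \<le> card (L x)" using finL(1)[of x] x by (intro card_mono) auto
      also have "\<dots> \<le> K + m" using finL(2)[of x] x by simp
      finally show "card (\<Union>p\<in>{p \<in> L x. \<not> int p dvd u}. R p d) \<le> K + m" .
    qed
    also have "\<dots> = card {x \<in> A. u * x + c \<noteq> 0} * (K + m)" by simp
    also have "\<dots> \<le> card A * (K + m)" using finA by (intro mult_right_mono card_mono) auto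
    finally show ?thesis by (simp add: cardA)
  qed
  then have "real (card S3) \<le> real N * real (K + m)" unfolding of_nat_mult[symmetric] of_nat_le_iff .
  ultimately show ?thesis using total by (simp add: distrib_left)
qed

lemma card_two_coordinates:
  fixes A :: "int set"
  assumes I: "finite I" "e1 \<in> I" "e2 \<in> I" "e1 \<noteq> e2" and A: "finite A"
    and bound: "\<And>g. g \<in> PiE_dflt (I - {e1, e2}) 0 (\<lambda>_. A) \<Longrightarrow>
      real (card {(x, y) \<in> A \<times> A. E (g(e1 := x, e2 := y))}) \<le> c"
  shows "real (card {f \<in> int_funs I A. E f}) \<le> real (card A) ^ (card I - 2) * c"
proof -
  define J where "J = PiE_dflt (I - {e1, e2}) 0 (\<lambda>_. A)"
  define T where "T = Sigma J (\<lambda>g. {(x, y) \<in> A \<times> A. E (g(e1 := x, e2 := y))})"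
  define \<Phi> where "\<Phi> f = (f(e1 := 0, e2 := 0), f e1, f e2)" for f :: "_ \<Rightarrow> int"
  have restore: "(f(e1 := 0, e2 := 0))(e1 := f e1, e2 := f e2) = f" for f :: "_ \<Rightarrow> int"
    using I(4) by (auto simp: fun_eq_iff)
  have finJ: "finite J" unfolding J_def using I A by auto
  have fin: "finite {(x, y) \<in> A \<times> A. E (g(e1 := x, e2 := y))}" for g
    by (rule finite_subset[of _ "A \<times> A"]) (use A in auto)
  have "inj_on \<Phi> X" for X
  proof (rule inj_onI)
    fix f g assume "\<Phi> f = \<Phi> g"
    then have "f(e1 := 0, e2 := 0) = g(e1 := 0, e2 := 0)" "f e1 = g e1" "f e2 = g e2"
      by (simp_all only: \<Phi>_def prod.inject)
    then show "f = g" using restore by metis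
  qed
  moreover have "\<Phi> ` {f \<in> int_funs I A. E f} \<subseteq> T"
  proof
    fix w assume "w \<in> \<Phi> ` {f \<in> int_funs I A. E f}"
    then obtain f where f: "f \<in> int_funs I A" "E f" "w = \<Phi> f" by blast
    have "f(e1 := 0, e2 := 0) \<in> J" using f(1) by (auto simp: J_def PiE_dflt_def)
    moreover have "f e1 \<in> A" "f e2 \<in> A" using f(1) I by (auto simp: PiE_dflt_def)
    moreover have "E ((f(e1 := 0, e2 := 0))(e1 := f e1, e2 := f e2))" unfolding restore by (rule f(2))
    ultimately show "w \<in> T"
      unfolding f(3) \<Phi>_def T_def by (simp only: mem_Sigma_iff mem_Collect_eq case_prod_conv simp_thms)
  qed
  moreover have "finite T" unfolding T_def using finJ fin by blast
  ultimately have "card {f \<in> int_funs I A. E f} \<le> card T" by (metis card_inj_on_le)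
  also have "card T = (\<Sum>g\<in>J. card {(x, y) \<in> A \<times> A. E (g(e1 := x, e2 := y))})"
    unfolding T_def by (rule card_SigmaI) (use finJ fin in auto)
  finally have "real (card {f \<in> int_funs I A. E f})
      \<le> (\<Sum>g\<in>J. real (card {(x, y) \<in> A \<times> A. E (g(e1 := x, e2 := y))}))"
    by (simp flip: of_nat_sum)
  also have "\<dots> \<le> (\<Sum>g\<in>J. c)" by (rule sum_mono) (use bound in \<open>simp add: J_def\<close>)
  also have "\<dots> = real (card J) * c" by simp
  also have "card J = card A ^ (card I - 2)"
  proof -
    have "card (I - {e1, e2}) = card I - 2" using I by (subst card_Diff_subset) auto
    then show ?thesis unfolding J_def using I A by (subst card_PiE_dflt) auto
  qed
  finally show ?thesis by simp
qed

text \<open>The bound of \<open>card_bad_pairs\<close> for minors of size at most n. By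
  \<open>det_bound\<close> their values are at most n! N^n, so n! and n take the places of K and
  m.\<close>

definition pair_bound :: "nat \<Rightarrow> nat \<Rightarrow> nat \<Rightarrow> real" where
  "pair_bound B n N = 4 * real N ^ 2 * square_tail B + real N * real (1 + fact n + n)"

text \<open>The entries (m, j) and (m + 1, j) are the two free variables. The first minor is u x
  plus a constant and the second is u y plus a constant with the same coefficient u, because u
  involves only rows above row m.\<close>

lemma card_minors_vanish_step:
  assumes mn: "Suc m < n" and j: "j \<le> m" and k: "1 \<le> k" and A: "A = {- int k..int k}" and N: "N = 2 * k + 1"
  shows "real (card {f \<in> int_funs (square n) A. \<exists>p. prime p \<and> B < p \<and>
      \<not> int p dvd last_cofactor m f j \<and> int p dvd minor1 (Suc m) f \<and> int p dvd minor2 (Suc m) f})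
    \<le> real N ^ (n * n - 2) * pair_bound B n N" (is "real (card ?S) \<le> _")
proof -
  have cardA: "card A = N" and finA: "finite A" unfolding A N by simp_all
  have e: "(m, j) \<in> square n" "(Suc m, j) \<in> square n" "(m, j) \<noteq> (Suc m, j)"
    using mn j by auto
  have "real (card ?S)
    \<le> real (card A) ^ (card (square n) - 2) * pair_bound B n N"
  proof (rule card_two_coordinates[OF _ e finA])
    fix g :: "nat \<times> nat \<Rightarrow> int"
    assume g: "g \<in> PiE_dflt (square n - {(m, j), (Suc m, j)}) 0 (\<lambda>_. A)"
    let ?h = "\<lambda>x y. g((m, j) := x, (Suc m, j) := y)"
    define u where "u = last_cofactor m g j"
    have lc: "last_cofactor m (?h x y) i = last_cofactor m g i" for x y i
      by (rule last_cofactor_cong) auto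
    have g0: "g (m, j) = 0" "g (Suc m, j) = 0" using g by (auto simp: PiE_dflt_def)
    have m1: "minor1 (Suc m) (?h x y) = u * x + minor1 (Suc m) g" for x y
    proof -
      have "minor1 (Suc m) (?h x y) = (\<Sum>i\<le>m. ?h x y (m, i) * last_cofactor m g i)"
        unfolding minor1_Suc lc ..
      also have "\<dots> = (\<Sum>i\<le>m. (if i = j then u * x else 0) + g (m, i) * last_cofactor m g i)"
        by (rule sum.cong) (auto simp: u_def g0)
      finally show ?thesis using j by (simp add: sum.distrib minor1_Suc)
    qed
    have m2: "minor2 (Suc m) (?h x y) = u * y + minor2 (Suc m) g" for x y
    proof -
      have "minor2 (Suc m) (?h x y) = (\<Sum>i\<le>m. ?h x y (Suc m, i) * last_cofactor m g i)"
        unfolding minor2_Suc lc ..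
      also have "\<dots> = (\<Sum>i\<le>m. (if i = j then u * y else 0) + g (Suc m, i) * last_cofactor m g i)"
        by (rule sum.cong) (auto simp: u_def g0)
      finally show ?thesis using j by (simp add: sum.distrib minor2_Suc)
    qed
    have "real (card {(x, y) \<in> A \<times> A. \<exists>p. prime p \<and> B < p \<and> \<not> int p dvd u \<and>
        int p dvd u * x + minor1 (Suc m) g \<and> int p dvd u * y + minor2 (Suc m) g})
      \<le> pair_bound B n N"
      unfolding pair_bound_def
    proof (rule card_bad_pairs[OF k A N])
      fix x assume x: "x \<in> A"
      \<comment> \<open>The first minor does not involve row m + 1, so 0 may stand for the second
        variable.\<close>
      have "\<bar>minor1 (Suc m) (?h x 0)\<bar> \<le> fact (Suc m) * int k ^ Suc m"
        unfolding minor1_def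
      proof (rule det_bound)
        fix i i' assume i: "i < Suc m" "i' < Suc m"
        have "?h x 0 (i, i') \<in> A"
        proof (cases "(i, i') = (m, j)")
          case False
          then have "(i, i') \<in> square n - {(m, j), (Suc m, j)}" using i mn by auto
          then have "g (i, i') \<in> A" using g by (auto simp: PiE_dflt_def)
          then show ?thesis using False i by auto
        qed (use x in auto)
        then show "\<bar>mat (Suc m) (Suc m) (?h x 0) $$ (i, i')\<bar> \<le> int k" using i unfolding A by auto
      qed simp
      also have "\<dots> \<le> fact n * int N ^ n"
      proof (rule mult_mono)
        show "(fact (Suc m) :: int) \<le> fact n" using mn by (intro fact_mono) simp
        have "int k ^ Suc m \<le> int N ^ Suc m" by (rule power_mono) (use N in auto)
        also have "\<dots> \<le> int N ^ n" by (rule power_increasing) (use mn N in auto)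
        finally show "int k ^ Suc m \<le> int N ^ n" .
      qed auto
      finally show "\<bar>u * x + minor1 (Suc m) g\<bar> \<le> int (fact n) * int N ^ n"
        unfolding m1 by (simp only: of_nat_fact)
    qed
    then show "real (card {(x, y) \<in> A \<times> A. \<exists>p. prime p \<and> B < p \<and> \<not> int p dvd last_cofactor m (?h x y) j \<and>
        int p dvd minor1 (Suc m) (?h x y) \<and> int p dvd minor2 (Suc m) (?h x y)})
      \<le> pair_bound B n N"
      unfolding m1 m2 lc u_def[symmetric] .
  qed simp
  then show ?thesis by (simp add: cardA)
qed

text \<open>Either the minors of the transposed smaller block vanish too, which is the induction
  hypothesis after \<open>prod.swap\<close>, or some coefficient is not divisible by p. The latter
  costs m + 1 \<le> n instances of \<open>card_minors_vanish_step\<close> in the step from m to m +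
  1, which explains the factor m n.\<close>

lemma card_minors_vanish:
  assumes mn: "m < n" and k: "1 \<le> k" and A: "A = {- int k..int k}" and N: "N = 2 * k + 1"
  shows "real (card {f \<in> int_funs (square n) A. minors_vanish_above B m f})
    \<le> real (m * n) * (real N ^ (n * n - 2) * pair_bound B n N)"
  using mn
proof (induction m)
  case 0
  have "{f \<in> int_funs (square n) A. minors_vanish_above B 0 f} = {}"
    using minors_vanish_0 unfolding minors_vanish_above_def by blast
  then show ?case by (simp only:) simp
next
  case (Suc m)
  define X where "X = int_funs (square n) A"
  define D where "D = real N ^ (n * n - 2) * pair_bound B n N"
  define S where "S m = {f \<in> X. minors_vanish_above B m f}" for m
  define S' where "S' = {f \<in> X. minors_vanish_above B m (f \<circ> prod.swap)}"
  define T where "T j = {f \<in> X. \<exists>p. prime p \<and> B < p \<and> \<not> int p dvd last_cofactor m f j \<and>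
    int p dvd minor1 (Suc m) f \<and> int p dvd minor2 (Suc m) f}" for j
  have finX: "finite X" unfolding X_def A by auto
  have fin: "finite {f \<in> X. Q f}" for Q by (rule finite_subset[OF _ finX]) auto
  have "S (Suc m) \<subseteq> S' \<union> (\<Union>j\<in>{..m}. T j)"
  proof
    fix f assume "f \<in> S (Suc m)"
    then obtain p where p: "f \<in> X" "prime p" "B < p" "minors_vanish (Suc m) p f" by (auto simp: S_def minors_vanish_above_def)
    show "f \<in> S' \<union> (\<Union>j\<in>{..m}. T j)"
    proof (cases "minors_vanish m p (f \<circ> prod.swap)")
      case True
      then have "f \<in> S'" unfolding S'_def minors_vanish_above_def using p by blast
      then show ?thesis by blast
    next
      case False
      then obtain j where "j \<le> m" "\<not> int p dvd last_cofactor m f j"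
        using minors_vanish_Suc[OF p(2,4)] by blast
      then have "f \<in> T j" unfolding T_def using p by (auto simp: minors_vanish_def)
      then show ?thesis using \<open>j \<le> m\<close> by blast
    qed
  qed
  then have "card (S (Suc m)) \<le> card (S' \<union> (\<Union>j\<in>{..m}. T j))"
    by (intro card_mono finite_UnI finite_UN_I) (simp_all only: S'_def T_def fin finite_atMost)
  also have "\<dots> \<le> card S' + card (\<Union>j\<in>{..m}. T j)" by (rule card_Un_le)
  also have "card (\<Union>j\<in>{..m}. T j) \<le> (\<Sum>j\<in>{..m}. card (T j))" by (rule card_UN_le) simp
  finally have le: "real (card (S (Suc m))) \<le> real (card S') + (\<Sum>j\<in>{..m}. real (card (T j)))"
    by (simp flip: of_nat_sum of_nat_add)
  have "card S' \<le> card (S m)"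
  proof (rule card_inj_on_le[of "\<lambda>f. f \<circ> prod.swap"])
    show "inj_on (\<lambda>f. f \<circ> prod.swap) S'"
    proof (rule inj_onI)
      fix f g :: "nat \<times> nat \<Rightarrow> int" assume "f \<circ> prod.swap = g \<circ> prod.swap"
      then have "(f \<circ> prod.swap) \<circ> prod.swap = (g \<circ> prod.swap) \<circ> prod.swap" by simp
      then show "f = g" by (simp add: fun_eq_iff)
    qed
    show "(\<lambda>f. f \<circ> prod.swap) ` S' \<subseteq> S m"
      by (auto simp: S'_def S_def X_def PiE_dflt_def)
    show "finite (S m)" unfolding S_def by (rule fin)
  qed
  then have "real (card S') \<le> real (m * n) * D"
    using Suc unfolding S_def X_def D_def by linarith
  moreover have "(\<Sum>j\<in>{..m}. real (card (T j))) \<le> (\<Sum>j\<in>{..m}. D)"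
    unfolding T_def X_def D_def
    by (intro sum_mono card_minors_vanish_step[OF Suc.prems _ k A N]) simp
  moreover have "(\<Sum>j\<in>{..m}. D) \<le> real n * D"
  proof -
    have "0 \<le> square_tail B"
      unfolding square_tail_def
      by (rule suminf_nonneg[OF summable_ignore_initial_segment[OF summable_inverse_squares]]) simp
    then have "0 \<le> D" unfolding D_def pair_bound_def by simp
    then have "real (Suc m) * D \<le> real n * D" using Suc.prems by (intro mult_right_mono) auto
    then show ?thesis by simp
  qed
  ultimately have "real (card (S (Suc m))) \<le> real (m * n) * D + real n * D" using le by linarith
  also have "\<dots> = real (Suc m * n) * D" by (simp add: algebra_simps)
  finally show ?case unfolding S_def X_def D_def .
qed

lemma int_density_minors_vanish:
  assumes mn: "m < n" and k: "1 \<le> k"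
  shows "int_density (square n) {- int k..int k} (minors_vanish_above B m)
    \<le> real (m * n) * (4 * square_tail B + real (1 + fact n + n) / real (2 * k + 1))"
proof (cases "m = 0")
  case True
  have "{f \<in> int_funs (square n) {- int k..int k}. minors_vanish_above B 0 f} = {}"
    using minors_vanish_0 unfolding minors_vanish_above_def by blast
  then show ?thesis unfolding int_density_def True by (simp only:) simp
next
  case False
  define N where "N = 2 * k + 1"
  have N0: "real N > 0" by (simp add: N_def)
  \<comment> \<open>A nonzero m forces n \<ge> 2, so n * n - 2 is not truncated.\<close>
  have "2 * 2 \<le> n * n" using mn False by (intro mult_le_mono) auto
  then have "n * n = (n * n - 2) + 2" by simp
  then have "real N ^ (n * n) = real N ^ (n * n - 2) * real N ^ 2"
    by (metis power_add)
  moreover have "card {- int k..int k} = N" by (simp add: N_def)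
  ultimately have "int_density (square n) {- int k..int k} (minors_vanish_above B m)
      \<le> real (m * n) * (real N ^ (n * n - 2) * pair_bound B n N)
        / (real N ^ (n * n - 2) * real N ^ 2)"
    unfolding int_density_def
    using divide_right_mono[OF card_minors_vanish[OF mn k refl N_def, of B], of "real N ^ (n * n)"] by simp
  also have "\<dots> = real (m * n) * (pair_bound B n N / real N ^ 2)"
    using N0 by simp
  also have "pair_bound B n N / real N ^ 2
      = 4 * square_tail B + real (1 + fact n + n) / real N"
    using N0 by (simp add: pair_bound_def add_divide_distrib power2_eq_square)
  finally show ?thesis by (simp add: N_def)
qed

section \<open>Densities\<close>

lemma int_density_mono:
  assumes "finite I" "finite A" "\<And>f. E f \<Longrightarrow> F f"
  shows "int_density I A E \<le> int_density I A F"
proof -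
  have "finite {f \<in> int_funs I A. F f}"
    by (rule finite_subset[of _ "int_funs I A"]) (use assms in auto)
  then have "card {f \<in> int_funs I A. E f} \<le> card {f \<in> int_funs I A. F f}"
    by (rule card_mono) (use assms(3) in auto)
  then show ?thesis unfolding int_density_def by (intro divide_right_mono) auto
qed

lemma int_density_disj:
  "int_density I A (\<lambda>f. E f \<or> F f) \<le> int_density I A E + int_density I A F"
proof -
  have "{f \<in> int_funs I A. E f \<or> F f} = {f \<in> int_funs I A. E f} \<union> {f \<in> int_funs I A. F f}"
    by auto
  then have "card {f \<in> int_funs I A. E f \<or> F f}
      \<le> card {f \<in> int_funs I A. E f} + card {f \<in> int_funs I A. F f}"
    by (simp only: card_Un_le)
  then have "real (card {f \<in> int_funs I A. E f \<or> F f})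
      \<le> real (card {f \<in> int_funs I A. E f}) + real (card {f \<in> int_funs I A. F f})"
    by linarith
  then show ?thesis unfolding int_density_def add_divide_distrib[symmetric] by (intro divide_right_mono) auto
qed

lemma prob_random_mat_density:
  assumes "finite A" "A \<noteq> {}"
  shows "measure_pmf.prob (random_mat n A) S = int_density (square n) A (\<lambda>f. mat n n f \<in> S)"
  by (simp add: prob_random_mat[OF assms] int_density_def card_cartesian_product)

section \<open>The density of the matrices whose Smith form lies in \<open>snf_T\<close>\<close>

definition rank_ge :: "nat \<Rightarrow> nat \<Rightarrow> nat \<Rightarrow> (nat \<times> nat \<Rightarrow> int) \<Rightarrow> bool" where
  "rank_ge n r p f \<longleftrightarrow> p ^ r \<le> card (im_mod p n (mat n n f))"

lemma periodic_rank_ge: "periodic p (rank_ge n r p)"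
proof -
  have "im_mod p n (mat n n f) = im_mod p n (mat n n (\<lambda>x. f x mod int p))" for f
    by (rule im_mod_cong) (simp add: mat_cong_def cong_def)
  then show ?thesis unfolding periodic_def rank_ge_def by metis
qed

lemma int_density_rank_ge:
  assumes "prime p" "l \<le> n"
  shows "int_density (square n) {0..<int p} (rank_ge n (n - l) p) = Zn n (real p) l"
  using prob_rank_ge[OF assms] prime_gt_0_nat[OF assms(1)]
  by (simp add: prob_random_mat_density rank_ge_def[abs_def])

lemma mu_box_snf_T:
  assumes "l \<le> n"
  shows "mu_box k n (snf_T n l)
    = int_density (square n) {- int k..int k} (\<lambda>f. \<forall>p. prime p \<longrightarrow> rank_ge n (n - l) p f)"
proof -
  have "mu_box k n (snf_T n l)
      = int_density (square n) {- int k..int k} (\<lambda>f. mat n n f \<in> {M. \<exists>D\<in>snf_T n l. is_snf n M D})"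
    unfolding mu_box_def by (rule prob_random_mat_density) auto
  also have "(\<lambda>f. mat n n f \<in> {M. \<exists>D\<in>snf_T n l. is_snf n M D}) = (\<lambda>f. \<forall>p. prime p \<longrightarrow> rank_ge n (n - l) p f)"
    using snf_in_snf_T_iff[OF _ assms] by (auto simp: rank_ge_def fun_eq_iff)
  finally show ?thesis .
qed

text \<open>Here l \<ge> 1 enters: a rank below n - l is below n - 1, which a minor of size n - 1
  not divisible by p would exclude.\<close>

lemma not_rank_ge_minors_vanish:
  assumes "prime p" "1 \<le> l" "l \<le> n" "\<not> rank_ge n (n - l) p f"
  shows "minors_vanish (n - 1) p f"
proof (rule ccontr)
  assume "\<not> minors_vanish (n - 1) p f"
  then have "p ^ (n - 1) \<le> card (im_mod p n (mat n n f))"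
    using minors_not_vanish_im[OF assms(1), of "n - 1" f] assms by simp
  moreover have "p ^ (n - l) \<le> p ^ (n - 1)"
    by (rule power_increasing) (use assms prime_gt_0_nat[OF assms(1)] in auto)
  ultimately show False using assms(4) unfolding rank_ge_def by linarith
qed

text \<open>The density d for all primes and the density e for the primes up to B satisfy d \<le> e
  \<le> d + t, where t is the density of matrices whose two minors have a common prime divisor above
  B.\<close>

lemma mu_box_tendsto:
  assumes l: "1 \<le> l" "l \<le> n"
  shows "(\<lambda>k. mu_box k n (snf_T n l)) \<longlonglongrightarrow> Zn_all n l"
proof -
  define I where "I = square n"
  define good where "good = rank_ge n (n - l)"
  define d where "d k = int_density I {- int k..int k} (\<lambda>f. \<forall>p. prime p \<longrightarrow> good p f)" for k
  define P where "P B = {p. prime p \<and> p \<le> B}" for B :: nat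
  define e where "e B k = int_density I {- int k..int k} (\<lambda>f. \<forall>p\<in>P B. good p f)" for B k
  define t where "t B k = int_density I {- int k..int k} (minors_vanish_above B (n - 1))" for B k
  define Q where "Q B = (\<Prod>p\<in>P B. Zn n (real p) l)" for B
  define C where "C = real ((n - 1) * n)"
  have finI: "finite I" by (simp add: I_def)
  have finP: "finite (P B)" for B by (rule finite_subset[of _ "{..B}"]) (auto simp: P_def)
  have d_le: "d k \<le> e B k" for B k
    unfolding d_def e_def by (rule int_density_mono[OF finI]) (auto simp: P_def)
  have e_le: "e B k \<le> d k + t B k" for B k
  proof -
    have "e B k \<le> int_density I {- int k..int k}
        (\<lambda>f. (\<forall>p. prime p \<longrightarrow> good p f) \<or> (minors_vanish_above B (n - 1) f))"
      unfolding e_def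
    proof (rule int_density_mono[OF finI])
      fix f assume f: "\<forall>p\<in>P B. good p f"
      show "(\<forall>p. prime p \<longrightarrow> good p f) \<or> (minors_vanish_above B (n - 1) f)"
      proof (rule disjCI, intro allI impI, rule ccontr)
        fix p assume no: "\<not> (minors_vanish_above B (n - 1) f)" and p: "prime p" "\<not> good p f"
        have "B < p"
        proof (rule ccontr)
          assume "\<not> B < p"
          then have "p \<in> P B" using p(1) by (simp add: P_def)
          then show False using f p(2) by blast
        qed
        moreover have "minors_vanish (n - 1) p f"
          using not_rank_ge_minors_vanish[OF p(1) l] p(2) by (simp add: good_def)
        ultimately show False using no p(1) unfolding minors_vanish_above_def by blast
      qed
    qed simp
    also have "\<dots> \<le> d k + t B k" unfolding d_def t_def by (rule int_density_disj)
    finally show ?thesis .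
  qed
  have t_le: "t B k \<le> C * (4 * square_tail B + real (1 + fact n + n) / real (2 * k + 1))" if "1 \<le> k" for B k
    unfolding t_def I_def C_def by (rule int_density_minors_vanish) (use l that in auto)
  have e_lim: "(\<lambda>k. e B k) \<longlonglongrightarrow> Q B" for B
  proof -
    have "(\<lambda>k. e B k) \<longlonglongrightarrow> (\<Prod>p\<in>P B. int_density I {0..<int p} (good p))"
      unfolding e_def
      by (rule density_box_primes_tendsto[OF finI finP]) (auto simp: P_def good_def periodic_rank_ge)
    also have "(\<Prod>p\<in>P B. int_density I {0..<int p} (good p)) = Q B"
      unfolding Q_def I_def good_def
      by (rule prod.cong) (auto simp: P_def int_density_rank_ge[OF _ l(2)])
    finally show ?thesis .
  qed
  have Q_lim: "Q \<longlonglongrightarrow> Zn_all n l"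
  proof -
    have "Q B = (\<Prod>i<Suc B. over_primes (\<lambda>p. Zn n (real p) l) i)" for B
    proof -
      have "(\<Prod>i<Suc B. over_primes (\<lambda>p. Zn n (real p) l) i) = (\<Prod>i\<in>P B. over_primes (\<lambda>p. Zn n (real p) l) i)"
        by (rule prod.mono_neutral_right) (auto simp: P_def over_primes_def)
      then show ?thesis by (simp add: Q_def P_def over_primes_def)
    qed
    moreover have "(\<lambda>B. \<Prod>i<Suc B. over_primes (\<lambda>p. Zn n (real p) l) i) \<longlonglongrightarrow> Zn_all n l"
      unfolding Zn_all_def by (rule LIMSEQ_Suc[OF unit_factors.tendsto[OF Zn_factors[OF l]]])
    ultimately show ?thesis by presburger
  qed
  have "d \<longlonglongrightarrow> Zn_all n l"
  proof (rule tendstoI)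
    fix \<epsilon> :: real assume "0 < \<epsilon>"
    then have \<epsilon>: "0 < \<epsilon> / 4" by simp
    \<comment> \<open>B is fixed first: it makes the part of the bound for t that is independent of
      the box small, and brings the finite product near its limit. The box size k is chosen
      afterwards, depending on B.\<close>
    have "(\<lambda>B. C * (4 * square_tail B)) \<longlonglongrightarrow> C * (4 * 0)"
      by (intro tendsto_intros square_tail_tendsto)
    then have "\<forall>\<^sub>F B in sequentially. C * (4 * square_tail B) < \<epsilon> / 4"
      by (rule order_tendstoD(2)) (use \<epsilon> in simp)
    then have "\<forall>\<^sub>F B in sequentially. C * (4 * square_tail B) < \<epsilon> / 4 \<and> dist (Q B) (Zn_all n l) < \<epsilon> / 4"
      using tendstoD[OF Q_lim \<epsilon>] by (rule eventually_conj)
    then obtain B where B: "C * (4 * square_tail B) < \<epsilon> / 4" "dist (Q B) (Zn_all n l) < \<epsilon> / 4"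
      unfolding eventually_sequentially by blast
    have "(\<lambda>k. C * (real (1 + fact n + n) / real (2 * k + 1))) \<longlonglongrightarrow> C * 0"
    proof (intro tendsto_mult tendsto_const)
      have "(\<lambda>k. real (1 + fact n + n) * (1 / real (2 * k + 1))) \<longlonglongrightarrow> real (1 + fact n + n) * 0"
        by (intro tendsto_mult tendsto_const) real_asymp
      then show "(\<lambda>k. real (1 + fact n + n) / real (2 * k + 1)) \<longlonglongrightarrow> 0" by simp
    qed
    then have "\<forall>\<^sub>F k in sequentially. C * (real (1 + fact n + n) / real (2 * k + 1)) < \<epsilon> / 4"
      by (rule order_tendstoD(2)) (use \<epsilon> in simp)
    then show "\<forall>\<^sub>F k in sequentially. dist (d k) (Zn_all n l) < \<epsilon>"
      using tendstoD[OF e_lim[of B] \<epsilon>] eventually_ge_at_top[of 1]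
    proof eventually_elim
      case (elim k)
      have "t B k \<le> C * (4 * square_tail B) + C * (real (1 + fact n + n) / real (2 * k + 1))"
        using t_le[OF elim(3), of B] unfolding distrib_left .
      then have "t B k < \<epsilon> / 2" using elim(1) B(1) by linarith
      moreover have "\<bar>e B k - Q B\<bar> < \<epsilon> / 4" "\<bar>Q B - Zn_all n l\<bar> < \<epsilon> / 4"
        using elim(2) B(2) by (simp_all add: dist_real_def)
      moreover have "d k \<le> e B k" "e B k \<le> d k + t B k" by (rule d_le, rule e_le)
      ultimately have "\<bar>d k - Zn_all n l\<bar> < \<epsilon>" by linarith
      then show ?case by (simp add: dist_real_def)
    qed
  qed
  then show ?thesis unfolding d_def I_def good_def mu_box_snf_T[OF l(2)] .
qed

lemma mu_snf_T: "1 \<le> l \<Longrightarrow> l \<le> n \<Longrightarrow> mu n (snf_T n l) = Zn_all n l"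
  unfolding mu_def by (rule limI[OF mu_box_tendsto])

lemma mu_tendsto:
  assumes "1 \<le> l"
  shows "(\<lambda>n. mu n (snf_T n l)) \<longlonglongrightarrow> Z_all l"
proof (rule Lim_transform_eventually[OF Zn_all_tendsto[OF assms]])
  show "\<forall>\<^sub>F n in sequentially. Zn_all n l = mu n (snf_T n l)"
    using eventually_ge_at_top[of l] by eventually_elim (rule mu_snf_T[OF assms, symmetric])
qed

lemma mu_mod_tendsto:
  assumes "prime p"
  shows "(\<lambda>n. mu_mod p n (snf_T n l)) \<longlonglongrightarrow> Z (real p) l"
proof (rule Lim_transform_eventually[OF Zn_tendsto_Z[OF prime_ge_2_real[OF assms]]])
  show "\<forall>\<^sub>F n in sequentially. Zn n (real p) l = mu_mod p n (snf_T n l)"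
    using eventually_ge_at_top[of l] by eventually_elim (simp add: mu_mod_snf_T assms)
qed

theorem theorem4p13:
  shows
  \<comment> \<open>(i)\<close>
  "(\<forall>n l. 1 \<le> l \<and> l \<le> n \<longrightarrow>
      convergent (\<lambda>k. mu_box k n (snf_T n l)) \<and>
      convergent_prod (over_primes (\<lambda>p. Zn n (real p) l)) \<and>
      convergent_prod (over_primes (\<lambda>p. Yn n (real p) l)) \<and>
      mu n (snf_T n l) = Zn_all n l \<and>
      Zn_all n l = 1 / (\<Prod>i=2..n. zeta (real i)) * prodinf (over_primes (\<lambda>p. Yn n (real p) l)) \<and>
      (\<forall>p. prime p \<longrightarrow>
         mu_mod p n (snf_T n l) = Zn n (real p) l \<and>
         Yn n (real p) l = qbr (real p) 1 *
           (\<Sum>i=0..l. 1 / real p ^ (i^2) * qbr (real p) n /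
                       ((qbr (real p) i)^2 * qbr (real p) (n - i)))))
   \<and>
   \<comment> \<open>(ii) and (iv) for every real \<open>q \<ge> 2\<close>, i.e. for all primes and all \<open>q = 1/x\<close> with \<open>0 < x \<le> 1/2\<close>\<close>
   (\<forall>q::real. q \<ge> 2 \<longrightarrow>
      convergent_prod (\<lambda>j. 1 - 1 / q ^ Suc j) \<and>
      (\<forall>l\<ge>1.
         increases_to l (\<lambda>n. Yn n q l) (Y q l) \<and>
         (\<lambda>n. Zn n q l) \<longlonglongrightarrow> qC q / qbr q 1 * Y q l \<and>
         qC q / qbr q 1 * Y q l = Z q l) \<and>
      increases_to 1 (\<lambda>l. Y q l) (qbr q 1 / qC q) \<and>
      increases_to 1 (\<lambda>l. Z q l) 1 \<and>
      (\<exists>E :: nat \<Rightarrow> real.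
         E \<in> O(\<lambda>l. 1 / q ^ (2 * l)) \<and>
         (\<forall>l\<ge>1.
            Z q l = 1 - 1 / qC q * (1 / q ^ ((l + 1)^2)) *
                        (1 - 2 / (q^2 - q) * (1 / q ^ l) + E l) \<and>
            0 < E l \<and> E l < 2 * (1 / q ^ (2 * l)))))
   \<and>
   (\<forall>p l. prime p \<and> 1 \<le> l \<longrightarrow>
      (\<lambda>n. mu_mod p n (snf_T n l)) \<longlonglongrightarrow> Z (real p) l)
   \<and>
   \<comment> \<open>(iii)\<close>
   convergent_prod (\<lambda>i. zeta (real (i + 2))) \<and>
   (\<forall>l\<ge>1.
      convergent_prod (over_primes (\<lambda>p. Y (real p) l)) \<and>
      convergent_prod (over_primes (\<lambda>p. Z (real p) l)) \<and>
      (\<lambda>n. mu n (snf_T n l)) \<longlonglongrightarrow> Z_all l \<and>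
      (\<lambda>n. Zn_all n l) \<longlonglongrightarrow> Z_all l \<and>
      1 / prodinf (\<lambda>i. zeta (real (i + 2))) * prodinf (over_primes (\<lambda>p. Y (real p) l)) = Z_all l) \<and>
   increases_to 1 (\<lambda>l. Z_all l) 1
   \<and>
   \<comment> \<open>(v); the first limit there is part of (iii)\<close>
   (\<exists>E :: nat \<Rightarrow> real.
      E \<in> O(\<lambda>l. 1 / 4 ^ l) \<and>
      (\<forall>l\<ge>1.
         Z_all l = 1 - 1 / qC 2 * (1 / 2 ^ ((l + 1)^2)) * (1 - 1 / 2 ^ l + E l))) \<and>
   \<bar>1 / qC 2 - 3.46275\<bar> < 0.000005"
proof (intro conjI allI impI)
  fix n l :: nat assume *: "1 \<le> l \<and> l \<le> n"
  then have l: "1 \<le> l" "l \<le> n" and n: "1 \<le> n" by simp_all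
  show "convergent (\<lambda>k. mu_box k n (snf_T n l))"
    using mu_box_tendsto[OF l] by (rule convergentI)
  show "convergent_prod (over_primes (\<lambda>p. Zn n (real p) l))"
    by (rule unit_factors.convergent[OF Zn_factors[OF l]])
  show "convergent_prod (over_primes (\<lambda>p. Yn n (real p) l))" by (rule convergent_prod_Yn[OF l])
  show "mu n (snf_T n l) = Zn_all n l" by (rule mu_snf_T[OF l])
  \<comment> \<open>Both the zeta product and the product of \<open>Yn\<close> are expressed through
    this number, which then cancels.\<close>
  have "prodinf (qbr_ratio n) \<noteq> 0"
    using unit_factors.prodinf_pos[OF ratio_factors[OF n]] by (rule less_imp_neq[symmetric])
  then show "Zn_all n l = 1 / (\<Prod>i=2..n. zeta (real i)) * prodinf (over_primes (\<lambda>p. Yn n (real p) l))"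
    unfolding prodinf_Yn[OF l] prodinf_ratio[OF n, symmetric] by simp
  fix p :: nat assume p: "prime p"
  show "mu_mod p n (snf_T n l) = Zn n (real p) l" by (rule mu_mod_snf_T[OF p l(2)])
  show "Yn n (real p) l = qbr (real p) 1 *
      (\<Sum>i=0..l. 1 / real p ^ (i^2) * qbr (real p) n / ((qbr (real p) i)^2 * qbr (real p) (n - i)))"
    unfolding Yn_def Zn_def using qbr_pos[OF prime_ge_2_real[OF p], of n] by simp
next
  fix q :: real assume q: "2 \<le> q"
  show "convergent_prod (\<lambda>j. 1 - 1 / q ^ Suc j)" by (rule unit_factors.convergent[OF unit_factors_qC[OF q]])
  show "increases_to l (\<lambda>n. Yn n q l) (Y q l)" for l by (rule Yn_increases_to_Y[OF q])
  show "(\<lambda>n. Zn n q l) \<longlonglongrightarrow> qC q / qbr q 1 * Y q l" for l unfolding Z_eq_Y[OF q] by (rule Zn_tendsto_Z[OF q])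
  show "qC q / qbr q 1 * Y q l = Z q l" for l by (rule Z_eq_Y[OF q])
  show "increases_to 1 (\<lambda>l. Y q l) (qbr q 1 / qC q)" by (rule Y_increases_to[OF q])
  show "increases_to 1 (\<lambda>l. Z q l) 1" by (rule Z_increases_to[OF q])
  show "\<exists>E :: nat \<Rightarrow> real. E \<in> O(\<lambda>l. 1 / q ^ (2 * l)) \<and>
      (\<forall>l\<ge>1. Z q l = 1 - 1 / qC q * (1 / q ^ ((l + 1)^2)) * (1 - 2 / (q^2 - q) * (1 / q ^ l) + E l) \<and>
        0 < E l \<and> E l < 2 * (1 / q ^ (2 * l)))"
    by (rule Z_expansion[OF q])
next
  show "(\<lambda>n. mu_mod p n (snf_T n l)) \<longlonglongrightarrow> Z (real p) l" if "prime p \<and> 1 \<le> l" for p l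
    using that by (blast intro: mu_mod_tendsto)
  show "convergent_prod (\<lambda>i. zeta (real (i + 2)))" by (rule convergent_prod_zeta)
next
  fix l :: nat assume l: "1 \<le> l"
  show "convergent_prod (over_primes (\<lambda>p. Y (real p) l))" by (rule convergent_prod_Y[OF l])
  show "convergent_prod (over_primes (\<lambda>p. Z (real p) l))"
    by (rule unit_factors.convergent[OF Z_factors[OF l]])
  show "(\<lambda>n. mu n (snf_T n l)) \<longlonglongrightarrow> Z_all l" by (rule mu_tendsto[OF l])
  show "(\<lambda>n. Zn_all n l) \<longlonglongrightarrow> Z_all l" by (rule Zn_all_tendsto[OF l])
  have "prodinf qC_ratio \<noteq> 0"
    using unit_factors.prodinf_pos[OF qC_ratio_factors] by (rule less_imp_neq[symmetric])
  then show "1 / prodinf (\<lambda>i. zeta (real (i + 2))) * prodinf (over_primes (\<lambda>p. Y (real p) l)) = Z_all l"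
    unfolding prodinf_Y[OF l] prodinf_zeta[symmetric] by simp
qed (rule Z_all_increases_to Z_all_expansion inverse_qC_2)+

end
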